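(* For each $0<\rho<1$ there exist finite positive constants $r_0(\rho), C(\rho), N_0(\rho)$ such that for all $N\ge N_0(\rho)$ and $r_0(\rho)\le r\le[(1-\rho)^2\wedge\rho^2]N^{1/3}$, $$\mathbb{P}^\rho\big\{\text{for all } z \text{ outside } [\![0,v_N]\!]\text{ we have } |\mathbf{Z}^{0\to z}|\ge rN^{2/3}\big\}\;\ge\; e^{-C(\rho)r^3}.$$
   Context: Notation: $e_1=(1,0)$, $e_2=(0,1)$; points of $\mathbb{Z}^2$ are ordered coordinatewise, $|x|_1=|x_1|+|x_2|$; $[\![a,b]\!]=\{x\in\mathbb{Z}^2:a\le x\le b\}$; $\mathrm{Exp}(\alpha)$ is the exponential distribution of rate $\alpha$. For $\rho\in(0,1)$ and a real scaling parameter $N>0$, $v_N=(\lfloor N(1-\rho)^2\rfloor,\lfloor N\rho^2\rfloor)$. Stationary last-passage percolation with base point $0$ and parameter $\rho$: under $\mathbb{P}^\rho$ the following weights are mutually independent: bulk weights $\omega_z\sim\mathrm{Exp}(1)$ for $z\in\mathbb{Z}_{>0}^2$, and boundary weights $I_{ke_1}\sim\mathrm{Exp}(1-\rho)$, $J_{le_2}\sim\mathrm{Exp}(\rho)$ for $k,l\in\mathbb{Z}_{>0}$. For $x\le y$ in $\mathbb{Z}_{>0}^2$, $G_{x,y}$ is the maximum of $\sum_{k=0}^{|y-x|_1}\omega_{z_k}$ over paths from $x$ to $y$ with steps in $\{e_1,e_2\}$. For $y=(m,n)\in\mathbb{Z}_{>0}^2$, $$G^\rho_{0,y}=\max_{1\le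 k\le m}\Big\{\sum_{i=1}^kI_{ie_1}+G_{ke_1+e_2,y}\Big\}\vee\max_{1\le l\le n}\Big\{\sum_{j=1}^lJ_{je_2}+G_{le_2+e_1,y}\Big\}.$$ The maximizer is almost surely unique. The exit time $\mathbf{Z}^{0\to y}\in\mathbb{Z}\setminus\{0\}$ is $k>0$ if the maximum is attained at the term $\sum_{i=1}^kI_{ie_1}+G_{ke_1+e_2,y}$, and $-l<0$ if it is attained at the term $\sum_{j=1}^lJ_{je_2}+G_{le_2+e_1,y}$. Points $z$ "outside $[\![0,v_N]\!]$" range over $\mathbb{Z}_{>0}^2\setminus[\![0,v_N]\!]$, where the exit time is defined. *)

theory Defs
  imports "HOL-Probability.Probability"
begin

text \<open>
  Points of the integer lattice are pairs of integers, ordered coordinatewise by the library's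
  product order, so \<open>{a..b}\<close> is the lattice rectangle with corners \<open>a\<close> and \<open>b\<close>.  (The strict
  product order is not coordinatewise strict, hence the explicit definition of the open quadrant.)
\<close>

definition pos_quadrant :: "(int \<times> int) set" where
  "pos_quadrant = {z. 0 < fst z \<and> 0 < snd z}"

definition up_right_paths :: "int \<times> int \<Rightarrow> int \<times> int \<Rightarrow> (int \<times> int) list set" where
  "up_right_paths x y = {\<pi>. \<pi> \<noteq> [] \<and> hd \<pi> = x \<and> last \<pi> = y \<and>
     successively (\<lambda>u v. v = u + (1, 0) \<or> v = u + (0, 1)) \<pi>}"

definition last_passage :: "(int \<times> int \<Rightarrow> real) \<Rightarrow> int \<times> int \<Rightarrow> int \<times> int \<Rightarrow> real" where
  "last_passage w x y = Max ((\<lambda>\<pi>. sum_list (map w \<pi>)) ` up_right_paths x y)"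

text \<open>
  All weights form one family indexed by the closed quadrant without the origin: \<open>w (k, 0)\<close> is the
  boundary weight \<open>I\<close> at \<open>k e\<^sub>1\<close>, \<open>w (0, l)\<close> is the boundary weight \<open>J\<close> at \<open>l e\<^sub>2\<close>, and \<open>w z\<close> is
  the bulk weight \<open>\<omega>\<close> at \<open>z\<close> in the open quadrant.
\<close>

definition weight_sites :: "(int \<times> int) set" where
  "weight_sites = {z. 0 \<le> z} - {0}"

definition weight_rate :: "real \<Rightarrow> int \<times> int \<Rightarrow> real" where
  "weight_rate \<rho> z = (if snd z = 0 then 1 - \<rho> else if fst z = 0 then \<rho> else 1)"

definition stationary_measure :: "real \<Rightarrow> (int \<times> int \<Rightarrow> real) measure" where
  "stationary_measure \<rho> =
     (\<Pi>\<^sub>M z\<in>weight_sites. density lborel (exponential_density (weight_rate \<rho> z)))"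

definition horizontal_exit :: "(int \<times> int \<Rightarrow> real) \<Rightarrow> int \<times> int \<Rightarrow> int \<Rightarrow> real" where
  "horizontal_exit w y k = (\<Sum>i=1..k. w (i, 0)) + last_passage w (k, 1) y"

definition vertical_exit :: "(int \<times> int \<Rightarrow> real) \<Rightarrow> int \<times> int \<Rightarrow> int \<Rightarrow> real" where
  "vertical_exit w y l = (\<Sum>j=1..l. w (0, j)) + last_passage w (1, l) y"

definition stationary_last_passage :: "(int \<times> int \<Rightarrow> real) \<Rightarrow> int \<times> int \<Rightarrow> real" where
  "stationary_last_passage w y =
     max (MAX k\<in>{1..fst y}. horizontal_exit w y k) (MAX l\<in>{1..snd y}. vertical_exit w y l)"

definition is_exit_time :: "(int \<times> int \<Rightarrow> real) \<Rightarrow> int \<times> int \<Rightarrow> int \<Rightarrow> bool" where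
  "is_exit_time w y k \<longleftrightarrow>
     (k \<in> {1..fst y} \<and> horizontal_exit w y k = stationary_last_passage w y) \<or>
     (- k \<in> {1..snd y} \<and> vertical_exit w y (- k) = stationary_last_passage w y)"

text \<open>
  The maximizer is almost surely unique under \<open>stationary_measure \<rho>\<close>; the choice operator only
  matters on the null event of a tie.
\<close>

definition exit_time :: "(int \<times> int \<Rightarrow> real) \<Rightarrow> int \<times> int \<Rightarrow> int" where
  "exit_time w y = (SOME k. is_exit_time w y k)"

definition char_point :: "real \<Rightarrow> real \<Rightarrow> int \<times> int" where
  "char_point \<rho> N = (\<lfloor>N * (1 - \<rho>)\<^sup>2\<rfloor>, \<lfloor>N * \<rho>\<^sup>2\<rfloor>)"

lemma is_exit_time_exit_time:
  assumes "y \<in> pos_quadrant"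
  shows "is_exit_time w y (exit_time w y)"
proof -
  have 1: "(MAX k\<in>{1..fst y}. horizontal_exit w y k) \<in> horizontal_exit w y ` {1..fst y}"
    using assms by (intro Max_in) (auto simp: pos_quadrant_def)
  have 2: "(MAX l\<in>{1..snd y}. vertical_exit w y l) \<in> vertical_exit w y ` {1..snd y}"
    using assms by (intro Max_in) (auto simp: pos_quadrant_def)
  have "\<exists>k. is_exit_time w y k"
  proof (cases "(MAX l\<in>{1..snd y}. vertical_exit w y l) \<le> (MAX k\<in>{1..fst y}. horizontal_exit w y k)")
    case True
    then have "stationary_last_passage w y = (MAX k\<in>{1..fst y}. horizontal_exit w y k)"
      by (simp add: stationary_last_passage_def max_def)
    with 1 obtain k where "k \<in> {1..fst y}" "horizontal_exit w y k = stationary_last_passage w y"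
      by (metis imageE)
    then show ?thesis
      unfolding is_exit_time_def by blast
  next
    case False
    then have "stationary_last_passage w y = (MAX l\<in>{1..snd y}. vertical_exit w y l)"
      by (simp add: stationary_last_passage_def max_def)
    with 2 obtain l where "l \<in> {1..snd y}" "vertical_exit w y l = stationary_last_passage w y"
      by (metis imageE)
    then have "is_exit_time w y (- l)"
      unfolding is_exit_time_def by (intro disjI2) simp
    then show ?thesis ..
  qed
  then show ?thesis
    unfolding exit_time_def by (rule someI_ex)
qed

lemma finite_up_right_paths: "finite (up_right_paths x y)"
proof -
  have len: "int (length \<pi>) = (fst y - fst x) + (snd y - snd x) + 1 \<and> set \<pi> \<subseteq> {x..y}"
    if "\<pi> \<in> up_right_paths x y" for \<pi> x
    using that
  proof (induction \<pi> arbitrary: x)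
    case Nil
    then show ?case by (simp add: up_right_paths_def)
  next
    case (Cons a \<pi>)
    show ?case
    proof (cases "\<pi> = []")
      case True
      with Cons.prems show ?thesis by (auto simp: up_right_paths_def)
    next
      case False
      with Cons.prems have a: "a = x" "\<pi> \<in> up_right_paths (hd \<pi>) y"
        "hd \<pi> = x + (1, 0) \<or> hd \<pi> = x + (0, 1)"
        by (auto simp: up_right_paths_def successively_Cons)
      note IH = Cons.IH[OF a(2)]
      have "x \<le> hd \<pi>"
        using a(3) by (auto simp: less_eq_prod_def)
      moreover have "hd \<pi> \<le> y"
        using IH hd_in_set[OF False] by auto
      ultimately have "set (a # \<pi>) \<subseteq> {x..y}"
        using IH a(1) by auto (metis atLeastAtMost_iff order_trans subsetD)+
      then show ?thesis
        using IH a by auto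
    qed
  qed
  have box: "{x..y} = {fst x..fst y} \<times> {snd x..snd y}"
    by (auto simp: less_eq_prod_def)
  have "up_right_paths x y \<subseteq>
      {\<pi>. set \<pi> \<subseteq> {x..y} \<and> length \<pi> = nat ((fst y - fst x) + (snd y - snd x) + 1)}"
    using len by fastforce
  then show ?thesis
    by (rule finite_subset) (intro finite_lists_length_eq, simp add: box)
qed

lemma weight_rate_pos:
  assumes "0 < \<rho>" "\<rho> < 1"
  shows "0 < weight_rate \<rho> z"
  using assms by (simp add: weight_rate_def)

lemma prob_space_stationary_measure:
  assumes "0 < \<rho>" "\<rho> < 1"
  shows "prob_space (stationary_measure \<rho>)"
  unfolding stationary_measure_def
  by (intro prob_space_PiM prob_space_exponential_density weight_rate_pos assms)

lemma distributed_weight: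
  assumes "0 < \<rho>" "\<rho> < 1" and z: "z \<in> weight_sites"
  shows "distributed (stationary_measure \<rho>) lborel (\<lambda>w. w z)
           (exponential_density (weight_rate \<rho> z))"
proof -
  let ?D = "\<lambda>z. density lborel (exponential_density (weight_rate \<rho> z))"
  have D: "prob_space (?D i)" for i
    by (intro prob_space_exponential_density weight_rate_pos assms)
  have "distr (stationary_measure \<rho>) lborel (\<lambda>w. w z) = distr (PiM weight_sites ?D) (?D z) (\<lambda>w. w z)"
    unfolding stationary_measure_def by (intro distr_cong) auto
  also have "\<dots> = ?D z"
    by (rule distr_PiM_component[OF D z])
  finally show ?thesis
    unfolding distributed_def stationary_measure_def
    using z measurable_component_singleton[OF z, of ?D] by (auto cong: measurable_cong_sets)
qed

lemma indep_vars_weights: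
  assumes "0 < \<rho>" "\<rho> < 1"
  shows "prob_space.indep_vars (stationary_measure \<rho>) (\<lambda>_. borel) (\<lambda>z w. w z) weight_sites"
proof -
  let ?D = "\<lambda>z. density lborel (exponential_density (weight_rate \<rho> z))"
  have D: "prob_space (?D i)" for i
    by (intro prob_space_exponential_density weight_rate_pos assms)
  interpret P: prob_space "stationary_measure \<rho>"
    by (rule prob_space_stationary_measure[OF assms])
  have rv: "(\<lambda>w. w z) \<in> borel_measurable (stationary_measure \<rho>)" if "z \<in> weight_sites" for z
    using measurable_component_singleton[OF that, of ?D]
    by (simp add: stationary_measure_def cong: measurable_cong_sets)
  have "(1, 0) \<in> weight_sites"
    by (simp add: weight_sites_def less_eq_prod_def zero_prod_def)
  then have ne: "weight_sites \<noteq> {}"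
    by blast
  have S: "sets (PiM weight_sites ?D) = sets (PiM weight_sites (\<lambda>_. borel))"
    by (intro sets_PiM_cong) auto
  have "distr (stationary_measure \<rho>) (PiM weight_sites (\<lambda>_. borel)) (\<lambda>w. restrict (\<lambda>z. w z) weight_sites)
      = distr (stationary_measure \<rho>) (stationary_measure \<rho>) (\<lambda>w. w)"
    by (intro distr_cong) (auto simp: S stationary_measure_def space_PiM)
  also have "\<dots> = PiM weight_sites ?D"
    by (simp add: distr_id2 stationary_measure_def)
  also have "\<dots> = PiM weight_sites (\<lambda>z. distr (stationary_measure \<rho>) borel (\<lambda>w. w z))"
  proof (intro PiM_cong refl)
    fix z assume z: "z \<in> weight_sites"
    have "?D z = distr (stationary_measure \<rho>) lborel (\<lambda>w. w z)"
      using distributed_weight[OF assms z] by (simp add: distributed_def)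
    also have "\<dots> = distr (stationary_measure \<rho>) borel (\<lambda>w. w z)"
      by (intro distr_cong) auto
    finally show "?D z = distr (stationary_measure \<rho>) borel (\<lambda>w. w z)" .
  qed
  finally show ?thesis
    using P.indep_vars_iff_distr_eq_PiM'[OF ne, of "\<lambda>z w. w z" "\<lambda>_. borel"] rv by auto
qed

end

theory Submission
  imports Defs
begin

text \<open>
  Write \<open>\<omega> = 1 - \<rho>\<close> and \<open>R = r N\<^bsup>2/3\<^esup>\<close>, and let \<open>v = (m, n)\<close> be \<open>v\<^sub>N + (1, 1)\<close>.

  Everything is read off at the single endpoint \<open>v\<close>.  Suppose some level \<open>t\<close> separates the exits
  towards \<open>v\<close>: every exit at distance less than \<open>R\<close> from the origin is worth at most \<open>t\<close>, while each
  of the two axes has an exit at distance at least \<open>R\<close> worth more than \<open>t\<close>.  Then no endpoint outside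
  \<open>\<lbrakk>0, v\<^sub>N\<rbrakk>\<close> has its exit within distance \<open>R\<close> (\<open>exit_time_ge_outside_box\<close>), because the difference of
  two passage times with ordered boundary increments is monotone in the endpoint.

  In the stationary environment no such level is likely, so the boundary weights at distance between
  \<open>R\<close> and a constant times \<open>R\<close> are made heavier by lowering their rates by \<open>\<delta> = a r N\<^bsup>-1/3\<^esup>\<close>.  About
  \<open>r N\<^bsup>2/3\<^esup>\<close> weights change, each by a relative amount of order \<open>r N\<^bsup>-1/3\<^esup>\<close>, so the second moment of
  the likelihood ratio is \<open>exp (O(r\<^sup>3))\<close>; an event that has probability at least \<open>1/2\<close> after the tilt
  has probability at least \<open>exp (- C r\<^sup>3)\<close> before it (\<open>tilt_cost\<close>).

  It remains to see that the tilt works with probability at least \<open>1/2\<close>, which needs passage times on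
  the scale \<open>N\<^bsup>1/3\<^esup>\<close>.  The main input is the identity
  \<open>E exp ((u - z) G) = (u / z)\<^sup>m ((1 - z) / (1 - u))\<^sup>n\<close> for rates \<open>u\<close> on the first axis and \<open>1 - z\<close> on
  the second (\<open>boundary_passage_mgf\<close>), a change of measure away from Burke's theorem.  For \<open>z < u\<close> it
  bounds the upper tail of \<open>G\<close>, for \<open>u < z\<close> the lower tail.  In both cases the exponent is \<open>N\<close> times an
  increment of a function with derivative \<open>1 + (v - \<omega>)\<^sup>2 / (v (1 - v))\<close>, so it is linear with slope one
  up to a cubic error, and parameters at distance of order \<open>r N\<^bsup>-1/3\<^esup>\<close> from \<open>\<omega>\<close> control \<open>G\<close> on the scale
  \<open>r\<^sup>2 N\<^bsup>1/3\<^esup>\<close> with error \<open>exp (- c r\<^sup>3)\<close>.  Taking the lower bound with the first axis at rate \<open>\<omega> - \<delta>\<close> and the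
  second at its stationary rate shows that the heavier axis alone reaches a level far above what the
  stationary exits reach; the roles of the axes may be exchanged.
  Two corrections restrict the extra weight to a finite window: what the first \<open>R\<close> sites would add is too
  small to matter, and exits beyond the window are excluded since, with the rates lowered by \<open>2 \<delta>\<close>, they
  would be worth more than the upper tail allows (\<open>tilted_exit_above_level\<close>).

  The tilt requires \<open>\<delta>\<close> to be smaller than the rates, that is, \<open>r\<close> at most a small multiple of
  \<open>N\<^bsup>1/3\<^esup>\<close>.  For larger \<open>r\<close> the number \<open>r\<^sup>3\<close> is comparable with \<open>N\<close>, and it suffices to add a multiple of
  \<open>N\<close> to one weight on each axis, which costs \<open>exp (- C N)\<close> (\<open>far_exits_lower_bound_large\<close>).
\<close>

section \<open>Product laws of exponential weights\<close>

abbreviation exp_law :: "real \<Rightarrow> real measure" where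
  "exp_law a \<equiv> density lborel (exponential_density a)"

text \<open>
  An arbitrary rate at every site puts the stationary, the tilted and all auxiliary environments on the
  same space of configurations.
\<close>

definition weights_law :: "(int \<times> int \<Rightarrow> real) \<Rightarrow> (int \<times> int \<Rightarrow> real) measure" where
  "weights_law \<alpha> = (\<Pi>\<^sub>M z\<in>weight_sites. exp_law (\<alpha> z))"

abbreviation configurations :: "(int \<times> int \<Rightarrow> real) measure" where
  "configurations \<equiv> (\<Pi>\<^sub>M z\<in>weight_sites. borel)"

lemma sets_weights_law [measurable_cong, simp]: "sets (weights_law \<alpha>) = sets configurations"
  unfolding weights_law_def by (intro sets_PiM_cong) auto

lemma space_weights_law [simp]: "space (weights_law \<alpha>) = space configurations"
  unfolding weights_law_def by (auto simp: space_PiM)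

lemma prob_space_weights_law:
  assumes "\<And>z. 0 < \<alpha> z"
  shows "prob_space (weights_law \<alpha>)"
  unfolding weights_law_def by (intro prob_space_PiM prob_space_exponential_density assms)

lemma measurable_resample:
  assumes "p \<in> weight_sites"
  shows "(\<lambda>(X, x). X(p := x)) \<in> configurations \<Otimes>\<^sub>M borel \<rightarrow>\<^sub>M configurations"
  using measurable_add_dim[of p weight_sites "\<lambda>_. borel :: real measure"] assms
  by (simp add: insert_absorb)

lemma measurable_update:
  assumes "p \<in> weight_sites" "f \<in> M \<rightarrow>\<^sub>M configurations" "g \<in> borel_measurable M"
  shows "(\<lambda>w. (f w)(p := g w)) \<in> M \<rightarrow>\<^sub>M configurations"
  using measurable_compose[OF measurable_Pair[OF assms(2,3)] measurable_resample[OF assms(1)]]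
  by simp

lemma measurable_redraw_integral:
  assumes "0 < a" "p \<in> weight_sites" "f \<in> borel_measurable configurations"
  shows "(\<lambda>X. \<integral>\<^sup>+ x. f (X(p := x)) \<partial>exp_law a) \<in> borel_measurable configurations"
proof -
  interpret E: prob_space "exp_law a" by (intro prob_space_exponential_density assms)
  show ?thesis
    using measurable_compose[OF measurable_resample[OF assms(2)] assms(3)]
    by (intro E.borel_measurable_nn_integral) (simp_all add: split_beta' cong: measurable_cong_sets)
qed

text \<open>
  Under a product law a single weight may be redrawn independently of all others.  After that the old value
  at \<open>p\<close> is irrelevant, so the rate under which it was drawn may be any \<open>\<alpha> p\<close>.  This reduces rate changes,
  shifts and Burke's theorem to integrals over one or three real variables.
\<close>

lemma nn_integral_weights_law_resample:
  assumes pos: "\<And>z. 0 < \<alpha> z" "\<And>z. 0 < \<beta> z" and p: "p \<in> weight_sites"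
    and off: "\<And>z. z \<noteq> p \<Longrightarrow> \<beta> z = \<alpha> z" and f: "f \<in> borel_measurable configurations"
  shows "(\<integral>\<^sup>+ w. f w \<partial>weights_law \<beta>)
    = (\<integral>\<^sup>+ X. \<integral>\<^sup>+ x. f (X(p := x)) \<partial>exp_law (\<beta> p) \<partial>weights_law \<alpha>)"
proof -
  let ?J = "weight_sites - {p}"
  let ?Q = "\<Pi>\<^sub>M z\<in>?J. exp_law (\<alpha> z)"
  have ins: "insert p ?J = weight_sites" using p by auto
  have E: "prob_space (exp_law (\<gamma> z))" if "\<And>z. 0 < \<gamma> z" for \<gamma> :: "int \<times> int \<Rightarrow> real" and z
    by (intro prob_space_exponential_density that)
  interpret Q: prob_space ?Q by (intro prob_space_PiM E pos)
  have mu: "(\<lambda>(x, X). X(p := x)) \<in> borel \<Otimes>\<^sub>M ?Q \<rightarrow>\<^sub>M configurations"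
  proof -
    have s: "sets ?Q = sets (\<Pi>\<^sub>M z\<in>?J. borel)" by (intro sets_PiM_cong) auto
    have "(\<lambda>(X, x). X(p := x)) \<in> (\<Pi>\<^sub>M z\<in>?J. borel) \<Otimes>\<^sub>M borel \<rightarrow>\<^sub>M configurations"
      using measurable_add_dim[of p ?J "\<lambda>_. borel :: real measure"] unfolding ins .
    from measurable_compose[OF measurable_Pair[OF measurable_snd measurable_fst] this]
    show ?thesis by (simp add: s split_beta' cong: measurable_cong_sets)
  qed
  have int: "(\<integral>\<^sup>+ w. g w \<partial>weights_law \<gamma>)
      = (\<integral>\<^sup>+ x. \<integral>\<^sup>+ X. g (X(p := x)) \<partial>?Q \<partial>exp_law (\<gamma> p))"
    if \<gamma>: "\<And>z. 0 < \<gamma> z" "\<And>z. z \<noteq> p \<Longrightarrow> \<gamma> z = \<alpha> z"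
      and g: "g \<in> borel_measurable configurations" for \<gamma> g
  proof -
    have Q': "?Q = (\<Pi>\<^sub>M z\<in>?J. exp_law (\<gamma> z))"
      using \<gamma>(2) by (intro PiM_cong) auto
    have "weights_law \<gamma> = distr (exp_law (\<gamma> p) \<Otimes>\<^sub>M ?Q) (weights_law \<gamma>) (\<lambda>(x, X). X(p := x))"
      using distr_pair_PiM_eq_PiM[of ?J "\<lambda>z. exp_law (\<gamma> z)" p] E[of \<gamma>] \<gamma>(1) ins
      unfolding weights_law_def Q' by simp
    then have "(\<integral>\<^sup>+ w. g w \<partial>weights_law \<gamma>)
        = (\<integral>\<^sup>+ w. g w \<partial>distr (exp_law (\<gamma> p) \<Otimes>\<^sub>M ?Q) (weights_law \<gamma>) (\<lambda>(x, X). X(p := x)))"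
      by simp
    also have "\<dots> = (\<integral>\<^sup>+ y. g ((\<lambda>(x, X). X(p := x)) y) \<partial>(exp_law (\<gamma> p) \<Otimes>\<^sub>M ?Q))"
      using mu g by (intro nn_integral_distr) (simp_all cong: measurable_cong_sets)
    also have "\<dots> = (\<integral>\<^sup>+ x. \<integral>\<^sup>+ X. g (X(p := x)) \<partial>?Q \<partial>exp_law (\<gamma> p))"
      using measurable_compose[OF mu g]
      by (subst Q.nn_integral_fst[symmetric]) (simp_all cong: measurable_cong_sets)
    finally show ?thesis .
  qed
  interpret B: prob_space "exp_law (\<beta> p)" by (rule E[OF pos(2)])
  interpret A: prob_space "exp_law (\<alpha> p)" by (rule E[OF pos(1)])
  interpret pair_sigma_finite "exp_law (\<beta> p)" ?Q
    by unfold_locales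
  have "(\<integral>\<^sup>+ X. \<integral>\<^sup>+ x. f (X(p := x)) \<partial>exp_law (\<beta> p) \<partial>weights_law \<alpha>)
      = (\<integral>\<^sup>+ y. \<integral>\<^sup>+ X. \<integral>\<^sup>+ x. f (X(p := x)) \<partial>exp_law (\<beta> p) \<partial>?Q \<partial>exp_law (\<alpha> p))"
    by (subst int[OF pos(1) _ measurable_redraw_integral[OF pos(2) p f]]) simp_all
  also have "\<dots> = (\<integral>\<^sup>+ X. \<integral>\<^sup>+ x. f (X(p := x)) \<partial>exp_law (\<beta> p) \<partial>?Q)"
    by (simp add: A.emeasure_space_1[simplified])
  also have "\<dots> = (\<integral>\<^sup>+ x. \<integral>\<^sup>+ X. f (X(p := x)) \<partial>?Q \<partial>exp_law (\<beta> p))"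
    using measurable_compose[OF mu f]
    by (intro Fubini') (simp add: split_beta' cong: measurable_cong_sets)
  also have "\<dots> = (\<integral>\<^sup>+ w. f w \<partial>weights_law \<beta>)"
    by (rule int[OF pos(2) off f, symmetric])
  finally show ?thesis by simp
qed

lemma nn_integral_exp_law:
  assumes "f \<in> borel_measurable borel"
  shows "(\<integral>\<^sup>+ x. f x \<partial>exp_law a) = (\<integral>\<^sup>+ x. ennreal (exponential_density a x) * f x \<partial>lborel)"
  using assms by (intro nn_integral_density) auto

lemma nn_integral_exp_law_scale:
  assumes "0 < a" "0 < b" "f \<in> borel_measurable borel"
  shows "(\<integral>\<^sup>+ x. f x \<partial>exp_law b) = (\<integral>\<^sup>+ x. f (a / b * x) \<partial>exp_law a)"
proof -
  have dens: "a / b * exponential_density b (a / b * x) = exponential_density a x" for x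
    using assms(1,2) by (auto simp: exponential_density_def mult_less_0_iff zero_less_mult_iff divide_less_0_iff)
  have "(\<integral>\<^sup>+ x. f x \<partial>exp_law b)
      = ennreal (a / b) * (\<integral>\<^sup>+ x. ennreal (exponential_density b (a / b * x)) * f (a / b * x) \<partial>lborel)"
    using assms nn_integral_real_affine[where c="a/b" and t=0 and f="\<lambda>x. ennreal (exponential_density b x) * f x"]
    by (simp add: nn_integral_exp_law)
  also have "\<dots> = (\<integral>\<^sup>+ x. ennreal (a / b) * (ennreal (exponential_density b (a / b * x)) * f (a / b * x)) \<partial>lborel)"
    using assms by (intro nn_integral_cmult[symmetric]) simp
  also have "\<dots> = (\<integral>\<^sup>+ x. ennreal (exponential_density a x) * f (a / b * x) \<partial>lborel)"
  proof (intro nn_integral_cong)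
    fix x
    have "ennreal (a / b) * ennreal (exponential_density b (a / b * x)) = ennreal (exponential_density a x)"
      using assms(1,2) by (subst ennreal_mult'[symmetric]) (simp_all only: dens, simp)
    then show "ennreal (a / b) * (ennreal (exponential_density b (a / b * x)) * f (a / b * x))
        = ennreal (exponential_density a x) * f (a / b * x)"
      by (metis mult.assoc)
  qed
  also have "\<dots> = (\<integral>\<^sup>+ x. f (a / b * x) \<partial>exp_law a)"
    using assms by (subst nn_integral_exp_law) auto
  finally show ?thesis .
qed

lemma nn_integral_exp_law_tilt:
  assumes "0 < a" "0 < b" "f \<in> borel_measurable borel"
  shows "(\<integral>\<^sup>+ x. f x \<partial>exp_law b) = (\<integral>\<^sup>+ x. ennreal (b / a * exp ((a - b) * x)) * f x \<partial>exp_law a)"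
proof -
  have dens: "exponential_density a x * (b / a * exp ((a - b) * x)) = exponential_density b x" for x
    using assms(1,2) exp_add[of "- (x * a)" "(a - b) * x"]
    by (auto simp: exponential_density_def algebra_simps)
  have "(\<integral>\<^sup>+ x. ennreal (b / a * exp ((a - b) * x)) * f x \<partial>exp_law a)
    = (\<integral>\<^sup>+ x. ennreal (exponential_density a x) * (ennreal (b / a * exp ((a - b) * x)) * f x) \<partial>lborel)"
    using assms by (subst nn_integral_exp_law) auto
  also have "\<dots> = (\<integral>\<^sup>+ x. ennreal (exponential_density b x) * f x \<partial>lborel)"
  proof (intro nn_integral_cong)
    fix x
    have "ennreal (exponential_density a x) * ennreal (b / a * exp ((a - b) * x)) = ennreal (exponential_density b x)"
      using assms(1,2) by (subst ennreal_mult''[symmetric]) (simp_all only: dens, simp)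
    then show "ennreal (exponential_density a x) * (ennreal (b / a * exp ((a - b) * x)) * f x)
        = ennreal (exponential_density b x) * f x"
      by (metis mult.assoc)
  qed
  finally show ?thesis using assms by (simp add: nn_integral_exp_law)
qed

text \<open>
  By memorylessness, adding \<open>t\<close> amounts to conditioning on the event that the variable exceeds \<open>t\<close>, which
  has probability \<open>exp (- a t)\<close>.
\<close>

lemma nn_integral_exp_law_shift_le:
  assumes "0 < a" "0 \<le> t" "f \<in> borel_measurable borel"
  shows "(\<integral>\<^sup>+ x. f (x + t) \<partial>exp_law a) \<le> ennreal (exp (a * t)) * (\<integral>\<^sup>+ x. f x \<partial>exp_law a)"
proof -
  have dens: "exponential_density a (x - t) \<le> exp (a * t) * exponential_density a x" for x
    using assms(1,2) exp_add[of "a * t" "- (x * a)"]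
    by (auto simp: exponential_density_def algebra_simps)
  have "(\<integral>\<^sup>+ x. f (x + t) \<partial>exp_law a)
     = (\<integral>\<^sup>+ x. ennreal (exponential_density a x) * f (x + t) \<partial>lborel)"
    using assms by (subst nn_integral_exp_law) auto
  also have "\<dots> = (\<integral>\<^sup>+ x. ennreal (exponential_density a (x - t)) * f x \<partial>lborel)"
    using assms nn_integral_real_affine[where c=1 and t="-t" and f="\<lambda>x. ennreal (exponential_density a x) * f (x + t)"]
    by simp
  also have "\<dots> \<le> (\<integral>\<^sup>+ x. ennreal (exp (a * t)) * (ennreal (exponential_density a x) * f x) \<partial>lborel)"
  proof (intro nn_integral_mono)
    fix x
    have "ennreal (exponential_density a (x - t)) \<le> ennreal (exp (a * t)) * ennreal (exponential_density a x)"
      by (subst ennreal_mult'[symmetric]) (simp_all add: dens ennreal_leI)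
    then show "ennreal (exponential_density a (x - t)) * f x
        \<le> ennreal (exp (a * t)) * (ennreal (exponential_density a x) * f x)"
      by (metis mult.assoc mult_right_mono zero_le)
  qed
  also have "\<dots> = ennreal (exp (a * t)) * (\<integral>\<^sup>+ x. f x \<partial>exp_law a)"
    using assms by (subst nn_integral_cmult) (auto simp: nn_integral_exp_law)
  finally show ?thesis .
qed

lemma measurable_weight: "p \<in> weight_sites \<Longrightarrow> (\<lambda>w. w p) \<in> borel_measurable configurations"
  by (intro measurable_component_singleton)

lemma measurable_redraw:
  assumes "p \<in> weight_sites" "X \<in> space (weights_law \<alpha>)" "f \<in> borel_measurable configurations"
  shows "(\<lambda>x. f (X(p := x))) \<in> borel_measurable borel"
  by (rule measurable_compose[OF measurable_update[OF assms(1)] assms(3)]) (use assms(2) in auto)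

lemma nn_integral_weights_law_transfer:
  assumes pos: "\<And>z. 0 < \<alpha> z" "0 < b" and p: "p \<in> weight_sites"
    and f: "f \<in> borel_measurable configurations" and g: "g \<in> borel_measurable configurations"
    and eq: "\<And>X. (\<lambda>x. f (X(p := x))) \<in> borel_measurable borel \<Longrightarrow>
      (\<integral>\<^sup>+ x. f (X(p := x)) \<partial>exp_law b) = (\<integral>\<^sup>+ x. g (X(p := x)) \<partial>exp_law (\<alpha> p))"
  shows "(\<integral>\<^sup>+ w. f w \<partial>weights_law (\<alpha>(p := b))) = (\<integral>\<^sup>+ w. g w \<partial>weights_law \<alpha>)"
proof -
  have "(\<integral>\<^sup>+ w. f w \<partial>weights_law (\<alpha>(p := b)))
      = (\<integral>\<^sup>+ X. \<integral>\<^sup>+ x. f (X(p := x)) \<partial>exp_law b \<partial>weights_law \<alpha>)"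
    using nn_integral_weights_law_resample[of \<alpha> "\<alpha>(p := b)" p f] pos p f by auto
  also have "\<dots> = (\<integral>\<^sup>+ X. \<integral>\<^sup>+ x. g (X(p := x)) \<partial>exp_law (\<alpha> p) \<partial>weights_law \<alpha>)"
    by (intro nn_integral_cong eq measurable_redraw[OF p _ f])
  also have "\<dots> = (\<integral>\<^sup>+ w. g w \<partial>weights_law \<alpha>)"
    by (rule nn_integral_weights_law_resample[OF pos(1) pos(1) p refl g, symmetric])
  finally show ?thesis .
qed

lemma nn_integral_weights_law_update_density:
  assumes pos: "\<And>z. 0 < \<alpha> z" "0 < b" and p: "p \<in> weight_sites"
    and f: "f \<in> borel_measurable configurations"
  shows "(\<integral>\<^sup>+ w. f w \<partial>weights_law (\<alpha>(p := b)))
    = (\<integral>\<^sup>+ w. ennreal (b / \<alpha> p * exp ((\<alpha> p - b) * w p)) * f w \<partial>weights_law \<alpha>)"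
  using nn_integral_exp_law_tilt[of "\<alpha> p" b] pos measurable_weight[OF p] f
  by (intro nn_integral_weights_law_transfer[OF pos p f]) auto

lemma nn_integral_weights_law_update_scale:
  assumes pos: "\<And>z. 0 < \<alpha> z" "0 < b" and p: "p \<in> weight_sites"
    and f: "f \<in> borel_measurable configurations"
  shows "(\<integral>\<^sup>+ w. f w \<partial>weights_law (\<alpha>(p := b)))
    = (\<integral>\<^sup>+ w. f (w(p := \<alpha> p / b * w p)) \<partial>weights_law \<alpha>)"
proof (rule nn_integral_weights_law_transfer[OF pos p f])
  show "(\<lambda>w. f (w(p := \<alpha> p / b * w p))) \<in> borel_measurable configurations"
    using measurable_weight[OF p] by (intro measurable_compose[OF _ f] measurable_update[OF p]) auto
qed (use nn_integral_exp_law_scale[of "\<alpha> p" b] pos in auto)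

lemma measurable_shift:
  "p \<in> weight_sites \<Longrightarrow> (\<lambda>w. w(p := w p + t)) \<in> configurations \<rightarrow>\<^sub>M configurations"
  by (intro measurable_update borel_measurable_add measurable_weight) auto

lemma nn_integral_weights_law_shift_le:
  assumes pos: "\<And>z. 0 < \<alpha> z" "0 \<le> t" and p: "p \<in> weight_sites"
    and f: "f \<in> borel_measurable configurations"
  shows "(\<integral>\<^sup>+ w. f (w(p := w p + t)) \<partial>weights_law \<alpha>)
    \<le> ennreal (exp (\<alpha> p * t)) * (\<integral>\<^sup>+ w. f w \<partial>weights_law \<alpha>)"
proof -
  note R = nn_integral_weights_law_resample[OF pos(1) pos(1) p refl]
  have "(\<integral>\<^sup>+ w. f (w(p := w p + t)) \<partial>weights_law \<alpha>)
      = (\<integral>\<^sup>+ X. \<integral>\<^sup>+ x. f (X(p := x + t)) \<partial>exp_law (\<alpha> p) \<partial>weights_law \<alpha>)"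
    using R[OF measurable_compose[OF measurable_shift[OF p] f]] by simp
  also have "\<dots> \<le> (\<integral>\<^sup>+ X. ennreal (exp (\<alpha> p * t)) * (\<integral>\<^sup>+ x. f (X(p := x)) \<partial>exp_law (\<alpha> p)) \<partial>weights_law \<alpha>)"
    using pos by (intro nn_integral_mono nn_integral_exp_law_shift_le measurable_redraw[OF p _ f])
  also have "\<dots> = ennreal (exp (\<alpha> p * t)) * (\<integral>\<^sup>+ X. \<integral>\<^sup>+ x. f (X(p := x)) \<partial>exp_law (\<alpha> p) \<partial>weights_law \<alpha>)"
    using measurable_redraw_integral[OF pos(1) p f]
    by (intro nn_integral_cmult) (simp cong: measurable_cong_sets)
  also have "\<dots> = ennreal (exp (\<alpha> p * t)) * (\<integral>\<^sup>+ w. f w \<partial>weights_law \<alpha>)"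
    unfolding R[OF f] ..
  finally show ?thesis .
qed

text \<open>
  The likelihood ratio serves two purposes: it prices a tilt, and for \<open>f = 1\<close> its total mass one evaluates
  exponential moments of sums.
\<close>

lemma nn_integral_weights_law_density:
  assumes "finite F" "F \<subseteq> weight_sites" and pos: "\<And>z. 0 < \<alpha> z"
    and "\<And>z. 0 < \<beta> z" and "\<And>z. z \<notin> F \<Longrightarrow> \<beta> z = \<alpha> z" and "f \<in> borel_measurable configurations"
  shows "(\<integral>\<^sup>+ w. f w \<partial>weights_law \<beta>)
    = (\<integral>\<^sup>+ w. (\<Prod>p\<in>F. ennreal (\<beta> p / \<alpha> p * exp ((\<alpha> p - \<beta> p) * w p))) * f w \<partial>weights_law \<alpha>)"
  using assms
proof (induction F arbitrary: \<beta> f rule: finite_induct)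
  case empty
  then have "\<beta> = \<alpha>" by auto
  then show ?case by simp
next
  case (insert p F)
  let ?\<gamma> = "\<beta>(p := \<alpha> p)"
  let ?d = "\<lambda>p w. ennreal (\<beta> p / \<alpha> p * exp ((\<alpha> p - \<beta> p) * w p))"
  have comp: "(\<lambda>w. w p) \<in> borel_measurable configurations"
    using insert.prems by (intro measurable_component_singleton) auto
  have "(\<integral>\<^sup>+ w. f w \<partial>weights_law \<beta>) = (\<integral>\<^sup>+ w. f w \<partial>weights_law (?\<gamma>(p := \<beta> p)))"
    by simp
  also have "\<dots> = (\<integral>\<^sup>+ w. ?d p w * f w \<partial>weights_law ?\<gamma>)"
    using insert.prems by (subst nn_integral_weights_law_update_density) auto
  also have "\<dots> = (\<integral>\<^sup>+ w. (\<Prod>q\<in>F. ennreal (?\<gamma> q / \<alpha> q * exp ((\<alpha> q - ?\<gamma> q) * w q))) * (?d p w * f w)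
      \<partial>weights_law \<alpha>)"
    using insert.prems comp by (intro insert.IH) auto
  also have "\<dots> = (\<integral>\<^sup>+ w. (\<Prod>q\<in>F. ?d q w) * (?d p w * f w) \<partial>weights_law \<alpha>)"
    using insert.hyps by (intro nn_integral_cong arg_cong2[where f="(*)"] prod.cong) auto
  finally show ?case
    using insert.hyps by (simp add: ac_simps)
qed

definition rescale :: "('a \<Rightarrow> real) \<Rightarrow> 'a set \<Rightarrow> ('a \<Rightarrow> real) \<Rightarrow> 'a \<Rightarrow> real" where
  "rescale c F w z = (if z \<in> F then c z * w z else w z)"

lemma measurable_rescale:
  assumes "F \<subseteq> weight_sites"
  shows "rescale c F \<in> configurations \<rightarrow>\<^sub>M configurations"
  unfolding rescale_def[abs_def]
proof (rule measurable_PiM_single')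
  fix z assume "z \<in> weight_sites"
  then have [measurable]: "(\<lambda>w. w z) \<in> borel_measurable configurations"
    by (intro measurable_component_singleton)
  show "(\<lambda>w. if z \<in> F then c z * w z else w z) \<in> borel_measurable configurations"
    by measurable
qed (use assms in \<open>auto simp: space_PiM PiE_iff extensional_def\<close>)

text \<open>
  The same change of rates as a coupling: an exponential variable is turned into one of another rate by
  multiplication.  This lets environments with different rates be compared pointwise.
\<close>

lemma nn_integral_weights_law_rescale:
  assumes "finite F" "F \<subseteq> weight_sites" and pos: "\<And>z. 0 < \<alpha> z"
    and "\<And>z. 0 < \<beta> z" and "\<And>z. z \<notin> F \<Longrightarrow> \<beta> z = \<alpha> z" and "f \<in> borel_measurable configurations"
  shows "(\<integral>\<^sup>+ w. f w \<partial>weights_law \<beta>)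
    = (\<integral>\<^sup>+ w. f (rescale (\<lambda>z. \<alpha> z / \<beta> z) F w) \<partial>weights_law \<alpha>)"
  using assms
proof (induction F arbitrary: \<beta> f rule: finite_induct)
  case empty
  then have "\<beta> = \<alpha>" by auto
  then show ?case by (simp add: rescale_def[abs_def])
next
  case (insert p F)
  let ?\<gamma> = "\<beta>(p := \<alpha> p)"
  have p: "p \<in> weight_sites" using insert.prems by auto
  have comp: "(\<lambda>w. w p) \<in> borel_measurable configurations"
    using p by (intro measurable_component_singleton) auto
  have "(\<integral>\<^sup>+ w. f w \<partial>weights_law \<beta>) = (\<integral>\<^sup>+ w. f w \<partial>weights_law (?\<gamma>(p := \<beta> p)))"
    by simp
  also have "\<dots> = (\<integral>\<^sup>+ w. f (w(p := \<alpha> p / \<beta> p * w p)) \<partial>weights_law ?\<gamma>)"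
    using insert.prems by (subst nn_integral_weights_law_update_scale) auto
  also have "\<dots> = (\<integral>\<^sup>+ w. f ((rescale (\<lambda>z. \<alpha> z / ?\<gamma> z) F w)(p := \<alpha> p / \<beta> p * rescale (\<lambda>z. \<alpha> z / ?\<gamma> z) F w p))
      \<partial>weights_law \<alpha>)"
    using insert.prems comp
    by (intro insert.IH measurable_compose[OF measurable_update[OF p] insert.prems(5)]) auto
  also have "\<dots> = (\<integral>\<^sup>+ w. f (rescale (\<lambda>z. \<alpha> z / \<beta> z) (insert p F) w) \<partial>weights_law \<alpha>)"
    using insert.hyps
    by (intro nn_integral_cong arg_cong[where f=f]) (auto simp: rescale_def fun_eq_iff)
  finally show ?case .
qed

lemma AE_exp_law_pos: "AE x in exp_law a. 0 < x"
proof -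
  have "AE x in lborel. x \<noteq> (0::real)" by (rule AE_lborel_singleton)
  then have "AE x in lborel. 0 < ennreal (exponential_density a x) \<longrightarrow> 0 < x"
    by eventually_elim (auto simp: exponential_density_def not_less)
  then show ?thesis by (subst AE_density) auto
qed

lemma AE_weights_law_pos:
  assumes "\<And>z. 0 < \<alpha> z"
  shows "AE w in weights_law \<alpha>. \<forall>z\<in>weight_sites. 0 < w z"
proof (subst AE_ball_countable)
  show "\<forall>z\<in>weight_sites. AE w in weights_law \<alpha>. 0 < w z"
    unfolding weights_law_def
    using assms AE_exp_law_pos by (intro ballI AE_PiM_component prob_space_exponential_density) auto
qed (rule countableI_type)

section \<open>Burke's theorem\<close>

lemma pred_mem_greaterThan [measurable (raw)]:
  fixes f g :: "'a \<Rightarrow> real"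
  assumes [measurable]: "f \<in> borel_measurable M" "g \<in> borel_measurable M"
  shows "Measurable.pred M (\<lambda>x. g x \<in> {f x<..})"
  unfolding greaterThan_iff by measurable

text \<open>
  The exponential race: on the event \<open>y < x\<close> the pair is \<open>(y + d, y)\<close>, where the excess \<open>d\<close> has the law of
  \<open>x\<close> and the minimum \<open>y\<close> is independent of it with rate \<open>a + b = 1\<close>.  The factor \<open>b\<close> is the probability of the event.
\<close>

lemma nn_integral_exp_law_pair_less:
  fixes h :: "real \<Rightarrow> real \<Rightarrow> ennreal"
  assumes ab: "0 < a" "0 < b" "a + b = 1"
    and h: "case_prod h \<in> borel_measurable (borel \<Otimes>\<^sub>M borel)"
  shows "(\<integral>\<^sup>+ y. \<integral>\<^sup>+ x. h x y * indicator {y<..} x \<partial>exp_law a \<partial>exp_law b)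
    = (\<integral>\<^sup>+ y. \<integral>\<^sup>+ d. b * h (y + d) y \<partial>exp_law a \<partial>exp_law 1)"
proof -
  note [measurable] = h
  have dens: "b * (exponential_density a d) * exponential_density 1 y
      = exponential_density a (y + d) * exponential_density b y" if "0 < d" for d y
  proof -
    have "- (d * a) + - y = - ((y + d) * a) + - (y * b)" using ab(3) by algebra
    then have "exp (- (d * a)) * exp (- y) = exp (- ((y + d) * a)) * exp (- (y * b))"
      by (metis exp_add)
    then have e: "b * (a * exp (- (d * a))) * (1 * exp (- y)) = a * exp (- ((y + d) * a)) * (b * exp (- (y * b)))"
      by algebra
    show ?thesis
    proof (cases "y < 0")
      case False
      then have "exponential_density a d = a * exp (- (d * a))" "exponential_density 1 y = 1 * exp (- y)"
        "exponential_density a (y + d) = a * exp (- ((y + d) * a))"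
        "exponential_density b y = b * exp (- (y * b))"
        using that by (simp_all add: exponential_density_def algebra_simps)
      then show ?thesis using e by (simp only:)
    qed (simp add: exponential_density_def)
  qed
  have inner: "ennreal (exponential_density b y) * (\<integral>\<^sup>+ x. h x y * indicator {y<..} x \<partial>exp_law a)
      = ennreal (exponential_density 1 y) * (\<integral>\<^sup>+ d. b * h (y + d) y \<partial>exp_law a)" for y
  proof -
    have "(\<integral>\<^sup>+ x. h x y * indicator {y<..} x \<partial>exp_law a)
        = (\<integral>\<^sup>+ x. ennreal (exponential_density a x) * (h x y * indicator {y<..} x) \<partial>lborel)"
      by (intro nn_integral_exp_law) measurable
    also have "\<dots> = (\<integral>\<^sup>+ d. ennreal (exponential_density a (y + d)) * (h (y + d) y * indicator {0<..} d) \<partial>lborel)"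
      by (subst nn_integral_real_affine[where c=1 and t=y])
         (auto intro!: nn_integral_cong split: split_indicator)
    finally have "ennreal (exponential_density b y) * (\<integral>\<^sup>+ x. h x y * indicator {y<..} x \<partial>exp_law a)
        = (\<integral>\<^sup>+ d. ennreal (exponential_density b y) *
            (ennreal (exponential_density a (y + d)) * (h (y + d) y * indicator {0<..} d)) \<partial>lborel)"
      by (simp add: nn_integral_cmult)
    also have "\<dots> = (\<integral>\<^sup>+ d. ennreal (exponential_density 1 y) *
            (ennreal (exponential_density a d) * (b * h (y + d) y)) \<partial>lborel)"
    proof (intro nn_integral_cong_AE)
      have "AE d in lborel. d \<noteq> (0::real)" by (rule AE_lborel_singleton)
      then show "AE d in lborel. ennreal (exponential_density b y) *
            (ennreal (exponential_density a (y + d)) * (h (y + d) y * indicator {0<..} d))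
          = ennreal (exponential_density 1 y) * (ennreal (exponential_density a d) * (b * h (y + d) y))"
      proof eventually_elim
        fix d :: real assume "d \<noteq> 0"
        show "ennreal (exponential_density b y) *
            (ennreal (exponential_density a (y + d)) * (h (y + d) y * indicator {0<..} d))
          = ennreal (exponential_density 1 y) * (ennreal (exponential_density a d) * (b * h (y + d) y))"
        proof (cases "0 < d")
          case True
          have "ennreal (exponential_density b y) * ennreal (exponential_density a (y + d))
              = ennreal b * ennreal (exponential_density a d) * ennreal (exponential_density 1 y)"
            using ab dens[OF True, of y] exponential_density_nonneg[of a d]
              exponential_density_nonneg[of b y]
            by (simp add: ennreal_mult'[symmetric] ennreal_mult''[symmetric] mult.commute)
          with True show ?thesis
            by (simp add: ac_simps) (metis (no_types, lifting) mult.assoc mult.commute)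
        next
          case False
          with \<open>d \<noteq> 0\<close> show ?thesis by (simp add: exponential_density_def)
        qed
      qed
    qed
    also have "\<dots> = ennreal (exponential_density 1 y) * (\<integral>\<^sup>+ d. b * h (y + d) y \<partial>exp_law a)"
      by (subst nn_integral_exp_law) (auto simp: nn_integral_cmult)
    finally show ?thesis .
  qed
  interpret E: prob_space "exp_law a" by (intro prob_space_exponential_density ab)
  have "(\<integral>\<^sup>+ y. \<integral>\<^sup>+ x. h x y * indicator {y<..} x \<partial>exp_law a \<partial>exp_law b)
      = (\<integral>\<^sup>+ y. ennreal (exponential_density b y) * (\<integral>\<^sup>+ x. h x y * indicator {y<..} x \<partial>exp_law a) \<partial>lborel)"
    by (intro nn_integral_exp_law) measurable
  also have "\<dots> = (\<integral>\<^sup>+ y. \<integral>\<^sup>+ d. b * h (y + d) y \<partial>exp_law a \<partial>exp_law 1)"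
    unfolding inner by (intro nn_integral_exp_law[symmetric]) measurable
  finally show ?thesis .
qed


lemma nn_integral_exp_law_pair_split:
  fixes f :: "real \<Rightarrow> real \<Rightarrow> ennreal"
  assumes ab: "0 < a" "0 < b" "a + b = 1"
    and f: "case_prod f \<in> borel_measurable (borel \<Otimes>\<^sub>M borel)"
  shows "(\<integral>\<^sup>+ x. \<integral>\<^sup>+ y. f x y \<partial>exp_law b \<partial>exp_law a)
    = (\<integral>\<^sup>+ y. \<integral>\<^sup>+ d. b * f (y + d) y \<partial>exp_law a \<partial>exp_law 1)
      + (\<integral>\<^sup>+ x. \<integral>\<^sup>+ d. a * f x (x + d) \<partial>exp_law b \<partial>exp_law 1)"
proof -
  note [measurable] = f
  interpret A: prob_space "exp_law a" by (intro prob_space_exponential_density ab)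
  interpret B: prob_space "exp_law b" by (intro prob_space_exponential_density ab)
  interpret pair_sigma_finite "exp_law b" "exp_law a" by unfold_locales
  have ne: "AE y in exp_law b. y \<noteq> x" for x
    using AE_lborel_singleton[of x] by (subst AE_density) auto
  have "(\<integral>\<^sup>+ x. \<integral>\<^sup>+ y. f x y \<partial>exp_law b \<partial>exp_law a)
      = (\<integral>\<^sup>+ x. \<integral>\<^sup>+ y. f x y * indicator {y<..} x + f x y * indicator {x<..} y \<partial>exp_law b \<partial>exp_law a)"
    by (intro nn_integral_cong nn_integral_cong_AE, rule AE_mp[OF ne])
       (auto split: split_indicator)
  also have "\<dots> = (\<integral>\<^sup>+ x. \<integral>\<^sup>+ y. f x y * indicator {y<..} x \<partial>exp_law b \<partial>exp_law a)
      + (\<integral>\<^sup>+ x. \<integral>\<^sup>+ y. f x y * indicator {x<..} y \<partial>exp_law b \<partial>exp_law a)"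
  proof -
    have "(\<integral>\<^sup>+ y. f x y * indicator {y<..} x + f x y * indicator {x<..} y \<partial>exp_law b)
        = (\<integral>\<^sup>+ y. f x y * indicator {y<..} x \<partial>exp_law b) + (\<integral>\<^sup>+ y. f x y * indicator {x<..} y \<partial>exp_law b)" for x
      by (intro nn_integral_add; measurable)
    then show ?thesis
      by (simp only:) (intro nn_integral_add; measurable)
  qed
  also have "(\<integral>\<^sup>+ x. \<integral>\<^sup>+ y. f x y * indicator {y<..} x \<partial>exp_law b \<partial>exp_law a)
      = (\<integral>\<^sup>+ y. \<integral>\<^sup>+ x. f x y * indicator {y<..} x \<partial>exp_law a \<partial>exp_law b)"
    by (intro Fubini') measurable
  also have "\<dots> = (\<integral>\<^sup>+ y. \<integral>\<^sup>+ d. b * f (y + d) y \<partial>exp_law a \<partial>exp_law 1)"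
    by (rule nn_integral_exp_law_pair_less[OF ab f])
  also have "(\<integral>\<^sup>+ x. \<integral>\<^sup>+ y. f x y * indicator {x<..} y \<partial>exp_law b \<partial>exp_law a)
      = (\<integral>\<^sup>+ x. \<integral>\<^sup>+ d. a * f x (x + d) \<partial>exp_law b \<partial>exp_law 1)"
    using ab by (intro nn_integral_exp_law_pair_less[where h="\<lambda>y x. f x y"]) auto
  finally show ?thesis .
qed

lemma AE_exp_law_nonneg: "AE x in exp_law a. 0 \<le> x"
  using AE_exp_law_pos[of a] by eventually_elim simp

text \<open>
  The local step of Burke's theorem.  By the race decomposition the minimum of \<open>x\<close> and \<open>y\<close> is a rate one
  variable independent of the difference \<open>x - y\<close>, and the map exchanges this minimum with the
  independent rate one variable \<open>z\<close>.
\<close>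

lemma nn_integral_burke_triple:
  fixes g :: "real \<Rightarrow> real \<Rightarrow> real \<Rightarrow> ennreal"
  assumes ab: "0 < a" "0 < b" "a + b = 1"
    and g: "(\<lambda>(x, y, z). g x y z) \<in> borel_measurable (borel \<Otimes>\<^sub>M borel \<Otimes>\<^sub>M borel)"
  shows "(\<integral>\<^sup>+ x. \<integral>\<^sup>+ y. \<integral>\<^sup>+ z. g (z + max 0 (x - y)) (z + max 0 (y - x)) (min x y)
        \<partial>exp_law 1 \<partial>exp_law b \<partial>exp_law a)
    = (\<integral>\<^sup>+ x. \<integral>\<^sup>+ y. \<integral>\<^sup>+ z. g x y z \<partial>exp_law 1 \<partial>exp_law b \<partial>exp_law a)"
proof -
  have g' [measurable]: "(\<lambda>w. g (f1 w) (f2 w) (f3 w)) \<in> borel_measurable M"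
    if "f1 \<in> borel_measurable M" "f2 \<in> borel_measurable M" "f3 \<in> borel_measurable M"
    for f1 f2 f3 and M :: "'m measure"
    using measurable_compose[OF measurable_Pair[OF that(1) measurable_Pair[OF that(2,3)]] g] by simp
  interpret A: prob_space "exp_law a" by (intro prob_space_exponential_density ab)
  interpret B: prob_space "exp_law b" by (intro prob_space_exponential_density ab)
  interpret C: prob_space "exp_law 1" by (intro prob_space_exponential_density) simp
  interpret CC: pair_sigma_finite "exp_law 1" "exp_law 1" by unfold_locales
  let ?h = "\<lambda>x y. \<integral>\<^sup>+ z. g (z + max 0 (x - y)) (z + max 0 (y - x)) (min x y) \<partial>exp_law 1"
  let ?k = "\<lambda>x y. \<integral>\<^sup>+ z. g x y z \<partial>exp_law 1"
  have mh: "case_prod ?h \<in> borel_measurable (borel \<Otimes>\<^sub>M borel)"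
    and mk: "case_prod ?k \<in> borel_measurable (borel \<Otimes>\<^sub>M borel)"
    unfolding split_beta' by measurable
  note [measurable] = mh[unfolded split_beta'] mk[unfolded split_beta']
  have swap: "(\<integral>\<^sup>+ y. \<integral>\<^sup>+ d. \<integral>\<^sup>+ z. \<phi> d z y \<partial>exp_law 1 \<partial>exp_law c \<partial>exp_law 1)
      = (\<integral>\<^sup>+ y. \<integral>\<^sup>+ d. \<integral>\<^sup>+ z. \<phi> d y z \<partial>exp_law 1 \<partial>exp_law c \<partial>exp_law 1)"
    if "0 < c" and \<phi>: "(\<lambda>(d, z, y). \<phi> d z y) \<in> borel_measurable (borel \<Otimes>\<^sub>M borel \<Otimes>\<^sub>M borel)"
    for c and \<phi> :: "real \<Rightarrow> real \<Rightarrow> real \<Rightarrow> ennreal"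
  proof -
    have [measurable]: "(\<lambda>w. \<phi> (f1 w) (f2 w) (f3 w)) \<in> borel_measurable M"
      if "f1 \<in> borel_measurable M" "f2 \<in> borel_measurable M" "f3 \<in> borel_measurable M"
      for f1 f2 f3 and M :: "'m measure"
      using measurable_compose[OF measurable_Pair[OF that(1) measurable_Pair[OF that(2,3)]] \<phi>] by simp
    interpret E: prob_space "exp_law c" by (intro prob_space_exponential_density that)
    interpret pair_sigma_finite "exp_law c" "exp_law 1" by unfold_locales
    have "(\<integral>\<^sup>+ y. \<integral>\<^sup>+ d. \<integral>\<^sup>+ z. \<phi> d z y \<partial>exp_law 1 \<partial>exp_law c \<partial>exp_law 1)
        = (\<integral>\<^sup>+ y. \<integral>\<^sup>+ z. \<integral>\<^sup>+ d. \<phi> d z y \<partial>exp_law c \<partial>exp_law 1 \<partial>exp_law 1)"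
      by (intro nn_integral_cong Fubini'[symmetric]) measurable
    also have "\<dots> = (\<integral>\<^sup>+ z. \<integral>\<^sup>+ y. \<integral>\<^sup>+ d. \<phi> d z y \<partial>exp_law c \<partial>exp_law 1 \<partial>exp_law 1)"
      by (intro CC.Fubini') measurable
    also have "\<dots> = (\<integral>\<^sup>+ z. \<integral>\<^sup>+ d. \<integral>\<^sup>+ y. \<phi> d z y \<partial>exp_law 1 \<partial>exp_law c \<partial>exp_law 1)"
      by (intro nn_integral_cong Fubini') measurable
    finally show ?thesis .
  qed
  have 1: "(\<integral>\<^sup>+ y. \<integral>\<^sup>+ d. b * ?h (y + d) y \<partial>exp_law a \<partial>exp_law 1)
      = (\<integral>\<^sup>+ y. \<integral>\<^sup>+ d. b * ?k (y + d) y \<partial>exp_law a \<partial>exp_law 1)"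
  proof -
    have "(\<integral>\<^sup>+ y. \<integral>\<^sup>+ d. b * ?h (y + d) y \<partial>exp_law a \<partial>exp_law 1)
        = (\<integral>\<^sup>+ y. \<integral>\<^sup>+ d. \<integral>\<^sup>+ z. b * g (z + d) z y \<partial>exp_law 1 \<partial>exp_law a \<partial>exp_law 1)"
      by (intro nn_integral_cong nn_integral_cong_AE, rule AE_mp[OF AE_exp_law_nonneg])
         (auto simp: nn_integral_cmult[symmetric])
    also have "\<dots> = (\<integral>\<^sup>+ y. \<integral>\<^sup>+ d. b * ?k (y + d) y \<partial>exp_law a \<partial>exp_law 1)"
      by (subst swap[OF ab(1)]) (simp_all add: nn_integral_cmult split_beta')
    finally show ?thesis .
  qed
  have 2: "(\<integral>\<^sup>+ x. \<integral>\<^sup>+ d. a * ?h x (x + d) \<partial>exp_law b \<partial>exp_law 1)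
      = (\<integral>\<^sup>+ x. \<integral>\<^sup>+ d. a * ?k x (x + d) \<partial>exp_law b \<partial>exp_law 1)"
  proof -
    have "(\<integral>\<^sup>+ x. \<integral>\<^sup>+ d. a * ?h x (x + d) \<partial>exp_law b \<partial>exp_law 1)
        = (\<integral>\<^sup>+ x. \<integral>\<^sup>+ d. \<integral>\<^sup>+ z. a * g z (z + d) x \<partial>exp_law 1 \<partial>exp_law b \<partial>exp_law 1)"
      by (intro nn_integral_cong nn_integral_cong_AE, rule AE_mp[OF AE_exp_law_nonneg])
         (auto simp: nn_integral_cmult[symmetric])
    also have "\<dots> = (\<integral>\<^sup>+ x. \<integral>\<^sup>+ d. a * ?k x (x + d) \<partial>exp_law b \<partial>exp_law 1)"
      by (subst swap[OF ab(2)]) (simp_all add: nn_integral_cmult split_beta')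
    finally show ?thesis .
  qed
  show ?thesis
    using nn_integral_exp_law_pair_split[OF ab mh] nn_integral_exp_law_pair_split[OF ab mk] 1 2
    by simp
qed

text \<open>
  One step of the passage time recursion, carried out in place: \<open>(i, 0)\<close> holds the current horizontal
  increment in column \<open>i\<close>, and \<open>(0, j)\<close> the current vertical increment in row \<open>j\<close>.  Keeping the minimum at
  the used site \<open>(i, j)\<close> makes the step an involution on three coordinates, so that it preserves the whole
  product law instead of mapping it to a law with fewer coordinates.
\<close>

definition corner_flip :: "nat \<Rightarrow> nat \<Rightarrow> (int \<times> int \<Rightarrow> real) \<Rightarrow> int \<times> int \<Rightarrow> real" where
  "corner_flip i j w =
     (let I = w (int i, 0); J = w (0, int j); b = w (int i, int j)
      in w((int i, 0) := b + max 0 (I - J), (0, int j) := b + max 0 (J - I),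
           (int i, int j) := min I J))"

lemma weight_sites_iff: "(x, y) \<in> weight_sites \<longleftrightarrow> 0 \<le> x \<and> 0 \<le> y \<and> (x \<noteq> 0 \<or> y \<noteq> 0)"
  by (auto simp: weight_sites_def less_eq_prod_def zero_prod_def)

lemma nn_integral_weights_law_resample3:
  assumes pos: "\<And>z. 0 < \<alpha> z"
    and p: "p \<in> weight_sites" and q: "q \<in> weight_sites" and r: "r \<in> weight_sites"
    and f: "f \<in> borel_measurable configurations"
  shows "(\<integral>\<^sup>+ w. f w \<partial>weights_law \<alpha>)
    = (\<integral>\<^sup>+ X. \<integral>\<^sup>+ x. \<integral>\<^sup>+ y. \<integral>\<^sup>+ z. f (X(p := x, q := y, r := z))
         \<partial>exp_law (\<alpha> r) \<partial>exp_law (\<alpha> q) \<partial>exp_law (\<alpha> p) \<partial>weights_law \<alpha>)"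
proof -
  note m = measurable_redraw_integral[OF pos]
  note R = nn_integral_weights_law_resample[OF pos pos]
  have "(\<integral>\<^sup>+ w. f w \<partial>weights_law \<alpha>) = (\<integral>\<^sup>+ X. \<integral>\<^sup>+ z. f (X(r := z)) \<partial>exp_law (\<alpha> r) \<partial>weights_law \<alpha>)"
    by (rule R[OF r refl f])
  also have "\<dots> = (\<integral>\<^sup>+ X. \<integral>\<^sup>+ y. \<integral>\<^sup>+ z. f (X(q := y, r := z)) \<partial>exp_law (\<alpha> r) \<partial>exp_law (\<alpha> q) \<partial>weights_law \<alpha>)"
    by (rule R[OF q refl m[OF r f]])
  also have "\<dots> = (\<integral>\<^sup>+ X. \<integral>\<^sup>+ x. \<integral>\<^sup>+ y. \<integral>\<^sup>+ z. f (X(p := x, q := y, r := z))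
         \<partial>exp_law (\<alpha> r) \<partial>exp_law (\<alpha> q) \<partial>exp_law (\<alpha> p) \<partial>weights_law \<alpha>)"
    by (rule R[OF p refl m[OF q m[OF r f]]])
  finally show ?thesis .
qed

lemma measurable_corner_flip:
  assumes "0 < i" "0 < j"
  shows "corner_flip i j \<in> configurations \<rightarrow>\<^sub>M configurations"
proof -
  have s: "(int i, 0) \<in> weight_sites" "(0, int j) \<in> weight_sites" "(int i, int j) \<in> weight_sites"
    using assms by (auto simp: weight_sites_iff)
  note [measurable] = s[THEN measurable_weight]
  show ?thesis
    unfolding corner_flip_def[abs_def] Let_def
    by (intro measurable_update s) measurable
qed

lemma nn_integral_corner_flip:
  assumes pos: "\<And>z. 0 < \<alpha> z" and ij: "0 < i" "0 < j"
    and \<alpha>: "\<alpha> (int i, 0) + \<alpha> (0, int j) = 1" "\<alpha> (int i, int j) = 1"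
    and f: "f \<in> borel_measurable configurations"
  shows "(\<integral>\<^sup>+ w. f (corner_flip i j w) \<partial>weights_law \<alpha>) = (\<integral>\<^sup>+ w. f w \<partial>weights_law \<alpha>)"
proof -
  let ?p = "(int i, 0) :: int \<times> int" and ?q = "(0, int j) :: int \<times> int" and ?r = "(int i, int j)"
  have s: "?p \<in> weight_sites" "?q \<in> weight_sites" "?r \<in> weight_sites"
    using ij by (auto simp: weight_sites_iff)
  note R = nn_integral_weights_law_resample3[OF pos s]
  have "(\<integral>\<^sup>+ w. f (corner_flip i j w) \<partial>weights_law \<alpha>)
     = (\<integral>\<^sup>+ X. \<integral>\<^sup>+ x. \<integral>\<^sup>+ y. \<integral>\<^sup>+ z. f (corner_flip i j (X(?p := x, ?q := y, ?r := z)))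
         \<partial>exp_law (\<alpha> ?r) \<partial>exp_law (\<alpha> ?q) \<partial>exp_law (\<alpha> ?p) \<partial>weights_law \<alpha>)"
    by (rule R[OF measurable_compose[OF measurable_corner_flip[OF ij] f]])
  also have "\<dots> = (\<integral>\<^sup>+ X. \<integral>\<^sup>+ x. \<integral>\<^sup>+ y. \<integral>\<^sup>+ z.
        f (X(?p := z + max 0 (x - y), ?q := z + max 0 (y - x), ?r := min x y))
         \<partial>exp_law 1 \<partial>exp_law (\<alpha> ?q) \<partial>exp_law (\<alpha> ?p) \<partial>weights_law \<alpha>)"
    unfolding \<alpha>(2) using ij
    by (intro nn_integral_cong arg_cong[where f=f]) (auto simp: corner_flip_def fun_eq_iff Let_def)
  also have "\<dots> = (\<integral>\<^sup>+ X. \<integral>\<^sup>+ x. \<integral>\<^sup>+ y. \<integral>\<^sup>+ z. f (X(?p := x, ?q := y, ?r := z))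
         \<partial>exp_law 1 \<partial>exp_law (\<alpha> ?q) \<partial>exp_law (\<alpha> ?p) \<partial>weights_law \<alpha>)"
  proof (rule nn_integral_cong)
    fix X assume X: "X \<in> space (weights_law \<alpha>)"
    have "(\<lambda>v. X(?p := fst v, ?q := fst (snd v), ?r := snd (snd v)))
        \<in> (borel \<Otimes>\<^sub>M borel \<Otimes>\<^sub>M borel) \<rightarrow>\<^sub>M configurations"
      using X by (intro measurable_update s) auto
    from measurable_compose[OF this f]
    show "(\<integral>\<^sup>+ x. \<integral>\<^sup>+ y. \<integral>\<^sup>+ z.
        f (X(?p := z + max 0 (x - y), ?q := z + max 0 (y - x), ?r := min x y))
         \<partial>exp_law 1 \<partial>exp_law (\<alpha> ?q) \<partial>exp_law (\<alpha> ?p))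
       = (\<integral>\<^sup>+ x. \<integral>\<^sup>+ y. \<integral>\<^sup>+ z. f (X(?p := x, ?q := y, ?r := z))
         \<partial>exp_law 1 \<partial>exp_law (\<alpha> ?q) \<partial>exp_law (\<alpha> ?p))"
      by (intro nn_integral_burke_triple[where g="\<lambda>x y z. f (X(?p := x, ?q := y, ?r := z))"] pos \<alpha>(1))
         (simp add: split_beta')
  qed
  also have "\<dots> = (\<integral>\<^sup>+ w. f w \<partial>weights_law \<alpha>)"
    unfolding R[OF f] \<alpha>(2) ..
  finally show ?thesis .
qed

primrec column_flips :: "nat \<Rightarrow> nat \<Rightarrow> (int \<times> int \<Rightarrow> real) \<Rightarrow> int \<times> int \<Rightarrow> real" where
  "column_flips i 0 w = w"
| "column_flips i (Suc j) w = corner_flip i (Suc j) (column_flips i j w)"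

primrec box_flips :: "nat \<Rightarrow> nat \<Rightarrow> (int \<times> int \<Rightarrow> real) \<Rightarrow> int \<times> int \<Rightarrow> real" where
  "box_flips 0 n w = w"
| "box_flips (Suc i) n w = column_flips (Suc i) n (box_flips i n w)"

text \<open>
  Only the box \<open>{0..m} \<times> {0..n}\<close> is constrained, because rates are changed at finitely many sites at a
  time and keep their old values elsewhere.
\<close>

definition box_rates :: "nat \<Rightarrow> nat \<Rightarrow> real \<Rightarrow> real \<Rightarrow> (int \<times> int \<Rightarrow> real) \<Rightarrow> bool" where
  "box_rates m n a b \<alpha> \<longleftrightarrow> (\<forall>z. 0 < \<alpha> z) \<and> (\<forall>i\<in>{1..m}. \<alpha> (int i, 0) = a) \<and>
     (\<forall>j\<in>{1..n}. \<alpha> (0, int j) = b) \<and> (\<forall>i\<in>{1..m}. \<forall>j\<in>{1..n}. \<alpha> (int i, int j) = 1)"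

lemma measurable_column_flips: "0 < i \<Longrightarrow> column_flips i j \<in> configurations \<rightarrow>\<^sub>M configurations"
proof (induction j)
  case (Suc j)
  then show ?case
    using measurable_compose[OF Suc.IH measurable_corner_flip[of i "Suc j"]]
    by (simp add: column_flips.simps(2)[abs_def])
qed (simp add: column_flips.simps(1)[abs_def])

lemma nn_integral_column_flips:
  assumes "box_rates m n a b \<alpha>" "a + b = 1" "1 \<le> i" "i \<le> m" "j \<le> n"
    and f: "f \<in> borel_measurable configurations"
  shows "(\<integral>\<^sup>+ w. f (column_flips i j w) \<partial>weights_law \<alpha>) = (\<integral>\<^sup>+ w. f w \<partial>weights_law \<alpha>)"
  using assms(5) f
proof (induction j arbitrary: f)
  case (Suc j)
  have "(\<integral>\<^sup>+ w. f (column_flips i (Suc j) w) \<partial>weights_law \<alpha>)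
      = (\<integral>\<^sup>+ w. f (corner_flip i (Suc j) w) \<partial>weights_law \<alpha>)"
    using Suc.prems assms(3)
      Suc.IH[OF _ measurable_compose[OF measurable_corner_flip[of i "Suc j"] Suc.prems(2)]] by simp
  also have "\<dots> = (\<integral>\<^sup>+ w. f w \<partial>weights_law \<alpha>)"
    using assms(1-4) Suc.prems unfolding box_rates_def
    by (intro nn_integral_corner_flip) (auto simp: Ball_def simp del: of_nat_Suc)
  finally show ?case .
qed simp

lemma nn_integral_box_flips:
  assumes "box_rates m n a b \<alpha>" "a + b = 1" "i \<le> m"
    and f: "f \<in> borel_measurable configurations"
  shows "(\<integral>\<^sup>+ w. f (box_flips i n w) \<partial>weights_law \<alpha>) = (\<integral>\<^sup>+ w. f w \<partial>weights_law \<alpha>)"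
  using assms(3) f
proof (induction i arbitrary: f)
  case (Suc i)
  have "(\<integral>\<^sup>+ w. f (box_flips (Suc i) n w) \<partial>weights_law \<alpha>)
      = (\<integral>\<^sup>+ w. f (column_flips (Suc i) n w) \<partial>weights_law \<alpha>)"
    using Suc.prems
      Suc.IH[OF _ measurable_compose[OF measurable_column_flips[of "Suc i" n] Suc.prems(2)]] by simp
  also have "\<dots> = (\<integral>\<^sup>+ w. f w \<partial>weights_law \<alpha>)"
    using Suc.prems by (intro nn_integral_column_flips[OF assms(1,2)]) auto
  finally show ?case .
qed simp

text \<open>
  Last passage times with arbitrary values \<open>A\<close>, \<open>B\<close> on the two axes.  The value at the origin is taken from
  \<open>A\<close>; lemmas that need it on both axes assume \<open>A 0 = B 0\<close>.
\<close>

fun passage_time :: "(nat \<Rightarrow> real) \<Rightarrow> (nat \<Rightarrow> real) \<Rightarrow> (int \<times> int \<Rightarrow> real) \<Rightarrow> nat \<Rightarrow> nat \<Rightarrow> real" where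
  "passage_time A B w i 0 = A i"
| "passage_time A B w 0 (Suc j) = B (Suc j)"
| "passage_time A B w (Suc i) (Suc j) =
     w (int (Suc i), int (Suc j)) + max (passage_time A B w i (Suc j)) (passage_time A B w (Suc i) j)"

definition x_sum :: "(int \<times> int \<Rightarrow> real) \<Rightarrow> nat \<Rightarrow> real" where
  "x_sum w k = (\<Sum>i=1..k. w (int i, 0))"

definition y_sum :: "(int \<times> int \<Rightarrow> real) \<Rightarrow> nat \<Rightarrow> real" where
  "y_sum w l = (\<Sum>j=1..l. w (0, int j))"

definition boundary_passage :: "(int \<times> int \<Rightarrow> real) \<Rightarrow> nat \<Rightarrow> nat \<Rightarrow> real" where
  "boundary_passage w = passage_time (x_sum w) (y_sum w) w"

lemma x_sum_simps [simp]: "x_sum w 0 = 0" "x_sum w (Suc k) = x_sum w k + w (int (Suc k), 0)"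
  by (auto simp: x_sum_def)

lemma y_sum_simps [simp]: "y_sum w 0 = 0" "y_sum w (Suc k) = y_sum w k + w (0, int (Suc k))"
  by (auto simp: y_sum_def)

lemma boundary_passage_simps:
  "boundary_passage w i 0 = x_sum w i" "boundary_passage w 0 j = y_sum w j"
  "boundary_passage w (Suc i) (Suc j) = w (int (Suc i), int (Suc j)) +
     max (boundary_passage w i (Suc j)) (boundary_passage w (Suc i) j)"
  by (cases j; simp add: boundary_passage_def)+

text \<open>
  Flipping the corners of column \<open>i + 1\<close> from below moves the horizontal increment of that column up by one
  row each time and replaces the vertical increments of column \<open>i\<close>, one after the other, by those of
  column \<open>i + 1\<close>.
\<close>

lemma column_flips_increments:
  assumes J: "\<And>j. j < n \<Longrightarrow> u (0, int (Suc j)) = boundary_passage w i (Suc j) - boundary_passage w i j"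
    and u: "\<And>x y. int i < x \<Longrightarrow> u (x, y) = w (x, y)" and "j \<le> n"
  shows "column_flips (Suc i) j u (int (Suc i), 0) = boundary_passage w (Suc i) j - boundary_passage w i j
    \<and> (\<forall>k<j. column_flips (Suc i) j u (0, int (Suc k))
         = boundary_passage w (Suc i) (Suc k) - boundary_passage w (Suc i) k)
    \<and> (\<forall>k\<ge>j. column_flips (Suc i) j u (0, int (Suc k)) = u (0, int (Suc k)))
    \<and> (\<forall>k\<ge>j. column_flips (Suc i) j u (int (Suc i), int (Suc k)) = w (int (Suc i), int (Suc k)))
    \<and> (\<forall>x y. int (Suc i) < x \<longrightarrow> column_flips (Suc i) j u (x, y) = w (x, y))"
  using assms(3)
proof (induction j)
  case 0
  then show ?case using u by (simp add: boundary_passage_simps)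
next
  case (Suc j)
  let ?v = "column_flips (Suc i) j u"
  from Suc have IH: "?v (int (Suc i), 0) = boundary_passage w (Suc i) j - boundary_passage w i j"
    "\<And>k. k < j \<Longrightarrow> ?v (0, int (Suc k)) = boundary_passage w (Suc i) (Suc k) - boundary_passage w (Suc i) k"
    "\<And>k. j \<le> k \<Longrightarrow> ?v (0, int (Suc k)) = u (0, int (Suc k))"
    "\<And>k. j \<le> k \<Longrightarrow> ?v (int (Suc i), int (Suc k)) = w (int (Suc i), int (Suc k))"
    "\<And>x y. int (Suc i) < x \<Longrightarrow> ?v (x, y) = w (x, y)"
    by auto
  have J': "?v (0, int (Suc j)) = boundary_passage w i (Suc j) - boundary_passage w i j"
    using IH(3)[of j] J[of j] Suc.prems by simp
  note G = boundary_passage_simps(3)[of w i j]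
  show ?case
    using IH J' G
    by (auto simp: corner_flip_def Let_def less_Suc_eq simp del: of_nat_Suc)
qed

lemma box_flips_increments:
  "(\<forall>j<n. box_flips i n w (0, int (Suc j)) = boundary_passage w i (Suc j) - boundary_passage w i j)
    \<and> (\<forall>x y. int i < x \<longrightarrow> box_flips i n w (x, y) = w (x, y))"
proof (induction i)
  case 0
  then show ?case by (simp add: boundary_passage_simps)
next
  case (Suc i)
  then show ?case
    using column_flips_increments[of n "box_flips i n w" w i n] by simp
qed

lemma y_sum_box_flips: "y_sum (box_flips m n w) n = boundary_passage w m n - x_sum w m"
proof -
  have "j \<le> n \<Longrightarrow> y_sum (box_flips m n w) j = boundary_passage w m j - x_sum w m" for j
    using box_flips_increments[of n m w]
    by (induction j) (simp_all add: boundary_passage_simps(1) del: of_nat_Suc)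
  then show ?thesis by simp
qed

lemma y_sum_measurable: "(\<lambda>w. y_sum w n) \<in> borel_measurable configurations"
  unfolding y_sum_def
  by (intro borel_measurable_sum measurable_weight) (auto simp: weight_sites_iff)

lemma x_sum_measurable: "(\<lambda>w. x_sum w n) \<in> borel_measurable configurations"
  unfolding x_sum_def
  by (intro borel_measurable_sum measurable_weight) (auto simp: weight_sites_iff)

lemma passage_time_measurable:
  assumes A: "\<And>i. (\<lambda>w. A w i) \<in> borel_measurable configurations"
    and B: "\<And>j. (\<lambda>w. B w j) \<in> borel_measurable configurations"
  shows "(\<lambda>w. passage_time (A w) (B w) w i j) \<in> borel_measurable configurations"
proof (induction j arbitrary: i)
  case (Suc j)
  note j = Suc.IH
  show ?case
  proof (induction i)
    case (Suc i)
    then show ?case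
      unfolding passage_time.simps
      by (intro borel_measurable_add borel_measurable_max measurable_weight j)
        (auto simp: weight_sites_iff)
  qed (simp add: B)
qed (simp add: A)

lemma boundary_passage_measurable: "(\<lambda>w. boundary_passage w i j) \<in> borel_measurable configurations"
  unfolding boundary_passage_def by (intro passage_time_measurable x_sum_measurable y_sum_measurable)

text \<open>
  The flips preserve the law and turn the boundary weights of the second axis into the increments along
  column \<open>m\<close>.  Hence the rise of the passage time along column \<open>m\<close> has the law of the rise along the axis.
\<close>

theorem burke:
  assumes "box_rates m n a b \<alpha>" "a + b = 1" and g: "g \<in> borel_measurable borel"
  shows "(\<integral>\<^sup>+ w. g (boundary_passage w m n - x_sum w m) \<partial>weights_law \<alpha>)
    = (\<integral>\<^sup>+ w. g (y_sum w n) \<partial>weights_law \<alpha>)"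
  using nn_integral_box_flips[OF assms(1,2) order_refl measurable_compose[OF y_sum_measurable[of n] g]]
  by (simp add: y_sum_box_flips)

section \<open>Exponential moments\<close>

text \<open>
  The integrand is a constant times the likelihood ratio of the law with rates \<open>a - \<theta>\<close> on \<open>F\<close>, and
  that law has total mass one.
\<close>

lemma exp_moment_sum:
  assumes F: "finite F" "F \<subseteq> weight_sites" and pos: "\<And>z. 0 < \<alpha> z"
    and a: "\<And>p. p \<in> F \<Longrightarrow> \<alpha> p = a" and "0 < a" "\<theta> < a"
  shows "(\<integral>\<^sup>+ w. ennreal (exp (\<theta> * (\<Sum>p\<in>F. w p))) \<partial>weights_law \<alpha>) = ennreal ((a / (a - \<theta>)) ^ card F)"
proof -
  let ?\<beta> = "\<lambda>z. if z \<in> F then a - \<theta> else \<alpha> z"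
  have \<beta>: "0 < ?\<beta> z" for z using pos assms by auto
  interpret prob_space "weights_law ?\<beta>" by (rule prob_space_weights_law[OF \<beta>])
  let ?c = "((a - \<theta>) / a) ^ card F"
  have c: "0 < ?c" "?c * (a / (a - \<theta>)) ^ card F = 1"
    using assms by (auto simp: power_mult_distrib[symmetric])
  have meas: "(\<lambda>w. \<Sum>p\<in>F. w p) \<in> borel_measurable configurations"
    using F by (intro borel_measurable_sum measurable_weight) auto
  have "1 = (\<integral>\<^sup>+ w. 1 \<partial>weights_law ?\<beta>)"
    using emeasure_space_1 by simp
  also have "\<dots> = (\<integral>\<^sup>+ w. (\<Prod>p\<in>F. ennreal (?\<beta> p / \<alpha> p * exp ((\<alpha> p - ?\<beta> p) * w p))) * 1 \<partial>weights_law \<alpha>)"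
    using F \<beta> pos by (intro nn_integral_weights_law_density) auto
  also have "\<dots> = (\<integral>\<^sup>+ w. ennreal ?c * ennreal (exp (\<theta> * (\<Sum>p\<in>F. w p))) \<partial>weights_law \<alpha>)"
  proof (intro nn_integral_cong)
    fix w
    have "(\<Prod>p\<in>F. ennreal (?\<beta> p / \<alpha> p * exp ((\<alpha> p - ?\<beta> p) * w p)))
        = ennreal (\<Prod>p\<in>F. (a - \<theta>) / a * exp (\<theta> * w p))"
      using assms(5,6) a by (subst prod_ennreal[symmetric]) (auto intro!: prod.cong)
    also have "(\<Prod>p\<in>F. (a - \<theta>) / a * exp (\<theta> * w p)) = ?c * exp (\<theta> * (\<Sum>p\<in>F. w p))"
      using F by (simp only: prod.distrib prod_constant sum_distrib_left exp_sum)
    finally show "(\<Prod>p\<in>F. ennreal (?\<beta> p / \<alpha> p * exp ((\<alpha> p - ?\<beta> p) * w p))) * 1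
        = ennreal ?c * ennreal (exp (\<theta> * (\<Sum>p\<in>F. w p)))"
      using c by (simp add: ennreal_mult')
  qed
  also have "\<dots> = ennreal ?c * (\<integral>\<^sup>+ w. ennreal (exp (\<theta> * (\<Sum>p\<in>F. w p))) \<partial>weights_law \<alpha>)"
    using meas by (intro nn_integral_cmult) simp
  finally have "ennreal ((a / (a - \<theta>)) ^ card F) =
      ennreal ((a / (a - \<theta>)) ^ card F) * (ennreal ?c * (\<integral>\<^sup>+ w. ennreal (exp (\<theta> * (\<Sum>p\<in>F. w p))) \<partial>weights_law \<alpha>))"
    by simp
  also have "\<dots> = ennreal ((a / (a - \<theta>)) ^ card F * ?c) * (\<integral>\<^sup>+ w. ennreal (exp (\<theta> * (\<Sum>p\<in>F. w p))) \<partial>weights_law \<alpha>)"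
    using c by (subst ennreal_mult'') (auto simp: ac_simps)
  also have "(a / (a - \<theta>)) ^ card F * ?c = 1" using c by (simp add: mult.commute)
  finally show ?thesis by simp
qed

definition x_sites :: "nat set \<Rightarrow> (int \<times> int) set" where
  "x_sites K = (\<lambda>i. (int i, 0)) ` K"

definition y_sites :: "nat set \<Rightarrow> (int \<times> int) set" where
  "y_sites K = (\<lambda>j. (0, int j)) ` K"

lemma x_sites_simps:
  "finite K \<Longrightarrow> finite (x_sites K)" "card (x_sites K) = card K" "0 \<notin> K \<Longrightarrow> x_sites K \<subseteq> weight_sites"
  "(\<Sum>p\<in>x_sites K. f p) = (\<Sum>i\<in>K. f (int i, 0) :: real)"
  by (auto simp: x_sites_def weight_sites_iff card_image inj_on_def sum.reindex intro: gr0I)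

lemma y_sites_simps:
  "finite K \<Longrightarrow> finite (y_sites K)" "card (y_sites K) = card K" "0 \<notin> K \<Longrightarrow> y_sites K \<subseteq> weight_sites"
  "(\<Sum>p\<in>y_sites K. f p) = (\<Sum>i\<in>K. f (0, int i) :: real)"
  by (auto simp: y_sites_def weight_sites_iff card_image inj_on_def sum.reindex intro: gr0I)

text \<open>
  Change the rate on the first axis from \<open>u\<close> to \<open>z\<close>, which makes the environment stationary.  The
  likelihood ratio contributes \<open>exp (- (u - z) H)\<close>, where \<open>H\<close> is the sum of the weights on the first axis.
  So the exponent becomes \<open>(u - z) (G - H)\<close>, where \<open>G - H\<close> is the rise along the last column, a sum of
  \<open>n\<close> independent variables of rate \<open>1 - z\<close> in law, by Burke's theorem.
\<close>

theorem boundary_passage_mgf: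
  assumes \<alpha>: "box_rates m n u (1 - z) \<alpha>" and uz: "0 < u" "u < 1" "0 < z" "z < 1"
  shows "(\<integral>\<^sup>+ w. ennreal (exp ((u - z) * boundary_passage w m n)) \<partial>weights_law \<alpha>)
    = ennreal ((u / z) ^ m * ((1 - z) / (1 - u)) ^ n)"
proof -
  let ?F = "x_sites {1..m}"
  let ?\<gamma> = "\<lambda>p. if p \<in> ?F then z else \<alpha> p"
  have pos: "0 < \<alpha> p" "0 < ?\<gamma> p" for p
    using \<alpha> uz unfolding box_rates_def by metis+
  have F: "finite ?F" "?F \<subseteq> weight_sites" "card ?F = m" by (auto simp: x_sites_simps)
  have \<gamma>: "box_rates m n z (1 - z) ?\<gamma>"
    using \<alpha> pos uz by (auto simp: box_rates_def x_sites_def)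
  have \<alpha>F: "\<alpha> p = u" if "p \<in> ?F" for p
    using \<alpha> that by (auto simp: box_rates_def x_sites_def)
  note [measurable] = boundary_passage_measurable x_sum_measurable y_sum_measurable
  have "(\<integral>\<^sup>+ w. ennreal (exp ((u - z) * boundary_passage w m n)) \<partial>weights_law \<alpha>)
      = (\<integral>\<^sup>+ w. (\<Prod>p\<in>?F. ennreal (\<alpha> p / ?\<gamma> p * exp ((?\<gamma> p - \<alpha> p) * w p)))
          * ennreal (exp ((u - z) * boundary_passage w m n)) \<partial>weights_law ?\<gamma>)"
    using F pos by (intro nn_integral_weights_law_density) auto
  also have "\<dots> = (\<integral>\<^sup>+ w. ennreal ((u / z) ^ m) * ennreal (exp ((u - z) * (boundary_passage w m n - x_sum w m))) \<partial>weights_law ?\<gamma>)"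
  proof (intro nn_integral_cong)
    fix w
    have "(\<Prod>p\<in>?F. ennreal (\<alpha> p / ?\<gamma> p * exp ((?\<gamma> p - \<alpha> p) * w p))) = ennreal (\<Prod>p\<in>?F. u / z * exp ((z - u) * w p))"
      using uz \<alpha>F by (subst prod_ennreal[symmetric]) (auto intro!: prod.cong)
    also have "(\<Prod>p\<in>?F. u / z * exp ((z - u) * w p)) = (u / z) ^ m * exp ((z - u) * (\<Sum>p\<in>?F. w p))"
      using F by (simp only: prod.distrib prod_constant sum_distrib_left exp_sum)
    also have "(\<Sum>p\<in>?F. w p) = x_sum w m"
      by (simp add: x_sites_simps x_sum_def)
    finally have "(\<Prod>p\<in>?F. ennreal (\<alpha> p / ?\<gamma> p * exp ((?\<gamma> p - \<alpha> p) * w p))) = ennreal ((u / z) ^ m * exp ((z - u) * x_sum w m))" .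
    moreover have "exp ((z - u) * x_sum w m) * exp ((u - z) * boundary_passage w m n)
        = exp ((u - z) * (boundary_passage w m n - x_sum w m))"
      by (simp add: exp_add[symmetric] algebra_simps)
    ultimately show "(\<Prod>p\<in>?F. ennreal (\<alpha> p / ?\<gamma> p * exp ((?\<gamma> p - \<alpha> p) * w p))) * ennreal (exp ((u - z) * boundary_passage w m n))
       = ennreal ((u / z) ^ m) * ennreal (exp ((u - z) * (boundary_passage w m n - x_sum w m)))"
      using uz by (simp add: ennreal_mult'[symmetric] mult.assoc)
  qed
  also have "\<dots> = ennreal ((u / z) ^ m) * (\<integral>\<^sup>+ w. ennreal (exp ((u - z) * (boundary_passage w m n - x_sum w m))) \<partial>weights_law ?\<gamma>)"
    by (intro nn_integral_cmult) measurable
  also have "(\<integral>\<^sup>+ w. ennreal (exp ((u - z) * (boundary_passage w m n - x_sum w m))) \<partial>weights_law ?\<gamma>)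
      = (\<integral>\<^sup>+ w. ennreal (exp ((u - z) * y_sum w n)) \<partial>weights_law ?\<gamma>)"
    by (rule burke[OF \<gamma>, where g="\<lambda>x. ennreal (exp ((u - z) * x))"]) (auto simp: uz)
  also have "\<dots> = (\<integral>\<^sup>+ w. ennreal (exp ((u - z) * (\<Sum>p\<in>y_sites {1..n}. w p))) \<partial>weights_law ?\<gamma>)"
    by (simp add: y_sites_simps y_sum_def)
  also have "\<dots> = ennreal (((1 - z) / (1 - z - (u - z))) ^ card (y_sites {1..n}))"
    using \<gamma> uz by (intro exp_moment_sum pos) (auto simp: y_sites_simps y_sites_def box_rates_def weight_sites_iff)
  finally show ?thesis
    using uz by (simp add: y_sites_simps ennreal_mult')
qed

section \<open>Last passage values and exit times\<close>

lemma up_right_paths_singleton: "[x] \<in> up_right_paths x x"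
  by (simp add: up_right_paths_def)

lemma up_right_paths_iff:
  "\<pi> \<in> up_right_paths x y \<longleftrightarrow> \<pi> \<noteq> [] \<and> hd \<pi> = x \<and> last \<pi> = y \<and>
     successively (\<lambda>u v. v = u + (1, 0) \<or> v = u + (0, 1)) \<pi>"
  unfolding up_right_paths_def by blast

lemma up_right_paths_snoc:
  assumes "\<sigma> \<in> up_right_paths x y" "v = y + (1, 0) \<or> v = y + (0, 1)"
  shows "\<sigma> @ [v] \<in> up_right_paths x v"
proof -
  have \<sigma>: "\<sigma> \<noteq> []" "hd \<sigma> = x" "last \<sigma> = y"
     "successively (\<lambda>u v. v = u + (1, 0) \<or> v = u + (0, 1)) \<sigma>"
     using assms(1) unfolding up_right_paths_iff by blast+
  show ?thesis
    unfolding up_right_paths_iff successively_append_iff \<sigma>(3) list.sel successively.simps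
    using \<sigma>(1,2,4) assms(2) hd_append2[OF \<sigma>(1), of "[v]"] last_snoc[of \<sigma> v] by blast
qed

lemma up_right_paths_cases:
  assumes "\<pi> \<in> up_right_paths x v"
  obtains "\<pi> = [v]" "x = v"
  | \<sigma> y where "\<pi> = \<sigma> @ [v]" "\<sigma> \<in> up_right_paths x y" "v = y + (1, 0) \<or> v = y + (0, 1)"
proof (cases \<pi> rule: rev_cases)
  case Nil
  moreover have "\<pi> \<noteq> []" using assms unfolding up_right_paths_iff by (rule conjunct1)
  ultimately show ?thesis by contradiction
next
  case (snoc \<sigma> a)
  have \<pi>: "hd \<pi> = x" "last \<pi> = v" "successively (\<lambda>u v. v = u + (1, 0) \<or> v = u + (0, 1)) (\<sigma> @ [a])"
    using assms unfolding up_right_paths_iff snoc by blast+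
  have a: "a = v" using \<pi>(2) unfolding snoc last_snoc .
  show ?thesis
  proof (cases "\<sigma> = []")
    case True
    have \<pi>v: "\<pi> = [v]" unfolding snoc a True by simp
    have "x = v" using \<pi>(1) unfolding \<pi>v by simp
    from that(1)[OF \<pi>v this] show ?thesis .
  next
    case False
    have succ: "successively (\<lambda>u v. v = u + (1, 0) \<or> v = u + (0, 1)) \<sigma>"
      "v = last \<sigma> + (1, 0) \<or> v = last \<sigma> + (0, 1)"
      using \<pi>(3) False unfolding successively_append_iff a list.sel by blast+
    have "hd \<sigma> = x" using \<pi>(1) hd_append2[OF False, of "[a]"] unfolding snoc by simp
    then have "\<sigma> \<in> up_right_paths x (last \<sigma>)"
      unfolding up_right_paths_iff using succ(1) False by (intro conjI refl)
    from that(2)[OF snoc[unfolded a] this succ(2)] show ?thesis .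
  qed
qed

lemma up_right_paths_le:
  "\<pi> \<in> up_right_paths x y \<Longrightarrow> x \<le> y \<and> (\<forall>z\<in>set \<pi>. x \<le> z)"
proof (induction \<pi> arbitrary: y rule: rev_induct)
  case Nil
  then show ?case by (simp add: up_right_paths_def)
next
  case (snoc a \<pi>)
  from snoc.prems show ?case
  proof (cases rule: up_right_paths_cases)
    case 1
    then show ?thesis by simp
  next
    case (2 \<sigma> y')
    with snoc.IH[of y'] have x: "x \<le> y'" "\<forall>z\<in>set \<pi>. x \<le> z" by simp_all
    have "y' \<le> y" using 2(3) by (auto simp: less_eq_prod_def)
    from order_trans[OF x(1) this] x(2) 2(1) show ?thesis by simp
  qed
qed

lemma up_right_paths_nonempty:
  assumes "a \<le> c" "b \<le> d"
  shows "up_right_paths (a, b) (c, d) \<noteq> {}"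
proof -
  have "up_right_paths (a, b) (a, d) \<noteq> {}"
    using assms(2)
  proof (induction d rule: int_ge_induct)
    case base
    then show ?case using up_right_paths_singleton by blast
  next
    case (step d)
    then obtain \<sigma> where "\<sigma> \<in> up_right_paths (a, b) (a, d)" by blast
    from up_right_paths_snoc[OF this, of "(a, d + 1)"] show ?case by auto
  qed
  with assms(1) show ?thesis
  proof (induction c rule: int_ge_induct)
    case (step c)
    then obtain \<sigma> where "\<sigma> \<in> up_right_paths (a, b) (c, d)" by blast
    from up_right_paths_snoc[OF this, of "(c + 1, d)"] show ?case by auto
  qed simp
qed

lemma last_passage_ge: "\<pi> \<in> up_right_paths x y \<Longrightarrow> sum_list (map w \<pi>) \<le> last_passage w x y"
  unfolding last_passage_def by (intro Max_ge) (auto simp: finite_up_right_paths)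

lemma last_passage_attained:
  assumes "x \<le> y"
  obtains \<pi> where "\<pi> \<in> up_right_paths x y" "last_passage w x y = sum_list (map w \<pi>)"
proof -
  have "up_right_paths x y \<noteq> {}"
    using up_right_paths_nonempty[of "fst x" "fst y" "snd x" "snd y"] assms
    by (simp add: less_eq_prod_def)
  then have "last_passage w x y \<in> (\<lambda>\<pi>. sum_list (map w \<pi>)) ` up_right_paths x y"
    unfolding last_passage_def by (intro Max_in) (auto simp: finite_up_right_paths)
  with that show ?thesis by blast
qed

lemma last_passage_step_le:
  assumes "x \<le> y" "v = y + (1, 0) \<or> v = y + (0, 1)"
  shows "last_passage w x y + w v \<le> last_passage w x v"
proof -
  obtain \<pi> where \<pi>: "\<pi> \<in> up_right_paths x y" "last_passage w x y = sum_list (map w \<pi>)"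
    using last_passage_attained[OF assms(1)] .
  from last_passage_ge[OF up_right_paths_snoc[OF \<pi>(1) assms(2)], of w] \<pi>(2)
  show ?thesis by simp
qed

lemma last_passage_refl_ge: "w x \<le> last_passage w x x"
  using last_passage_ge[OF up_right_paths_singleton, of w x] by simp

lemma last_passage_cases:
  assumes "x \<le> v"
  obtains "x = v" "last_passage w x v = w v"
  | y where "x \<le> y" "v = y + (1, 0) \<or> v = y + (0, 1)" "last_passage w x v \<le> last_passage w x y + w v"
proof -
  obtain \<pi> where \<pi>: "\<pi> \<in> up_right_paths x v" "last_passage w x v = sum_list (map w \<pi>)"
    using last_passage_attained[OF assms] .
  from \<pi>(1) show ?thesis
  proof (cases rule: up_right_paths_cases)
    case 1
    with \<pi>(2) show ?thesis using that(1) by simp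
  next
    case (2 \<sigma> y)
    have "x \<le> y" using up_right_paths_le[OF 2(2)] by simp
    with 2 \<pi>(2) last_passage_ge[OF 2(2), of w] show ?thesis using that(2)[of y] by simp
  qed
qed

abbreviation x_tail :: "(int \<times> int \<Rightarrow> real) \<Rightarrow> nat \<Rightarrow> nat \<Rightarrow> nat \<Rightarrow> real" where
  "x_tail w i j k \<equiv> last_passage w (int k, 1) (int i, int j)"

abbreviation y_tail :: "(int \<times> int \<Rightarrow> real) \<Rightarrow> nat \<Rightarrow> nat \<Rightarrow> nat \<Rightarrow> real" where
  "y_tail w i j l \<equiv> last_passage w (1, int l) (int i, int j)"

text \<open>
  Together with \<open>passage_time_le_exit\<close>: the recursion computes the maximum over all exits, for arbitrary
  boundary values.  Penalising or rescaling an exit is then a change of boundary values.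
\<close>

lemma passage_time_ge_exit:
  assumes AB: "A 0 = B 0" and k: "1 \<le> k"
  shows "1 \<le> j \<Longrightarrow> k \<le> i \<Longrightarrow> A k + x_tail w i j k \<le> passage_time A B w i j"
    and "1 \<le> i \<Longrightarrow> k \<le> j \<Longrightarrow> B k + y_tail w i j k \<le> passage_time A B w i j"
proof (induction "i + j" arbitrary: i j rule: less_induct)
  case less
  {
    case 1
    define i' j' where "i' = i - 1" and "j' = j - 1"
    have ij: "i = Suc i'" "j = Suc j'" using 1 k by (simp_all add: i'_def j'_def)
    have "(int k, 1) \<le> (int i, int j)" using 1 by (simp add: less_eq_prod_def)
    then show ?case
    proof (cases rule: last_passage_cases[where w=w])
      case 1
      have kj: "k = i" "j = 1" using 1(1) by simp_all
      have "passage_time A B w i 1 = w (int i, int 1) + max (passage_time A B w i' 1) (A i)"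
        using ij(1) by simp
      with 1(2) show ?thesis unfolding kj by linarith
    next
      case (2 y)
      from 2(2) show ?thesis
      proof
        assume y: "(int i, int j) = y + (1, 0)"
        then have y': "y = (int i', int j)" using ij by (cases y) auto
        with 2 have "k \<le> i'" by (simp add: less_eq_prod_def)
        from less(1)[of i' j] this 1 ij have "A k + x_tail w i' j k \<le> passage_time A B w i' j" by simp
        with 2 y' show ?thesis using ij by simp
      next
        assume y: "(int i, int j) = y + (0, 1)"
        then have y': "y = (int i, int j')" using ij by (cases y) auto
        with 2 have "1 \<le> j'" by (simp add: less_eq_prod_def)
        from less(1)[of i j'] this 1 ij have "A k + x_tail w i j' k \<le> passage_time A B w i j'" by simp
        with 2 y' show ?thesis using ij by simp
      qed
    qed
  next
    case 2
    note prems = 2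
    define i' j' where "i' = i - 1" and "j' = j - 1"
    have ij: "i = Suc i'" "j = Suc j'" using 2 k by (simp_all add: i'_def j'_def)
    have "(1, int k) \<le> (int i, int j)" using 2 by (simp add: less_eq_prod_def)
    then show ?case
    proof (cases rule: last_passage_cases[where w=w])
      case 1
      have kj: "k = j" "i = 1" using 1(1) by simp_all
      have "passage_time A B w 1 j = w (int 1, int j) + max (B j) (passage_time A B w 1 j')"
        using ij(2) by simp
      with 1(2) show ?thesis unfolding kj by linarith
    next
      case (2 y)
      from 2(2) show ?thesis
      proof
        assume y: "(int i, int j) = y + (1, 0)"
        then have y': "y = (int i', int j)" using ij by (cases y) auto
        with 2 have "1 \<le> i'" by (simp add: less_eq_prod_def)
        from less(2)[of i' j] this prems ij have "B k + y_tail w i' j k \<le> passage_time A B w i' j" by simp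
        with 2 y' show ?thesis using ij by simp
      next
        assume y: "(int i, int j) = y + (0, 1)"
        then have y': "y = (int i, int j')" using ij by (cases y) auto
        with 2 have "k \<le> j'" by (simp add: less_eq_prod_def)
        from less(2)[of i j'] this prems ij have "B k + y_tail w i j' k \<le> passage_time A B w i j'" by simp
        with 2 y' show ?thesis using ij by simp
      qed
    qed
  }
qed

lemma passage_time_le_exit:
  assumes "1 \<le> i" "1 \<le> j"
  shows "(\<exists>k\<in>{1..i}. passage_time A B w i j \<le> A k + x_tail w i j k)
       \<or> (\<exists>l\<in>{1..j}. passage_time A B w i j \<le> B l + y_tail w i j l)"
  using assms
proof (induction "i + j" arbitrary: i j rule: less_induct)
  case less
  define i' j' where "i' = i - 1" and "j' = j - 1"
    have ij: "i = Suc i'" "j = Suc j'" using less.prems by (simp_all add: i'_def j'_def)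
  have step1: "x_tail w i' j k + w (int i, int j) \<le> x_tail w i j k" if "k \<le> i'" for k
    using that ij by (intro last_passage_step_le) (auto simp: less_eq_prod_def)
  have step2: "x_tail w i j' k + w (int i, int j) \<le> x_tail w i j k" if "k \<le> i" "1 \<le> j'" for k
    using that ij by (intro last_passage_step_le) (auto simp: less_eq_prod_def)
  have step3: "y_tail w i' j k + w (int i, int j) \<le> y_tail w i j k" if "k \<le> j" "1 \<le> i'" for k
    using that ij by (intro last_passage_step_le) (auto simp: less_eq_prod_def)
  have step4: "y_tail w i j' k + w (int i, int j) \<le> y_tail w i j k" if "k \<le> j'" for k
    using that ij by (intro last_passage_step_le) (auto simp: less_eq_prod_def)
  consider (left) "passage_time A B w i j = w (int i, int j) + passage_time A B w i' j"
    | (down) "passage_time A B w i j = w (int i, int j) + passage_time A B w i j'"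
  proof -
    have "passage_time A B w i j = w (int i, int j) + passage_time A B w i' j \<or>
        passage_time A B w i j = w (int i, int j) + passage_time A B w i j'"
      using ij by (simp add: max_def)
    then show ?thesis using left down by blast
  qed
  then show ?case
  proof cases
    case left
    show ?thesis
    proof (cases "i' = 0")
      case True
      then have "passage_time A B w i j \<le> B j + y_tail w i j j"
        using left ij last_passage_refl_ge[of w "(1, int j)"] by simp
      then show ?thesis using less by auto
    next
      case False
      then consider k where "k \<in> {1..i'}" "passage_time A B w i' j \<le> A k + x_tail w i' j k"
        | l where "l \<in> {1..j}" "passage_time A B w i' j \<le> B l + y_tail w i' j l"
        using less.hyps[of i' j] less.prems ij by fastforce
      then show ?thesis
      proof cases
        case (1 k)
        with step1[of k] left ij show ?thesis by (intro disjI1 bexI[of _ k]) auto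
      next
        case (2 l)
        with step3[of l] left ij False show ?thesis by (intro disjI2 bexI[of _ l]) auto
      qed
    qed
  next
    case down
    show ?thesis
    proof (cases "j' = 0")
      case True
      then have "passage_time A B w i j \<le> A i + x_tail w i j i"
        using down ij last_passage_refl_ge[of w "(int i, 1)"] by simp
      then show ?thesis using less by auto
    next
      case False
      then consider k where "k \<in> {1..i}" "passage_time A B w i j' \<le> A k + x_tail w i j' k"
        | l where "l \<in> {1..j'}" "passage_time A B w i j' \<le> B l + y_tail w i j' l"
        using less.hyps[of i j'] less.prems ij by fastforce
      then show ?thesis
      proof cases
        case (1 k)
        with step2[of k] down ij False show ?thesis by (intro disjI1 bexI[of _ k]) auto
      next
        case (2 l)
        with step4[of l] down ij show ?thesis by (intro disjI2 bexI[of _ l]) auto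
      qed
    qed
  qed
qed

lemma passage_time_mono:
  assumes "\<And>k. A k \<le> A' k" "\<And>l. B l \<le> B' l"
  shows "passage_time A B w i j \<le> passage_time A' B' w i j"
  using assms by (induction A B w i j rule: passage_time.induct) (auto simp: max.coboundedI1 max.coboundedI2)

text \<open>
  Across one cell with weight \<open>w\<close>, the increments \<open>I\<close> of the lower edge and \<open>J\<close> of the left edge
  become \<open>w + max 0 (I - J)\<close> on the upper and \<open>w + max 0 (J - I)\<close> on the right edge.  The former is increasing
  in \<open>I\<close> and decreasing in \<open>J\<close>, the latter conversely, so an ordering of the boundary increments propagates.
\<close>

lemma passage_time_increments_mono:
  fixes w :: "int \<times> int \<Rightarrow> real"
  assumes 0: "A 0 = B 0" "A' 0 = B' 0"
    and A: "\<And>i. A (Suc i) - A i \<le> A' (Suc i) - A' i"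
    and B: "\<And>j. B' (Suc j) - B' j \<le> B (Suc j) - B j"
  defines "P \<equiv> passage_time A B w" and "P' \<equiv> passage_time A' B' w"
  shows "P (Suc i) j - P i j \<le> P' (Suc i) j - P' i j"
    and "P' i (Suc j) - P' i j \<le> P i (Suc j) - P i j"
proof -
  have P0: "P 0 j = B j" "P' 0 j = B' j" for j
    using 0 by (cases j; simp add: P_def P'_def)+
  have cell: "P (Suc i) (Suc j) = w (int (Suc i), int (Suc j)) + max (P i (Suc j)) (P (Suc i) j)"
    "P' (Suc i) (Suc j) = w (int (Suc i), int (Suc j)) + max (P' i (Suc j)) (P' (Suc i) j)" for i j
    by (simp_all add: P_def P'_def)
  have vert: "P' i (Suc j) - P' i j \<le> P i (Suc j) - P i j"
    if "\<And>i. P (Suc i) j - P i j \<le> P' (Suc i) j - P' i j" for i j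
  proof (induction i)
    case 0
    then show ?case using B by (simp add: P0)
  next
    case (Suc i)
    with that[of i] show ?case unfolding cell by linarith
  qed
  have hor: "P (Suc i) j - P i j \<le> P' (Suc i) j - P' i j" for i j
  proof (induction j arbitrary: i)
    case 0
    then show ?case using A by (simp add: P_def P'_def)
  next
    case (Suc j)
    from vert[of j i, OF Suc] Suc[of i] show ?case unfolding cell by linarith
  qed
  show "P (Suc i) j - P i j \<le> P' (Suc i) j - P' i j" by (rule hor)
  show "P' i (Suc j) - P' i j \<le> P i (Suc j) - P i j" by (rule vert[OF hor])
qed

lemma passage_time_gap_mono:
  fixes w :: "int \<times> int \<Rightarrow> real"
  assumes 0: "A 0 = B 0" "A' 0 = B' 0"
    and A: "\<And>i. A (Suc i) - A i \<le> A' (Suc i) - A' i"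
    and B: "\<And>j. B' (Suc j) - B' j \<le> B (Suc j) - B j"
    and "i \<le> i'" "j' \<le> j"
  shows "passage_time A' B' w i j - passage_time A B w i j
    \<le> passage_time A' B' w i' j' - passage_time A B w i' j'"
proof -
  note inc = passage_time_increments_mono[of A B A' B', OF 0 A B]
  let ?D = "\<lambda>i j. passage_time A' B' w i j - passage_time A B w i j"
  have "?D i j \<le> ?D i' j"
    using \<open>i \<le> i'\<close>
  proof (induction i' rule: dec_induct)
    case (step i')
    with inc(1)[where w=w and i=i' and j=j] show ?case by linarith
  qed simp
  also have "\<dots> \<le> ?D i' j'"
    using \<open>j' \<le> j\<close>
  proof (induction j rule: dec_induct)
    case (step j)
    with inc(2)[where w=w and i=i' and j=j] show ?case by linarith
  qed simp
  finally show ?thesis .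
qed

text \<open>
  The recursion commutes with maxima, so an inequality on the two half-lines that bound the
  quadrant above \<open>(m, n)\<close> extends to this quadrant.
\<close>

lemma passage_time_max_order_propagates:
  assumes "\<And>i. m \<le> i \<Longrightarrow> passage_time A B w i n < max (passage_time A' B' w i n) (passage_time A'' B'' w i n)"
    and "\<And>j. n \<le> j \<Longrightarrow> passage_time A B w m j < max (passage_time A' B' w m j) (passage_time A'' B'' w m j)"
    and "m \<le> i" "n \<le> j"
  shows "passage_time A B w i j < max (passage_time A' B' w i j) (passage_time A'' B'' w i j)"
  using assms(3,4)
proof (induction "i + j" arbitrary: i j rule: less_induct)
  case less
  show ?case
  proof (cases "i = m \<or> j = n")
    case True
    then show ?thesis using assms less.prems by auto
  next
    case False
    then obtain i' j' where ij: "i = Suc i'" "j = Suc j'" using less.prems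
      by (metis Suc_le_D le_neq_implies_less less_eq_Suc_le)
    from less.hyps[of i' j] less.hyps[of i j'] False less.prems ij show ?thesis by force
  qed
qed

lemma horizontal_exit_eq: "horizontal_exit w (int i, int j) (int k) = x_sum w k + x_tail w i j k"
proof -
  have "{1..int k} = int ` {1..k}" by (simp add: image_int_atLeastAtMost)
  then show ?thesis by (simp add: horizontal_exit_def x_sum_def sum.reindex)
qed

lemma vertical_exit_eq: "vertical_exit w (int i, int j) (int k) = y_sum w k + y_tail w i j k"
proof -
  have "{1..int k} = int ` {1..k}" by (simp add: image_int_atLeastAtMost)
  then show ?thesis by (simp add: vertical_exit_def y_sum_def sum.reindex)
qed

lemma stationary_last_passage_ge:
  assumes "1 \<le> i" "1 \<le> j"
  shows "k \<in> {1..i} \<Longrightarrow> x_sum w k + x_tail w i j k \<le> stationary_last_passage w (int i, int j)"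
    and "l \<in> {1..j} \<Longrightarrow> y_sum w l + y_tail w i j l \<le> stationary_last_passage w (int i, int j)"
proof -
  assume k: "k \<in> {1..i}"
  have "horizontal_exit w (int i, int j) (int k) \<le> (MAX k\<in>{1..int i}. horizontal_exit w (int i, int j) k)"
    using k by (intro Max_ge) auto
  then show "x_sum w k + x_tail w i j k \<le> stationary_last_passage w (int i, int j)"
    by (simp add: stationary_last_passage_def horizontal_exit_eq)
next
  assume l: "l \<in> {1..j}"
  have "vertical_exit w (int i, int j) (int l) \<le> (MAX k\<in>{1..int j}. vertical_exit w (int i, int j) k)"
    using l by (intro Max_ge) auto
  then show "y_sum w l + y_tail w i j l \<le> stationary_last_passage w (int i, int j)"
    by (simp add: stationary_last_passage_def vertical_exit_eq)
qed

text \<open>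
  Three passage times with modified boundary values are compared: \<open>V\<close> penalises all exits beyond \<open>R\<close>, \<open>H\<close>
  all but the far exits on the first axis, \<open>U\<close> all but those on the second.  With a penalty \<open>\<Lambda>\<close> large
  enough, the hypotheses say that \<open>V \<le> t < H, U\<close> at \<open>(m, n)\<close>.  The boundary increments are ordered, so
  \<open>V < H\<close> persists to the right and below, \<open>V < U\<close> to the left and above, and hence \<open>V < max H U\<close>
  at every endpoint outside the box.  An optimal near exit would give the reverse
  inequality, as it is not penalised in \<open>V\<close>, while \<open>H\<close> and \<open>U\<close> never exceed the true passage time.
\<close>

theorem exit_time_ge_outside_box:
  assumes mn: "1 \<le> m" "1 \<le> n"
    and x_near: "\<And>k. k \<in> {1..m} \<Longrightarrow> real k < R \<Longrightarrow> x_sum w k + x_tail w m n k \<le> t"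
    and y_near: "\<And>l. l \<in> {1..n} \<Longrightarrow> real l < R \<Longrightarrow> y_sum w l + y_tail w m n l \<le> t"
    and x_far: "\<exists>k\<in>{1..m}. R \<le> real k \<and> t < x_sum w k + x_tail w m n k"
    and y_far: "\<exists>l\<in>{1..n}. R \<le> real l \<and> t < y_sum w l + y_tail w m n l"
    and z: "z \<in> pos_quadrant" "int m \<le> fst z \<or> int n \<le> snd z"
  shows "R \<le> real_of_int \<bar>exit_time w z\<bar>"
proof (rule ccontr)
  assume "\<not> ?thesis"
  then have R: "real_of_int \<bar>exit_time w z\<bar> < R" by simp
  then have "0 < R" by linarith
  define i j where "i = nat (fst z)" and "j = nat (snd z)"
  have zij: "z = (int i, int j)" and ij: "1 \<le> i" "1 \<le> j"
    using z(1) by (auto simp: i_def j_def pos_quadrant_def)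
  define \<Lambda> where "\<Lambda> = max 0 (boundary_passage w m n - t)"
  \<comment> \<open>Penalties that grow linearly along an axis keep the increments ordered there for all indices.\<close>
  define AV where "AV k = x_sum w k - (if R \<le> real k then \<Lambda> else 0)" for k
  define BV where "BV k = y_sum w k - (if R \<le> real k then \<Lambda> else 0)" for k
  define AH where "AH k = x_sum w k - (if real k < R then \<Lambda> else 0)" for k
  define BH where "BH k = y_sum w k - \<Lambda> * (real k + 1)" for k
  define AU where "AU k = x_sum w k - \<Lambda> * (real k + 1)" for k
  define BU where "BU k = y_sum w k - (if real k < R then \<Lambda> else 0)" for k
  note defs = AV_def BV_def AH_def BH_def AU_def BU_def
  let ?V = "passage_time AV BV w" and ?H = "passage_time AH BH w" and ?U = "passage_time AU BU w"
  have \<Lambda>: "0 \<le> \<Lambda>" "boundary_passage w m n - \<Lambda> \<le> t" by (auto simp: \<Lambda>_def)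
  have zero: "AV 0 = BV 0" "AH 0 = BH 0" "AU 0 = BU 0" using \<open>0 < R\<close> by (auto simp: defs)
  have V: "?V m n \<le> t"
  proof -
    have ge: "x_sum w k + x_tail w m n k \<le> boundary_passage w m n" if "k \<in> {1..m}" for k
      using that mn passage_time_ge_exit(1)[of "x_sum w" "y_sum w" k n m] by (simp add: boundary_passage_def)
    have ge': "y_sum w k + y_tail w m n k \<le> boundary_passage w m n" if "k \<in> {1..n}" for k
      using that mn passage_time_ge_exit(2)[of "x_sum w" "y_sum w" k m n] by (simp add: boundary_passage_def)
    have "AV k + x_tail w m n k \<le> t" if "k \<in> {1..m}" for k
      using x_near[OF that] ge[OF that] \<Lambda> by (cases "real k < R") (auto simp: AV_def)
    moreover have "BV k + y_tail w m n k \<le> t" if "k \<in> {1..n}" for k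
      using y_near[OF that] ge'[OF that] \<Lambda> by (cases "real k < R") (auto simp: BV_def)
    ultimately show ?thesis
      using passage_time_le_exit[OF mn, of AV BV w] by fastforce
  qed
  have H: "t < ?H m n"
  proof -
    obtain k where k: "k \<in> {1..m}" "R \<le> real k" "t < x_sum w k + x_tail w m n k" using x_far by blast
    with passage_time_ge_exit(1)[of AH BH k n m w] mn zero show ?thesis by (auto simp: AH_def)
  qed
  have U: "t < ?U m n"
  proof -
    obtain k where k: "k \<in> {1..n}" "R \<le> real k" "t < y_sum w k + y_tail w m n k" using y_far by blast
    with passage_time_ge_exit(2)[of AU BU k m n w] mn zero show ?thesis by (auto simp: BU_def)
  qed
  have VH: "?V i j < ?H i j" if "m \<le> i" "j \<le> n" for i j
  proof -
    have "?H m n - ?V m n \<le> ?H i j - ?V i j"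
      by (rule passage_time_gap_mono[where A=AV and B=BV and A'=AH and B'=BH])
        (use \<Lambda> zero that in \<open>auto simp: defs algebra_simps\<close>)
    then show ?thesis using V H by linarith
  qed
  have VU: "?V i j < ?U i j" if "i \<le> m" "n \<le> j" for i j
  proof -
    have "?V i j - ?U i j \<le> ?V m n - ?U m n"
      by (rule passage_time_gap_mono[where A=AU and B=BU and A'=AV and B'=BV])
        (use \<Lambda> zero that in \<open>auto simp: defs algebra_simps\<close>)
    then show ?thesis using V U by linarith
  qed
  have less: "?V i j < max (?H i j) (?U i j)"
  proof -
    consider "m \<le> i" "j \<le> n" | "i \<le> m" "n \<le> j" | "m \<le> i" "n \<le> j"
    proof -
      have "m \<le> i \<or> n \<le> j" using z(2) by (auto simp: zij)
      then show ?thesis using that by linarith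
    qed
    then show ?thesis
    proof cases
      case 1
      show ?thesis using VH[OF 1] by (rule less_le_trans) simp
    next
      case 2
      show ?thesis using VU[OF 2] by (rule less_le_trans) simp
    next
      case 3
      have 1: "?V i' n < max (?H i' n) (?U i' n)" if "m \<le> i'" for i'
        using VH[OF that order_refl] by (rule less_le_trans) simp
      have 2: "?V m j' < max (?H m j') (?U m j')" if "n \<le> j'" for j'
        using VU[OF order_refl that] by (rule less_le_trans) simp
      from passage_time_max_order_propagates[OF 1 2 3] show ?thesis .
    qed
  qed
  let ?S = "stationary_last_passage w (int i, int j)"
  have "boundary_passage w i j \<le> ?S"
    using passage_time_le_exit[OF ij, of "x_sum w" "y_sum w" w] stationary_last_passage_ge[OF ij, of _ w]
    unfolding boundary_passage_def by (blast intro: order_trans)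
  moreover have "?H i j \<le> boundary_passage w i j" "?U i j \<le> boundary_passage w i j"
    unfolding boundary_passage_def using \<Lambda> by (auto intro!: passage_time_mono simp: defs)
  ultimately have le_S: "?H i j \<le> ?S" "?U i j \<le> ?S" by linarith+
  have "?S \<le> ?V i j"
    using is_exit_time_exit_time[OF z(1), of w] unfolding is_exit_time_def
  proof (elim disjE conjE)
    assume k: "exit_time w z \<in> {1..fst z}" "horizontal_exit w z (exit_time w z) = stationary_last_passage w z"
    define k where "k = nat (exit_time w z)"
    have k': "exit_time w z = int k" "k \<in> {1..i}" "real k < R" using k(1) R by (auto simp: k_def zij)
    have "?S = AV k + x_tail w i j k"
      using k(2) k' by (simp add: zij horizontal_exit_eq AV_def)
    then show ?thesis using passage_time_ge_exit(1)[of AV BV k j i w] zero k' ij by simp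
  next
    assume k: "- exit_time w z \<in> {1..snd z}" "vertical_exit w z (- exit_time w z) = stationary_last_passage w z"
    define k where "k = nat (- exit_time w z)"
    have k': "- exit_time w z = int k" "k \<in> {1..j}" "real k < R" using k(1) R by (auto simp: k_def zij)
    have "?S = BV k + y_tail w i j k"
      using k(2) k' by (simp add: zij vertical_exit_eq BV_def)
    then show ?thesis using passage_time_ge_exit(2)[of AV BV k i j w] zero k' ij by simp
  qed
  moreover have "max (?H i j) (?U i j) \<le> ?S" using le_S by simp
  ultimately show False using less by linarith
qed

section \<open>Measurability of the exit time\<close>

lemma last_passage_measurable:
  assumes "\<And>z. x \<le> z \<Longrightarrow> z \<in> weight_sites"
  shows "(\<lambda>w. last_passage w x y) \<in> borel_measurable configurations"
proof -
  have "(\<lambda>w. sum_list (map w \<pi>)) \<in> borel_measurable configurations" if "set \<pi> \<subseteq> weight_sites" for \<pi>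
    using that
  proof (induction \<pi>)
    case (Cons a \<pi>)
    then show ?case by (simp add: measurable_weight)
  qed simp
  then have "(\<lambda>w. sum_list (map w \<pi>)) \<in> borel_measurable configurations" if "\<pi> \<in> up_right_paths x y" for \<pi>
    using up_right_paths_le[OF that] assms by blast
  then show ?thesis
    unfolding last_passage_def
    by (intro borel_measurable_Max) (auto simp: finite_up_right_paths)
qed

lemma exit_tail_measurable:
  assumes "0 \<le> k"
  shows "(\<lambda>w. last_passage w (k, 1) y) \<in> borel_measurable configurations"
    and "(\<lambda>w. last_passage w (1, k) y) \<in> borel_measurable configurations"
  using assms by (auto intro!: last_passage_measurable simp: weight_sites_iff less_eq_prod_def)

lemma exit_value_measurable:
  assumes "0 \<le> k"
  shows "(\<lambda>w. horizontal_exit w y k) \<in> borel_measurable configurations"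
    and "(\<lambda>w. vertical_exit w y k) \<in> borel_measurable configurations"
  unfolding horizontal_exit_def vertical_exit_def using assms
  by (auto intro!: borel_measurable_add borel_measurable_sum exit_tail_measurable measurable_weight
      simp: weight_sites_iff)

lemma stationary_last_passage_measurable:
  "(\<lambda>w. stationary_last_passage w y) \<in> borel_measurable configurations"
  unfolding stationary_last_passage_def
  by (intro borel_measurable_max borel_measurable_Max exit_value_measurable) auto

lemma is_exit_time_measurable:
  "Measurable.pred configurations (\<lambda>w. is_exit_time w y k)"
proof -
  have "Measurable.pred configurations (\<lambda>w. horizontal_exit w y k = stationary_last_passage w y)" if "0 \<le> k"
    using borel_measurable_eq[OF exit_value_measurable(1)[OF that] stationary_last_passage_measurable]
    by (rule pred_def[THEN iffD2])
  then have 1: "Measurable.pred configurations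
      (\<lambda>w. k \<in> {1..fst y} \<and> horizontal_exit w y k = stationary_last_passage w y)"
    by (intro pred_intros_conj1') auto
  have "Measurable.pred configurations (\<lambda>w. vertical_exit w y (- k) = stationary_last_passage w y)" if "0 \<le> - k"
    using borel_measurable_eq[OF exit_value_measurable(2)[OF that] stationary_last_passage_measurable]
    by (rule pred_def[THEN iffD2])
  then have 2: "Measurable.pred configurations
      (\<lambda>w. - k \<in> {1..snd y} \<and> vertical_exit w y (- k) = stationary_last_passage w y)"
    by (intro pred_intros_conj1') auto
  show ?thesis
    unfolding is_exit_time_def by (rule pred_intros_logic(5)[OF 1 2])
qed

text \<open>
  In case of ties the choice operator picks the exit, but its value depends on the finite set of maximisers
  only, and each of the finitely many possible sets of maximisers occurs on a measurable event.
\<close>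

lemma exit_time_ge_measurable:
  "Measurable.pred configurations (\<lambda>w. R \<le> real_of_int \<bar>exit_time w y\<bar>)"
proof -
  let ?K = "{1..fst y} \<union> {- snd y..- 1}"
  have K: "k \<in> ?K" if "is_exit_time w y k" for w k
    using that by (auto simp: is_exit_time_def)
  have "R \<le> real_of_int \<bar>exit_time w y\<bar> \<longleftrightarrow>
      (\<exists>T\<in>Pow ?K. (\<forall>k\<in>?K. is_exit_time w y k \<longleftrightarrow> k \<in> T) \<and> R \<le> real_of_int \<bar>SOME k. k \<in> T\<bar>)" for w
  proof -
    let ?T = "{k\<in>?K. is_exit_time w y k}"
    have "is_exit_time w y = (\<lambda>k. k \<in> ?T)" using K by auto
    then have e: "exit_time w y = (SOME k. k \<in> ?T)" unfolding exit_time_def by simp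
    show ?thesis
    proof
      assume "R \<le> real_of_int \<bar>exit_time w y\<bar>"
      then show "\<exists>T\<in>Pow ?K. (\<forall>k\<in>?K. is_exit_time w y k \<longleftrightarrow> k \<in> T) \<and> R \<le> real_of_int \<bar>SOME k. k \<in> T\<bar>"
        unfolding e by (intro bexI[of _ ?T]) auto
    next
      assume "\<exists>T\<in>Pow ?K. (\<forall>k\<in>?K. is_exit_time w y k \<longleftrightarrow> k \<in> T) \<and> R \<le> real_of_int \<bar>SOME k. k \<in> T\<bar>"
      then obtain T where T: "T \<subseteq> ?K" "\<forall>k\<in>?K. is_exit_time w y k \<longleftrightarrow> k \<in> T" "R \<le> real_of_int \<bar>SOME k. k \<in> T\<bar>"
        by blast
      then have "T = ?T" by blast
      with T(3) e show "R \<le> real_of_int \<bar>exit_time w y\<bar>" by simp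
    qed
  qed
  moreover have "Measurable.pred configurations (\<lambda>w. \<exists>T\<in>Pow ?K. (\<forall>k\<in>?K. is_exit_time w y k \<longleftrightarrow> k \<in> T)
      \<and> R \<le> real_of_int \<bar>SOME k. k \<in> T\<bar>)"
    by (intro pred_intros_finite pred_intros_logic is_exit_time_measurable) auto
  ultimately show ?thesis by simp
qed

lemma far_exit_event_sets:
  "{w \<in> space configurations. \<forall>z \<in> Z. R \<le> real_of_int \<bar>exit_time w z\<bar>} \<in> sets configurations"
proof -
  have "Measurable.pred configurations (\<lambda>w. \<forall>z \<in> Z. R \<le> real_of_int \<bar>exit_time w z\<bar>)"
    by (intro pred_intros_countable_bounded exit_time_ge_measurable)
  then show ?thesis by (rule predE)
qed

section \<open>Tail bounds for the passage time\<close>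

text \<open>
  The passage time when all weights on the axes are multiplied by \<open>a\<close> and \<open>b\<close>.  With
  \<open>a = (1 - \<rho>) / u\<close> and \<open>b = \<rho> / (1 - z)\<close> it has the law of the passage time for rates \<open>u\<close> and \<open>1 - z\<close>, but
  lives on the stationary environment, so that all parameters can be used at once.
\<close>

definition scaled_passage :: "real \<Rightarrow> real \<Rightarrow> (int \<times> int \<Rightarrow> real) \<Rightarrow> nat \<Rightarrow> nat \<Rightarrow> real" where
  "scaled_passage a b w = passage_time (\<lambda>k. a * x_sum w k) (\<lambda>l. b * y_sum w l) w"

lemma passage_time_cong:
  assumes "\<And>k. k \<le> i \<Longrightarrow> A k = A' k" "\<And>l. l \<le> j \<Longrightarrow> B l = B' l"
    and "\<And>k l. 0 < k \<Longrightarrow> 0 < l \<Longrightarrow> w (int k, int l) = w' (int k, int l)"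
  shows "passage_time A B w i j = passage_time A' B' w' i j"
  using assms
proof (induction A B w i j rule: passage_time.induct)
  case (3 A B w i j)
  then show ?case using "3.prems"(3)[of "Suc i" "Suc j"] by auto
qed auto

lemma scaled_passage_ge_exit:
  assumes "1 \<le> m" "1 \<le> n"
  shows "k \<in> {1..m} \<Longrightarrow> a * x_sum w k + x_tail w m n k \<le> scaled_passage a b w m n"
    and "l \<in> {1..n} \<Longrightarrow> b * y_sum w l + y_tail w m n l \<le> scaled_passage a b w m n"
  using assms passage_time_ge_exit[of "\<lambda>k. a * x_sum w k" "\<lambda>l. b * y_sum w l"]
  by (auto simp: scaled_passage_def)

lemma scaled_passage_measurable: "(\<lambda>w. scaled_passage a b w i j) \<in> borel_measurable configurations"
  unfolding scaled_passage_def
  by (intro passage_time_measurable borel_measurable_times x_sum_measurable y_sum_measurable) auto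

lemma weight_rate_x_sites: "p \<in> x_sites K \<Longrightarrow> weight_rate \<rho> p = 1 - \<rho>"
  by (auto simp: x_sites_def weight_rate_def)

lemma weight_rate_y_sites: "0 \<notin> K \<Longrightarrow> p \<in> y_sites K \<Longrightarrow> weight_rate \<rho> p = \<rho>"
  by (auto simp: y_sites_def weight_rate_def)

lemma stationary_eq_weights_law: "stationary_measure \<rho> = weights_law (weight_rate \<rho>)"
  by (simp add: stationary_measure_def weights_law_def)

lemma scaled_passage_mgf:
  assumes \<rho>: "0 < \<rho>" "\<rho> < 1" and uz: "0 < u" "u < 1" "0 < z" "z < 1"
  shows "(\<integral>\<^sup>+ w. ennreal (exp ((u - z) * scaled_passage ((1 - \<rho>) / u) (\<rho> / (1 - z)) w m n)) \<partial>stationary_measure \<rho>)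
    = ennreal ((u / z) ^ m * ((1 - z) / (1 - u)) ^ n)"
proof -
  let ?X = "x_sites {1..m}" and ?Y = "y_sites {1..n}"
  let ?\<alpha> = "weight_rate \<rho>"
  let ?\<beta> = "\<lambda>p. if p \<in> ?X then u else if p \<in> ?Y then 1 - z else ?\<alpha> p"
  have pos: "0 < ?\<alpha> p" "0 < ?\<beta> p" for p using weight_rate_pos[OF \<rho>] uz by auto
  have br: "box_rates m n u (1 - z) ?\<beta>"
    using pos(2) unfolding box_rates_def by (auto simp: x_sites_def y_sites_def weight_rate_def)
  have F: "finite (?X \<union> ?Y)" "?X \<union> ?Y \<subseteq> weight_sites"
    by (simp_all add: x_sites_simps y_sites_simps)
  let ?r = "rescale (\<lambda>p. ?\<alpha> p / ?\<beta> p) (?X \<union> ?Y)"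
  have bp: "boundary_passage (?r w) m n = scaled_passage ((1 - \<rho>) / u) (\<rho> / (1 - z)) w m n" for w
    unfolding boundary_passage_def scaled_passage_def
  proof (rule passage_time_cong)
    fix k assume "k \<le> m"
    then show "x_sum (?r w) k = (1 - \<rho>) / u * x_sum w k"
      unfolding x_sum_def sum_distrib_left
      by (intro sum.cong) (auto simp: rescale_def x_sites_def weight_rate_def)
  next
    fix l assume "l \<le> n"
    then show "y_sum (?r w) l = \<rho> / (1 - z) * y_sum w l"
      unfolding y_sum_def sum_distrib_left
      by (intro sum.cong) (auto simp: rescale_def x_sites_def y_sites_def weight_rate_def)
  qed (auto simp: rescale_def x_sites_def y_sites_def)
  have "(\<integral>\<^sup>+ w. ennreal (exp ((u - z) * boundary_passage w m n)) \<partial>weights_law ?\<beta>)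
      = (\<integral>\<^sup>+ w. ennreal (exp ((u - z) * boundary_passage (?r w) m n)) \<partial>weights_law ?\<alpha>)"
    using boundary_passage_measurable
    by (intro nn_integral_weights_law_rescale[OF F pos]) auto
  then show ?thesis
    unfolding bp stationary_eq_weights_law boundary_passage_mgf[OF br uz] by simp
qed

lemma space_stationary_measure: "space (stationary_measure \<rho>) = space configurations"
  by (simp add: stationary_eq_weights_law)

lemma sets_stationary_measure [measurable_cong]: "sets (stationary_measure \<rho>) = sets configurations"
  by (simp add: stationary_eq_weights_law)

lemma (in prob_space) exp_markov:
  assumes [measurable]: "X \<in> borel_measurable M"
    and mgf: "(\<integral>\<^sup>+ w. ennreal (exp (X w)) \<partial>M) \<le> ennreal c" and "0 \<le> c"
  shows "measure M {w \<in> space M. s \<le> X w} \<le> exp (- s) * c"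
proof -
  have "emeasure M {w \<in> space M. s \<le> X w} = (\<integral>\<^sup>+ w. indicator {w \<in> space M. s \<le> X w} w \<partial>M)"
    by simp
  also have "\<dots> \<le> (\<integral>\<^sup>+ w. ennreal (exp (- s)) * ennreal (exp (X w)) \<partial>M)"
  proof (intro nn_integral_mono)
    fix w assume "w \<in> space M"
    show "indicator {w \<in> space M. s \<le> X w} w \<le> ennreal (exp (- s)) * ennreal (exp (X w))"
      by (auto simp: indicator_def ennreal_mult[symmetric] exp_add[symmetric] ennreal_ge_1)
  qed
  also have "\<dots> = ennreal (exp (- s)) * (\<integral>\<^sup>+ w. ennreal (exp (X w)) \<partial>M)"
    by (intro nn_integral_cmult) measurable
  also have "\<dots> \<le> ennreal (exp (- s)) * ennreal c"
    using mgf by (intro mult_left_mono) auto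
  also have "\<dots> = ennreal (exp (- s) * c)" by (simp add: ennreal_mult')
  finally show ?thesis
    using assms by (simp add: emeasure_eq_measure)
qed

lemma scaled_passage_markov:
  assumes \<rho>: "0 < \<rho>" "\<rho> < 1" and uz: "0 < u" "u < 1" "0 < z" "z < 1"
  shows "measure (stationary_measure \<rho>) {w \<in> space configurations.
      (u - z) * s \<le> (u - z) * scaled_passage ((1 - \<rho>) / u) (\<rho> / (1 - z)) w m n}
    \<le> exp (- ((u - z) * s)) * ((u / z) ^ m * ((1 - z) / (1 - u)) ^ n)"
proof -
  interpret prob_space "stationary_measure \<rho>" by (rule prob_space_stationary_measure[OF \<rho>])
  show ?thesis
    unfolding space_stationary_measure[symmetric, of \<rho>]
    using scaled_passage_mgf[OF assms, of m n] scaled_passage_measurable uz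
    by (intro exp_markov) (auto simp: sets_stationary_measure cong: measurable_cong_sets)
qed

text \<open>
  The logarithm of the exponential moment at \<open>(m, n) = N (\<omega>\<^sup>2, (1 - \<omega>)\<^sup>2)\<close>, centred by \<open>N (u - z)\<close>, is \<open>N\<close>
  times \<open>D u - D z\<close>.  Its derivative \<open>(v - \<omega>)\<^sup>2 / (v (1 - v))\<close> vanishes to second order at \<open>\<omega>\<close>, the
  characteristic parameter, and both bounds compare it with a multiple of \<open>(v - \<omega>)\<^sup>2\<close> or \<open>h\<^sup>2\<close>.
\<close>

lemma drift_bounds:
  fixes \<omega> :: real
  assumes \<omega>: "0 < \<omega>" "\<omega> < 1"
  defines "D \<equiv> \<lambda>v. \<omega>\<^sup>2 * ln v - (1 - \<omega>)\<^sup>2 * ln (1 - v) - v"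
  shows drift_lower: "0 < u \<Longrightarrow> u \<le> z \<Longrightarrow> z < 1 \<Longrightarrow>
      4 / 3 * ((z - \<omega>) ^ 3 - (u - \<omega>) ^ 3) \<le> D z - D u"
    and drift_upper: "\<omega> - h \<le> z \<Longrightarrow> z \<le> u \<Longrightarrow> u \<le> \<omega> + h \<Longrightarrow> 0 \<le> h \<Longrightarrow> h \<le> \<omega> / 2 \<Longrightarrow> h \<le> (1 - \<omega>) / 2 \<Longrightarrow>
      D u - D z \<le> (u - z) * h\<^sup>2 * (4 / (\<omega> * (1 - \<omega>)))"
proof -
  have deriv: "(D has_real_derivative (v - \<omega>)\<^sup>2 / (v * (1 - v))) (at v)" if "0 < v" "v < 1" for v
  proof -
    have "(D has_real_derivative \<omega>\<^sup>2 * (1 / v) - (1 - \<omega>)\<^sup>2 * (1 / (1 - v) * (0 - 1)) - 1) (at v)"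
      unfolding D_def using that by (auto intro!: derivative_eq_intros simp: divide_inverse)
    moreover have "\<omega>\<^sup>2 * (1 / v) - (1 - \<omega>)\<^sup>2 * (1 / (1 - v) * (0 - 1)) - 1 = (v - \<omega>)\<^sup>2 / (v * (1 - v))"
      using that by (simp add: field_simps power2_eq_square)
    ultimately show ?thesis by simp
  qed
  {
    assume u: "0 < u" "u \<le> z" "z < 1"
    let ?E = "\<lambda>v. D v - 4 / 3 * (v - \<omega>) ^ 3"
    have "?E u \<le> ?E z"
    proof (rule DERIV_nonneg_imp_nondecreasing[OF u(2)])
      fix v assume v: "u \<le> v" "v \<le> z"
      with u have v01: "0 < v" "v < 1" by auto
      have "(?E has_real_derivative (v - \<omega>)\<^sup>2 / (v * (1 - v)) - 4 * (v - \<omega>)\<^sup>2) (at v)"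
        using deriv[OF v01] by (auto intro!: derivative_eq_intros simp: power2_eq_square)
      moreover have "4 * (v - \<omega>)\<^sup>2 \<le> (v - \<omega>)\<^sup>2 / (v * (1 - v))"
      proof -
        have "4 * (v * (1 - v)) \<le> 1" using zero_le_power2[of "2 * v - 1"] by (simp add: power2_eq_square algebra_simps)
        then have "4 * (v * (1 - v)) * (v - \<omega>)\<^sup>2 \<le> 1 * (v - \<omega>)\<^sup>2" by (intro mult_right_mono) auto
        moreover have "4 * (v * (1 - v)) * (v - \<omega>)\<^sup>2 = 4 * (v - \<omega>)\<^sup>2 * (v * (1 - v))"
          by (simp only: ac_simps)
        ultimately show ?thesis using v01 by (simp add: pos_le_divide_eq)
      qed
      ultimately show "\<exists>y. (?E has_real_derivative y) (at v) \<and> 0 \<le> y" by (intro exI conjI) auto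
    qed
    then show "4 / 3 * ((z - \<omega>) ^ 3 - (u - \<omega>) ^ 3) \<le> D z - D u" by (simp add: algebra_simps)
  }
  {
    assume u: "\<omega> - h \<le> z" "z \<le> u" "u \<le> \<omega> + h" "0 \<le> h" "h \<le> \<omega> / 2" "h \<le> (1 - \<omega>) / 2"
    let ?c = "h\<^sup>2 * (4 / (\<omega> * (1 - \<omega>)))"
    let ?E = "\<lambda>v. ?c * v - D v"
    have "?E z \<le> ?E u"
    proof (rule DERIV_nonneg_imp_nondecreasing[OF u(2)])
      fix v assume v: "z \<le> v" "v \<le> u"
      with u \<omega> have v01: "0 < v" "v < 1" and v2: "\<omega> / 2 \<le> v" "(1 - \<omega>) / 2 \<le> 1 - v" by auto
      have "(?E has_real_derivative ?c - (v - \<omega>)\<^sup>2 / (v * (1 - v))) (at v)"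
        by (rule DERIV_diff[OF DERIV_cmult_Id deriv[OF v01]])
      moreover have "(v - \<omega>)\<^sup>2 / (v * (1 - v)) \<le> ?c"
      proof -
        have "(v - \<omega>)\<^sup>2 \<le> h\<^sup>2" using v u by (intro abs_le_square_iff[THEN iffD1]) auto
        moreover have "\<omega> / 2 * ((1 - \<omega>) / 2) \<le> v * (1 - v)" using v2 \<omega> v01 by (intro mult_mono) auto
        ultimately have "(v - \<omega>)\<^sup>2 / (v * (1 - v)) \<le> h\<^sup>2 / (\<omega> / 2 * ((1 - \<omega>) / 2))"
          using \<omega> by (intro frac_le) auto
        then show ?thesis by simp
      qed
      ultimately show "\<exists>y. (?E has_real_derivative y) (at v) \<and> 0 \<le> y" by (intro exI conjI) auto
    qed
    then show "D u - D z \<le> (u - z) * h\<^sup>2 * (4 / (\<omega> * (1 - \<omega>)))" by (simp add: algebra_simps)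
  }
qed

lemma power_eq_exp_ln: "0 < x \<Longrightarrow> x ^ k = exp (real k * ln x)" for x :: real
  by (simp add: exp_of_nat_mult)

text \<open>
  The factor \<open>3\<close> pays for rounding: \<open>m\<close> and \<open>n\<close> exceed \<open>N (1 - \<rho>)\<^sup>2\<close> and \<open>N \<rho>\<^sup>2\<close> by at most one, and the
  ratios \<open>u / z\<close> and \<open>(1 - z) / (1 - u)\<close> are at most \<open>5/3\<close>.
\<close>

lemma scaled_passage_upper_tail:
  assumes \<rho>: "0 < \<rho>" "\<rho> < 1" and N: "0 \<le> N"
    and m: "real m \<le> N * (1 - \<rho>)\<^sup>2 + 1" and n: "real n \<le> N * \<rho>\<^sup>2 + 1"
    and uz: "1 - \<rho> - h \<le> z" "z < u" "u \<le> 1 - \<rho> + h" and h: "0 \<le> h" "h \<le> (1 - \<rho>) / 4" "h \<le> \<rho> / 4"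
  shows "measure (stationary_measure \<rho>) {w \<in> space configurations.
      s \<le> scaled_passage ((1 - \<rho>) / u) (\<rho> / (1 - z)) w m n}
    \<le> 3 * exp (N * ((u - z) * h\<^sup>2 * (4 / ((1 - \<rho>) * \<rho>))) - (u - z) * (s - N))"
proof -
  have u01: "0 < z" "u < 1" "0 < u" "z < 1" using uz h \<rho> by auto
  have "s \<le> x \<longleftrightarrow> (u - z) * s \<le> (u - z) * x" for x using uz by simp
  then have "measure (stationary_measure \<rho>) {w \<in> space configurations.
        s \<le> scaled_passage ((1 - \<rho>) / u) (\<rho> / (1 - z)) w m n}
      \<le> exp (- ((u - z) * s)) * ((u / z) ^ m * ((1 - z) / (1 - u)) ^ n)"
    using scaled_passage_markov[OF \<rho> u01(3,2,1,4), of s m n] by simp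
  also have "\<dots> \<le> 3 * exp (N * ((u - z) * h\<^sup>2 * (4 / ((1 - \<rho>) * \<rho>))) - (u - z) * (s - N))"
  proof -
    have l: "0 \<le> ln (u / z)" "0 \<le> ln ((1 - z) / (1 - u))" using u01 uz by auto
    have q: "u / z \<le> 5 / 3" "(1 - z) / (1 - u) \<le> 5 / 3"
      using u01 uz h by (auto simp: divide_simps)
    have "(u / z) ^ m * ((1 - z) / (1 - u)) ^ n
        = exp (real m * ln (u / z) + real n * ln ((1 - z) / (1 - u)))"
      using u01 by (simp add: power_eq_exp_ln exp_add)
    also have "\<dots> \<le> exp ((N * (1 - \<rho>)\<^sup>2 + 1) * ln (u / z) + (N * \<rho>\<^sup>2 + 1) * ln ((1 - z) / (1 - u)))"
      using l m n by (simp add: add_mono mult_right_mono)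
    also have "\<dots> = exp (ln (u / z)) * exp (ln ((1 - z) / (1 - u))) *
        exp (N * ((1 - \<rho>)\<^sup>2 * ln (u / z) + \<rho>\<^sup>2 * ln ((1 - z) / (1 - u))))"
      unfolding exp_add[symmetric] by (rule arg_cong[where f=exp]) (simp add: algebra_simps)
    also have "\<dots> = (u / z) * ((1 - z) / (1 - u)) *
        exp (N * ((1 - \<rho>)\<^sup>2 * ln (u / z) + \<rho>\<^sup>2 * ln ((1 - z) / (1 - u))))"
      using u01 by simp
    also have "\<dots> \<le> 3 * exp (N * ((u - z) + (u - z) * h\<^sup>2 * (4 / ((1 - \<rho>) * \<rho>))))"
    proof (intro mult_mono)
      have "(u / z) * ((1 - z) / (1 - u)) \<le> 5 / 3 * (5 / 3)"
        using q u01 by (intro mult_mono) auto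
      also have "\<dots> \<le> 3" by simp
      finally show "(u / z) * ((1 - z) / (1 - u)) \<le> 3" .
      have "(1 - \<rho>)\<^sup>2 * ln (u / z) + \<rho>\<^sup>2 * ln ((1 - z) / (1 - u)) \<le> (u - z) + (u - z) * h\<^sup>2 * (4 / ((1 - \<rho>) * \<rho>))"
        using drift_upper[of "1 - \<rho>" h z u] \<rho> h uz u01 by (simp add: ln_div algebra_simps)
      then show "exp (N * ((1 - \<rho>)\<^sup>2 * ln (u / z) + \<rho>\<^sup>2 * ln ((1 - z) / (1 - u))))
          \<le> exp (N * ((u - z) + (u - z) * h\<^sup>2 * (4 / ((1 - \<rho>) * \<rho>))))"
        using N by (simp add: mult_left_mono)
    qed auto
    finally have "exp (- ((u - z) * s)) * ((u / z) ^ m * ((1 - z) / (1 - u)) ^ n)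
        \<le> exp (- ((u - z) * s)) * (3 * exp (N * ((u - z) + (u - z) * h\<^sup>2 * (4 / ((1 - \<rho>) * \<rho>)))))"
      by (intro mult_left_mono) auto
    also have "\<dots> = 3 * exp (N * ((u - z) * h\<^sup>2 * (4 / ((1 - \<rho>) * \<rho>))) - (u - z) * (s - N))"
      unfolding mult.left_commute[of _ 3] exp_add[symmetric]
      by (simp add: algebra_simps)
    finally show ?thesis .
  qed
  finally show ?thesis .
qed

lemma scaled_passage_lower_tail:
  assumes \<rho>: "0 < \<rho>" "\<rho> < 1" and N: "0 \<le> N"
    and m: "N * (1 - \<rho>)\<^sup>2 \<le> real m" and n: "N * \<rho>\<^sup>2 \<le> real n"
    and uz: "0 < u" "u < z" "z < 1"
  shows "measure (stationary_measure \<rho>) {w \<in> space configurations.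
      scaled_passage ((1 - \<rho>) / u) (\<rho> / (1 - z)) w m n \<le> s}
    \<le> exp ((z - u) * (s - N) - N * (4 / 3 * ((z - (1 - \<rho>)) ^ 3 - (u - (1 - \<rho>)) ^ 3)))"
proof -
  have u01: "0 < z" "u < 1" "0 < u" "z < 1" using uz by auto
  have "x \<le> s \<longleftrightarrow> (u - z) * s \<le> (u - z) * x" for x using uz by (simp add: mult_le_cancel_left)
  then have "measure (stationary_measure \<rho>) {w \<in> space configurations.
        scaled_passage ((1 - \<rho>) / u) (\<rho> / (1 - z)) w m n \<le> s}
      \<le> exp (- ((u - z) * s)) * ((u / z) ^ m * ((1 - z) / (1 - u)) ^ n)"
    using scaled_passage_markov[OF \<rho> u01(3,2,1,4), of s m n] by simp
  also have "\<dots> \<le> exp ((z - u) * (s - N) - N * (4 / 3 * ((z - (1 - \<rho>)) ^ 3 - (u - (1 - \<rho>)) ^ 3)))"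
  proof -
    have l: "ln (u / z) \<le> 0" "ln ((1 - z) / (1 - u)) \<le> 0" using u01 uz by auto
    have "(u / z) ^ m * ((1 - z) / (1 - u)) ^ n
        = exp (real m * ln (u / z) + real n * ln ((1 - z) / (1 - u)))"
      using u01 by (simp add: power_eq_exp_ln exp_add)
    also have "\<dots> \<le> exp ((N * (1 - \<rho>)\<^sup>2) * ln (u / z) + (N * \<rho>\<^sup>2) * ln ((1 - z) / (1 - u)))"
      using l m n by (simp add: add_mono mult_right_mono_neg)
    also have "\<dots> = exp (N * ((1 - \<rho>)\<^sup>2 * ln (u / z) + \<rho>\<^sup>2 * ln ((1 - z) / (1 - u))))"
      by (simp add: algebra_simps)
    also have "\<dots> \<le> exp (N * (- (z - u) - 4 / 3 * ((z - (1 - \<rho>)) ^ 3 - (u - (1 - \<rho>)) ^ 3)))"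
    proof -
      have "(1 - \<rho>)\<^sup>2 * ln (u / z) + \<rho>\<^sup>2 * ln ((1 - z) / (1 - u))
          \<le> - (z - u) - 4 / 3 * ((z - (1 - \<rho>)) ^ 3 - (u - (1 - \<rho>)) ^ 3)"
        using drift_lower[of "1 - \<rho>" u z] \<rho> uz u01 by (simp add: ln_div algebra_simps)
      then show ?thesis using N by (simp only: exp_le_cancel_iff) (rule mult_left_mono)
    qed
    finally have "exp (- ((u - z) * s)) * ((u / z) ^ m * ((1 - z) / (1 - u)) ^ n)
        \<le> exp (- ((u - z) * s)) * exp (N * (- (z - u) - 4 / 3 * ((z - (1 - \<rho>)) ^ 3 - (u - (1 - \<rho>)) ^ 3)))"
      by (intro mult_left_mono) auto
    also have "\<dots> = exp ((z - u) * (s - N) - N * (4 / 3 * ((z - (1 - \<rho>)) ^ 3 - (u - (1 - \<rho>)) ^ 3)))"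
      unfolding exp_add[symmetric] by (rule arg_cong[where f=exp]) algebra
    finally show ?thesis .
  qed
  finally show ?thesis .
qed

section \<open>The cost of tilting boundary weights\<close>

text \<open>
  If \<open>f\<close> is the likelihood ratio and \<open>V\<close> bounds its second moment, then \<open>f 1\<^sub>A \<le> 4 V 1\<^sub>A + f\<^sup>2 / (4 V)\<close>
  bounds the tilted probability of \<open>A\<close> by \<open>4 V P(A) + 1/4\<close>.  The square of \<open>f\<close> is again proportional to a
  likelihood ratio, with rates lowered by \<open>2 \<delta>\<close>, which gives \<open>V\<close> with a factor \<open>1 + O(\<delta>\<^sup>2)\<close> for
  each tilted site.
\<close>

lemma tilt_cost:
  assumes F: "finite F" "F \<subseteq> weight_sites" and pos: "\<And>z. 0 < \<alpha> z"
    and \<eta>: "\<And>p. p \<in> F \<Longrightarrow> \<eta> \<le> \<alpha> p" "0 < \<eta>" and \<delta>: "0 \<le> \<delta>" "4 * \<delta> \<le> \<eta>"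
    and A: "A \<in> sets configurations"
    and half: "1 / 2 \<le> measure (weights_law \<alpha>)
      {w \<in> space configurations. rescale (\<lambda>p. \<alpha> p / (\<alpha> p - \<delta>)) F w \<in> A}"
  shows "exp (- (2 * \<delta>\<^sup>2 / \<eta>\<^sup>2 * real (card F))) / 16 \<le> measure (weights_law \<alpha>) A"
proof -
  interpret prob_space "weights_law \<alpha>" by (rule prob_space_weights_law[OF pos])
  let ?\<beta> = "\<lambda>p. if p \<in> F then \<alpha> p - \<delta> else \<alpha> p"
  let ?\<gamma> = "\<lambda>p. if p \<in> F then \<alpha> p - 2 * \<delta> else \<alpha> p"
  have big: "\<eta> / 2 \<le> \<alpha> p - 2 * \<delta>" "\<eta> \<le> \<alpha> p" if "p \<in> F" for p using \<eta>(1)[OF that] \<delta> by auto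
  have \<beta>pos: "0 < ?\<beta> p" and \<gamma>pos: "0 < ?\<gamma> p" for p
    using big[of p] \<eta>(2) \<delta> pos[of p] by (auto split: if_splits)
  interpret G: prob_space "weights_law ?\<gamma>" by (rule prob_space_weights_law[OF \<gamma>pos])
  define f where "f w = (\<Prod>p\<in>F. ?\<beta> p / \<alpha> p * exp ((\<alpha> p - ?\<beta> p) * w p))" for w :: "int \<times> int \<Rightarrow> real"
  have \<beta>0: "0 \<le> ?\<beta> p / \<alpha> p" and \<gamma>0: "0 \<le> ?\<gamma> p / \<alpha> p" for p
    by (rule divide_nonneg_nonneg[OF less_imp_le[OF \<beta>pos] less_imp_le[OF pos]],
        rule divide_nonneg_nonneg[OF less_imp_le[OF \<gamma>pos] less_imp_le[OF pos]])
  have f0: "0 \<le> f w" for w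
    unfolding f_def by (rule prod_nonneg) (rule mult_nonneg_nonneg[OF \<beta>0 exp_ge_zero])
  have [measurable]: "(\<lambda>w. w p) \<in> borel_measurable configurations" if "p \<in> F" for p
    using F that by (intro measurable_weight) auto
  have fm [measurable]: "f \<in> borel_measurable configurations"
    unfolding f_def by (intro borel_measurable_prod) measurable
  have f_eq: "ennreal (f w) = (\<Prod>p\<in>F. ennreal (?\<beta> p / \<alpha> p * exp ((\<alpha> p - ?\<beta> p) * w p)))" for w
    unfolding f_def by (rule prod_ennreal[symmetric]) (rule mult_nonneg_nonneg[OF \<beta>0 exp_ge_zero])
  define V where "V = exp (2 * \<delta>\<^sup>2 / \<eta>\<^sup>2 * real (card F))"
  have V: "0 < V" by (simp add: V_def)
  have second: "(\<integral>\<^sup>+ w. ennreal ((f w)\<^sup>2) \<partial>weights_law \<alpha>) \<le> ennreal V"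
  proof -
    let ?g = "\<lambda>p w. ?\<gamma> p / \<alpha> p * exp ((\<alpha> p - ?\<gamma> p) * w p)"
    have g0: "0 \<le> ?g p w" for p and w :: "int \<times> int \<Rightarrow> real"
      by (rule mult_nonneg_nonneg[OF \<gamma>0 exp_ge_zero])
    have sq: "(f w)\<^sup>2 \<le> V * (\<Prod>p\<in>F. ?g p w)" for w
    proof -
      have factor_le: "(?\<beta> p / \<alpha> p * exp ((\<alpha> p - ?\<beta> p) * w p))\<^sup>2 \<le> exp (2 * \<delta>\<^sup>2 / \<eta>\<^sup>2) * ?g p w" if "p \<in> F" for p
      proof -
        have c: "(?\<beta> p / \<alpha> p)\<^sup>2 = (1 + \<delta>\<^sup>2 / (\<alpha> p * ?\<gamma> p)) * (?\<gamma> p / \<alpha> p)"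
          using that pos[of p] \<gamma>pos[of p] by (simp add: field_simps power2_eq_square)
        have "\<eta> * (\<eta> / 2) \<le> \<alpha> p * ?\<gamma> p"
          using big[OF that] \<eta>(2) that pos[of p] by (intro mult_mono) auto
        then have "\<delta>\<^sup>2 / (\<alpha> p * ?\<gamma> p) \<le> \<delta>\<^sup>2 / (\<eta> * (\<eta> / 2))"
          using \<eta>(2) mult_pos_pos[OF mult_pos_pos[OF pos[of p] \<gamma>pos[of p]], of "\<eta> * (\<eta> / 2)"]
          by (intro divide_left_mono) simp_all
        also have "\<dots> = 2 * \<delta>\<^sup>2 / \<eta>\<^sup>2" by (simp add: power2_eq_square)
        finally have "1 + \<delta>\<^sup>2 / (\<alpha> p * ?\<gamma> p) \<le> exp (2 * \<delta>\<^sup>2 / \<eta>\<^sup>2)"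
          using exp_ge_add_one_self[of "2 * \<delta>\<^sup>2 / \<eta>\<^sup>2"] by linarith
        then have "(?\<beta> p / \<alpha> p)\<^sup>2 \<le> exp (2 * \<delta>\<^sup>2 / \<eta>\<^sup>2) * (?\<gamma> p / \<alpha> p)"
          unfolding c by (rule mult_right_mono[OF _ \<gamma>0])
        then have "(?\<beta> p / \<alpha> p)\<^sup>2 * exp ((\<alpha> p - ?\<gamma> p) * w p)
            \<le> exp (2 * \<delta>\<^sup>2 / \<eta>\<^sup>2) * (?\<gamma> p / \<alpha> p) * exp ((\<alpha> p - ?\<gamma> p) * w p)"
          by (intro mult_right_mono) auto
        moreover have "(exp ((\<alpha> p - ?\<beta> p) * w p))\<^sup>2 = exp ((\<alpha> p - ?\<gamma> p) * w p)"
          using that by (simp add: exp_double[symmetric] mult.assoc)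
        ultimately show ?thesis by (simp only: power_mult_distrib mult.assoc)
      qed
      have "(f w)\<^sup>2 = (\<Prod>p\<in>F. (?\<beta> p / \<alpha> p * exp ((\<alpha> p - ?\<beta> p) * w p))\<^sup>2)"
        by (simp add: f_def prod_power_distrib)
      also have "\<dots> \<le> (\<Prod>p\<in>F. exp (2 * \<delta>\<^sup>2 / \<eta>\<^sup>2) * ?g p w)"
        by (rule prod_mono) (blast intro: factor_le zero_le_power2)
      also have "\<dots> = V * (\<Prod>p\<in>F. ?g p w)"
        by (simp only: prod.distrib prod_constant V_def exp_of_nat2_mult)
      finally show ?thesis .
    qed
    have "(\<integral>\<^sup>+ w. ennreal ((f w)\<^sup>2) \<partial>weights_law \<alpha>)
        \<le> (\<integral>\<^sup>+ w. ennreal V * ((\<Prod>p\<in>F. ennreal (?g p w)) * 1) \<partial>weights_law \<alpha>)"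
    proof (intro nn_integral_mono)
      fix w
      have "(\<Prod>p\<in>F. ennreal (?g p w)) = ennreal (\<Prod>p\<in>F. ?g p w)" by (rule prod_ennreal) (rule g0)
      then show "ennreal ((f w)\<^sup>2) \<le> ennreal V * ((\<Prod>p\<in>F. ennreal (?g p w)) * 1)"
        using ennreal_leI[OF sq[of w]] by (simp only: mult_1_right ennreal_mult'[OF less_imp_le[OF V]])
    qed
    also have "\<dots> = ennreal V * (\<integral>\<^sup>+ w. (\<Prod>p\<in>F. ennreal (?g p w)) * 1 \<partial>weights_law \<alpha>)"
      by (intro nn_integral_cmult borel_measurable_times borel_measurable_prod_ennreal) measurable
    also have "(\<integral>\<^sup>+ w. (\<Prod>p\<in>F. ennreal (?g p w)) * 1 \<partial>weights_law \<alpha>) = (\<integral>\<^sup>+ w. 1 \<partial>weights_law ?\<gamma>)"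
      by (rule nn_integral_weights_law_density[OF F pos \<gamma>pos, symmetric]) auto
    also have "\<dots> = 1" using G.emeasure_space_1 by simp
    finally show ?thesis by simp
  qed
  have Am: "A \<in> sets (weights_law \<alpha>)" using A by simp
  let ?r = "rescale (\<lambda>p. \<alpha> p / (\<alpha> p - \<delta>)) F"
  have r: "rescale (\<lambda>p. \<alpha> p / ?\<beta> p) F = ?r" by (auto simp: rescale_def fun_eq_iff)
  have rm: "?r \<in> configurations \<rightarrow>\<^sub>M configurations" by (rule measurable_rescale[OF F(2)])
  have "ennreal (1 / 2) \<le> emeasure (weights_law \<alpha>) {w \<in> space configurations. ?r w \<in> A}"
    unfolding emeasure_eq_measure by (rule ennreal_leI[OF half])
  also have "{w \<in> space configurations. ?r w \<in> A} = ?r -` A \<inter> space configurations" by auto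
  also have "emeasure (weights_law \<alpha>) (?r -` A \<inter> space configurations)
      = (\<integral>\<^sup>+ w. indicator (?r -` A \<inter> space configurations) w \<partial>weights_law \<alpha>)"
    using measurable_sets[OF rm A] by simp
  also have "\<dots> = (\<integral>\<^sup>+ w. indicator A (?r w) \<partial>weights_law \<alpha>)"
    by (intro nn_integral_cong) (auto simp: indicator_def)
  also have "\<dots> = (\<integral>\<^sup>+ w. indicator A w \<partial>weights_law ?\<beta>)"
    using A by (subst nn_integral_weights_law_rescale[OF F pos \<beta>pos]) (auto simp: r)
  also have "\<dots> = (\<integral>\<^sup>+ w. ennreal (f w) * indicator A w \<partial>weights_law \<alpha>)"
    using A unfolding f_eq by (intro nn_integral_weights_law_density[OF F pos \<beta>pos]) auto
  also have "\<dots> \<le> (\<integral>\<^sup>+ w. ennreal (4 * V) * indicator A w + ennreal (1 / (4 * V)) * ennreal ((f w)\<^sup>2) \<partial>weights_law \<alpha>)"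
  proof (intro nn_integral_mono)
    fix w
    have "f w \<le> 4 * V + 1 / (4 * V) * (f w)\<^sup>2"
    proof (cases "f w \<le> 4 * V")
      case True
      moreover have "0 \<le> 1 / (4 * V) * (f w)\<^sup>2" using V by simp
      ultimately show ?thesis by linarith
    next
      case False
      then have "4 * V * f w \<le> (f w)\<^sup>2" using f0[of w] by (simp add: power2_eq_square mult_right_mono)
      then have "f w \<le> 1 / (4 * V) * (f w)\<^sup>2" using V by (simp add: field_simps)
      then show ?thesis using V by linarith
    qed
    then have "ennreal (f w) \<le> ennreal (4 * V) + ennreal (1 / (4 * V)) * ennreal ((f w)\<^sup>2)"
      using V by (simp add: ennreal_mult'[symmetric] ennreal_plus[symmetric] ennreal_leI del: ennreal_plus)
    then show "ennreal (f w) * indicator A w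
        \<le> ennreal (4 * V) * indicator A w + ennreal (1 / (4 * V)) * ennreal ((f w)\<^sup>2)"
      by (auto simp: indicator_def)
  qed
  also have "\<dots> = ennreal (4 * V) * emeasure (weights_law \<alpha>) A
      + ennreal (1 / (4 * V)) * (\<integral>\<^sup>+ w. ennreal ((f w)\<^sup>2) \<partial>weights_law \<alpha>)"
    using Am by (simp add: nn_integral_add nn_integral_cmult)
  also have "\<dots> \<le> ennreal (4 * V) * emeasure (weights_law \<alpha>) A + ennreal (1 / (4 * V)) * ennreal V"
    using second by (intro add_left_mono mult_left_mono) auto
  also have "\<dots> = ennreal (4 * V * prob A + 1 / 4)"
    using V by (simp add: emeasure_eq_measure ennreal_mult'[symmetric] ennreal_plus[symmetric] del: ennreal_plus)
  finally have "1 / 2 \<le> 4 * V * prob A + 1 / 4"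
    using V by (subst (asm) ennreal_le_iff) (auto intro: add_nonneg_nonneg)
  then have "1 / (16 * V) \<le> prob A" using V by (simp add: field_simps)
  then show ?thesis by (simp add: V_def exp_minus field_simps)
qed

section \<open>Configurations whose tilts exit far\<close>

lemma last_passage_cong:
  assumes "\<And>z. x \<le> z \<Longrightarrow> w z = w' z"
  shows "last_passage w x y = last_passage w' x y"
proof -
  have "sum_list (map w \<pi>) = sum_list (map w' \<pi>)" if "\<pi> \<in> up_right_paths x y" for \<pi>
    using up_right_paths_le[OF that] assms by (intro arg_cong[where f=sum_list] map_cong) auto
  then show ?thesis unfolding last_passage_def by (intro arg_cong[where f=Max] image_cong) auto
qed

lemma last_passage_nonneg:
  assumes "x \<le> y" "\<And>z. x \<le> z \<Longrightarrow> 0 \<le> w z"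
  shows "0 \<le> last_passage w x y"
proof -
  obtain \<pi> where \<pi>: "\<pi> \<in> up_right_paths x y" "last_passage w x y = sum_list (map w \<pi>)"
    using last_passage_attained[OF assms(1)] .
  then show ?thesis using up_right_paths_le[OF \<pi>(1)] assms(2) by (auto intro!: sum_list_nonneg)
qed

lemma sum_rescaled_segment:
  fixes g :: "nat \<Rightarrow> real"
  assumes "1 \<le> \<kappa>" "\<kappa> \<le> K"
  defines "S \<equiv> \<lambda>k. \<Sum>i=1..k. g i"
  shows "(\<Sum>i=1..k. if i \<in> {\<kappa>..K} then c * g i else g i)
    = (if k < \<kappa> then S k else S k + (c - 1) * (S (min k K) - S (\<kappa> - 1)))"
proof (induction k)
  case 0
  then show ?case using assms by (simp add: S_def)
next
  case (Suc k)
  have S: "S (Suc k) = S k + g (Suc k)" by (simp add: S_def)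
  consider "Suc k < \<kappa>" | "Suc k = \<kappa>" | "\<kappa> \<le> k" "Suc k \<le> K" | "\<kappa> \<le> k" "K \<le> k" by linarith
  then show ?case
  proof cases
    case 2
    then show ?thesis using Suc S assms(2) by (auto simp: algebra_simps min_def)
  next
    case 3
    then show ?thesis using Suc S by (auto simp: algebra_simps min_def)
  next
    case 4
    then have "min k K = K" "min (Suc k) K = K" "\<not> k < \<kappa>" "\<not> Suc k < \<kappa>" "Suc k \<notin> {\<kappa>..K}" by auto
    then show ?thesis using Suc S by simp
  qed (use Suc S in auto)
qed

text \<open>
  One axis with partial sums \<open>S\<close> and remaining passage times \<open>L\<close>.  The hypothesis gives an exit that
  exceeds \<open>s\<close> when all weights on the axis are multiplied by \<open>c\<close>; the task is to multiply by \<open>c\<close> only between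
  \<open>\<kappa>\<close> and \<open>K\<close>.  An exit beyond \<open>K\<close> would exceed \<open>s'\<close> with the larger factor \<open>d\<close>.  An exit before \<open>\<kappa>\<close> would
  exceed \<open>t\<close> without any factor, because the factor \<open>c\<close> adds at most \<open>s - t\<close> there.  For the same
  reason an exit in between loses at most \<open>s - t\<close> when the weights before \<open>\<kappa>\<close> are left alone.
\<close>

lemma tilted_exit_above_level:
  fixes S L T :: "nat \<Rightarrow> real"
  assumes mono: "mono S" and near: "\<And>k. k \<in> {1..m} \<Longrightarrow> S k + L k \<le> t"
    and c: "1 \<le> c" "c \<le> d"
    and seg: "(c - 1) * S \<kappa> \<le> s - t"
    and exceed: "k \<in> {1..m}" "s < c * S k + L k"
    and far: "\<And>k. k \<in> {1..m} \<Longrightarrow> d * S k + L k < s'" "s' - s \<le> (d - c) * S K"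
    and T: "\<And>k. \<kappa> \<le> k \<Longrightarrow> T k = S k + (c - 1) * (S (min k K) - S (\<kappa> - 1))"
  shows "\<exists>k\<in>{1..m}. \<kappa> \<le> k \<and> t < T k + L k"
proof -
  have "k \<le> K"
  proof (rule ccontr)
    assume "\<not> k \<le> K"
    then have "(d - c) * S K \<le> (d - c) * S k" using c mono by (intro mult_left_mono monoD[of S]) auto
    with exceed(2) far(2) have "s' < d * S k + L k" by (simp add: algebra_simps)
    with far(1)[OF exceed(1)] show False by simp
  qed
  have "\<kappa> \<le> k"
  proof (rule ccontr)
    assume "\<not> \<kappa> \<le> k"
    then have "(c - 1) * S k \<le> (c - 1) * S \<kappa>" using c mono by (intro mult_left_mono monoD[of S]) auto
    with exceed(2) seg have "t < S k + L k" by (simp add: algebra_simps)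
    with near[OF exceed(1)] show False by simp
  qed
  have "(c - 1) * S (\<kappa> - 1) \<le> (c - 1) * S \<kappa>" using c mono by (intro mult_left_mono monoD[of S]) auto
  with exceed(2) seg have "t < T k + L k"
    using T[OF \<open>\<kappa> \<le> k\<close>] \<open>k \<le> K\<close> by (simp add: min_def algebra_simps)
  with exceed(1) \<open>\<kappa> \<le> k\<close> show ?thesis by blast
qed

lemma mono_x_sum: "(\<And>z. z \<in> weight_sites \<Longrightarrow> 0 < w z) \<Longrightarrow> mono (x_sum w)"
  by (rule monoI, rule lift_Suc_mono_le) (auto simp: weight_sites_iff less_imp_le)

lemma mono_y_sum: "(\<And>z. z \<in> weight_sites \<Longrightarrow> 0 < w z) \<Longrightarrow> mono (y_sum w)"
  by (rule monoI, rule lift_Suc_mono_le) (auto simp: weight_sites_iff less_imp_le)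

lemma scaled_passage_exit_cases:
  assumes "1 \<le> m" "1 \<le> n" "s < scaled_passage a b w m n"
  obtains k where "k \<in> {1..m}" "s < a * x_sum w k + x_tail w m n k"
  | l where "l \<in> {1..n}" "s < b * y_sum w l + y_tail w m n l"
  using passage_time_le_exit[OF assms(1,2), of "\<lambda>k. a * x_sum w k" "\<lambda>l. b * y_sum w l" w] assms(3)
  unfolding scaled_passage_def by (meson less_le_trans)

text \<open>
  When only one axis is multiplied by its factor, the exit that exceeds \<open>s\<close> has to lie on that axis, since
  the exits of the other axis stay below \<open>t \<le> s\<close>.  So the pure passage times \<open>scaled_passage cx 1\<close> and
  \<open>scaled_passage 1 cy\<close> yield one far exit on each axis, although both axes are tilted at once.
\<close>

lemma exit_time_tilted_ge:
  fixes w :: "int \<times> int \<Rightarrow> real"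
  assumes mn: "1 \<le> m" "1 \<le> n" and \<kappa>: "1 \<le> \<kappa>" "\<kappa> \<le> K" "\<And>k. real k < R \<longleftrightarrow> k < \<kappa>"
    and pos: "\<And>z. z \<in> weight_sites \<Longrightarrow> 0 < w z"
    and near: "\<And>k. k \<in> {1..m} \<Longrightarrow> x_sum w k + x_tail w m n k \<le> t"
      "\<And>l. l \<in> {1..n} \<Longrightarrow> y_sum w l + y_tail w m n l \<le> t"
    and ts: "t \<le> s"
    and exceed: "s < scaled_passage cx 1 w m n" "s < scaled_passage 1 cy w m n"
    and c: "1 \<le> cx" "cx \<le> dx" "1 \<le> cy" "cy \<le> dy"
    and seg: "(cx - 1) * x_sum w \<kappa> \<le> s - t" "(cy - 1) * y_sum w \<kappa> \<le> s - t"
    and far: "\<And>k. k \<in> {1..m} \<Longrightarrow> dx * x_sum w k + x_tail w m n k < s'"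
      "\<And>l. l \<in> {1..n} \<Longrightarrow> dy * y_sum w l + y_tail w m n l < s'"
      "s' - s \<le> (dx - cx) * x_sum w K" "s' - s \<le> (dy - cy) * y_sum w K"
    and f: "\<And>i. f (int i, 0) = cx" "\<And>j. 1 \<le> j \<Longrightarrow> f (0, int j) = cy"
    and z: "z \<in> pos_quadrant" "int m \<le> fst z \<or> int n \<le> snd z"
  shows "R \<le> real_of_int \<bar>exit_time (rescale f (x_sites {\<kappa>..K} \<union> y_sites {\<kappa>..K}) w) z\<bar>"
proof -
  let ?w = "rescale f (x_sites {\<kappa>..K} \<union> y_sites {\<kappa>..K}) w"
  have x_tail: "x_tail ?w m n k = x_tail w m n k" if "1 \<le> k" for k
    using that by (intro last_passage_cong) (auto simp: rescale_def x_sites_def y_sites_def less_eq_prod_def)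
  have y_tail: "y_tail ?w m n k = y_tail w m n k" if "1 \<le> k" for k
    using that by (intro last_passage_cong) (auto simp: rescale_def x_sites_def y_sites_def less_eq_prod_def)
  have "x_sum ?w k = (\<Sum>i=1..k. if i \<in> {\<kappa>..K} then cx * w (int i, 0) else w (int i, 0))" for k
    unfolding x_sum_def by (intro sum.cong) (auto simp: rescale_def x_sites_def y_sites_def f)
  then have xs: "x_sum ?w k = (if k < \<kappa> then x_sum w k
      else x_sum w k + (cx - 1) * (x_sum w (min k K) - x_sum w (\<kappa> - 1)))" for k
    using sum_rescaled_segment[OF \<kappa>(1,2), where k=k and c=cx and g="\<lambda>i. w (int i, 0)"] by (simp add: x_sum_def)
  have "y_sum ?w k = (\<Sum>i=1..k. if i \<in> {\<kappa>..K} then cy * w (0, int i) else w (0, int i))" for k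
    unfolding y_sum_def using \<kappa>(1) by (intro sum.cong) (auto simp: rescale_def x_sites_def y_sites_def f)
  then have ys: "y_sum ?w k = (if k < \<kappa> then y_sum w k
      else y_sum w k + (cy - 1) * (y_sum w (min k K) - y_sum w (\<kappa> - 1)))" for k
    using sum_rescaled_segment[OF \<kappa>(1,2), where k=k and c=cy and g="\<lambda>i. w (0, int i)"] by (simp add: y_sum_def)
  show ?thesis
  proof (rule exit_time_ge_outside_box[OF mn _ _ _ _ z])
    fix k assume "k \<in> {1..m}" "real k < R"
    then show "x_sum ?w k + x_tail ?w m n k \<le> t" using near(1) \<kappa>(3) by (simp add: xs x_tail)
  next
    fix k assume "k \<in> {1..n}" "real k < R"
    then show "y_sum ?w k + y_tail ?w m n k \<le> t" using near(2) \<kappa>(3) by (simp add: ys y_tail)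
  next
    obtain k where k: "k \<in> {1..m}" "s < cx * x_sum w k + x_tail w m n k"
      using mn exceed(1)
    proof (cases rule: scaled_passage_exit_cases)
      case (2 l)
      with near(2)[of l] ts show ?thesis by simp
    qed
    have "\<exists>k\<in>{1..m}. \<kappa> \<le> k \<and> t < x_sum ?w k + x_tail w m n k"
      by (rule tilted_exit_above_level[where S="x_sum w" and K=K and c=cx and d=dx and s=s and s'=s'])
        (use k near(1) c seg(1) far(1,3) xs mono_x_sum[OF pos] in auto)
    then show "\<exists>k\<in>{1..m}. R \<le> real k \<and> t < x_sum ?w k + x_tail ?w m n k"
      using \<kappa>(3) x_tail by (metis atLeastAtMost_iff not_less)
  next
    obtain k where k: "k \<in> {1..n}" "s < cy * y_sum w k + y_tail w m n k"
      using mn exceed(2)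
    proof (cases rule: scaled_passage_exit_cases)
      case (1 l)
      with near(1)[of l] ts show ?thesis by simp
    qed
    have "\<exists>k\<in>{1..n}. \<kappa> \<le> k \<and> t < y_sum ?w k + y_tail w m n k"
      by (rule tilted_exit_above_level[where S="y_sum w" and K=K and c=cy and d=dy and s=s and s'=s'])
        (use k near(2) c seg(2) far(2,4) ys mono_y_sum[OF pos] in auto)
    then show "\<exists>k\<in>{1..n}. R \<le> real k \<and> t < y_sum ?w k + y_tail ?w m n k"
      using \<kappa>(3) y_tail by (metis atLeastAtMost_iff not_less)
  qed
qed

text \<open>
  Markov's inequality for the exponential moments with \<open>\<theta> = a / 2\<close> and \<open>\<theta> = - a\<close>.
\<close>

lemma sum_deviation:
  assumes F: "finite F" "F \<subseteq> weight_sites" and pos: "\<And>z. 0 < \<alpha> z"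
    and a: "\<And>p. p \<in> F \<Longrightarrow> \<alpha> p = a" "0 < a"
  shows "measure (weights_law \<alpha>) {w \<in> space configurations. 2 * real (card F) / a \<le> (\<Sum>p\<in>F. w p)}
      \<le> exp (- real (card F) / 8)"
    and "measure (weights_law \<alpha>) {w \<in> space configurations. (\<Sum>p\<in>F. w p) \<le> real (card F) / (2 * a)}
      \<le> exp (- real (card F) / 8)"
proof -
  interpret prob_space "weights_law \<alpha>" by (rule prob_space_weights_law[OF pos])
  let ?k = "card F"
  have m: "(\<lambda>w. \<Sum>p\<in>F. w p) \<in> borel_measurable (weights_law \<alpha>)"
    using F by (simp cong: measurable_cong_sets) (intro borel_measurable_sum measurable_weight, auto)
  have two: "2 ^ ?k = exp (real ?k * ln 2)" "(1 / 2) ^ ?k = exp (- (real ?k * ln 2))"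
    by (simp_all add: power_eq_exp_ln ln_div)
  have ln2: "real ?k * ln 2 \<le> real ?k * (25 / 36)" "real ?k * (2 / 3) \<le> real ?k * ln 2"
    by (intro mult_left_mono ln2_le_25_over_36 ln2_ge_two_thirds; simp)+
  have "prob {w \<in> space (weights_law \<alpha>). real ?k \<le> a / 2 * (\<Sum>p\<in>F. w p)} \<le> exp (- real ?k) * 2 ^ ?k"
    using m exp_moment_sum[OF F pos, where a=a and \<theta>="a / 2"] a by (intro exp_markov) auto
  also have "\<dots> \<le> exp (- real ?k / 8)" unfolding two exp_add[symmetric] using ln2 by simp
  finally show "prob {w \<in> space configurations. 2 * real ?k / a \<le> (\<Sum>p\<in>F. w p)} \<le> exp (- real ?k / 8)"
    using a(2) by (simp add: field_simps)
  have "prob {w \<in> space (weights_law \<alpha>). - (real ?k / 2) \<le> (- a) * (\<Sum>p\<in>F. w p)} \<le> exp (- (- (real ?k / 2))) * (1 / 2) ^ ?k"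
    using m exp_moment_sum[OF F pos, where a=a and \<theta>="- a"] a by (intro exp_markov) auto
  also have "\<dots> \<le> exp (- real ?k / 8)" unfolding two exp_add[symmetric] using ln2 by simp
  finally show "prob {w \<in> space configurations. (\<Sum>p\<in>F. w p) \<le> real ?k / (2 * a)} \<le> exp (- real ?k / 8)"
    using a(2) by (simp add: field_simps)
qed

section \<open>Moderate deviations\<close>

definition far_exits :: "real \<Rightarrow> real \<Rightarrow> real \<Rightarrow> (int \<times> int \<Rightarrow> real) set" where
  "far_exits \<rho> N R = {w \<in> space configurations.
     \<forall>z \<in> pos_quadrant - {0..char_point \<rho> N}. R \<le> real_of_int \<bar>exit_time w z\<bar>}"

lemma far_exits_sets: "far_exits \<rho> N R \<in> sets configurations"
  unfolding far_exits_def by (rule far_exit_event_sets)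

lemma outside_char_box:
  assumes "z \<in> pos_quadrant - {0..char_point \<rho> N}" "0 \<le> N"
  shows "int (nat \<lfloor>N * (1 - \<rho>)\<^sup>2\<rfloor> + 1) \<le> fst z \<or> int (nat \<lfloor>N * \<rho>\<^sup>2\<rfloor> + 1) \<le> snd z"
  using assms by (auto simp: pos_quadrant_def char_point_def less_eq_prod_def zero_prod_def)

lemma (in prob_space) prob_Un_le:
  assumes "A \<in> events" "B \<in> events" "prob A \<le> a" "prob B \<le> b"
  shows "prob (A \<union> B) \<le> a + b"
  using measure_Un_le[OF assms(1,2)] assms(3,4) by linarith

lemma exp_minus_16: "3 * exp (- 16 :: real) \<le> 1 / 20"
proof -
  have "(145 :: real) \<le> exp 16" using exp_lower_Taylor_quadratic[of 16] by simp
  then have "inverse (exp (16 :: real)) \<le> inverse 145" by (intro le_imp_inverse_le) auto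
  then show ?thesis by (simp add: exp_minus)
qed

text \<open>
  One axis keeps the stationary rate and the other gets lighter weights, which brings the parameters into
  the order \<open>z < u\<close> of the upper tail bound.  Each statement is used for the exits along the unscaled axis.
\<close>

lemma near_exits_upper_tail:
  fixes \<rho> N h \<tau> :: real
  assumes \<rho>: "0 < \<rho>" "\<rho> < 1" and N: "0 \<le> N"
    and m: "real m \<le> N * (1 - \<rho>)\<^sup>2 + 1" and n: "real n \<le> N * \<rho>\<^sup>2 + 1"
    and h: "0 < h" "h \<le> (1 - \<rho>) / 4" "h \<le> \<rho> / 4"
    and big: "16 \<le> h * (t - N - N * (h\<^sup>2 * (4 / ((1 - \<rho>) * \<rho>))))"
  shows "measure (stationary_measure \<rho>) {w \<in> space configurations.
      t \<le> scaled_passage 1 (\<rho> / (\<rho> + h)) w m n} \<le> 1 / 20"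
    and "measure (stationary_measure \<rho>) {w \<in> space configurations.
      t \<le> scaled_passage ((1 - \<rho>) / (1 - \<rho> + h)) 1 w m n} \<le> 1 / 20"
proof -
  have e: "3 * exp (N * (h * h\<^sup>2 * (4 / ((1 - \<rho>) * \<rho>))) - h * (t - N)) \<le> 1 / 20"
  proof -
    have "N * (h * h\<^sup>2 * (4 / ((1 - \<rho>) * \<rho>))) - h * (t - N) \<le> - 16"
      using big by (simp add: algebra_simps)
    then have "exp (N * (h * h\<^sup>2 * (4 / ((1 - \<rho>) * \<rho>))) - h * (t - N)) \<le> exp (- 16)" by simp
    then show ?thesis using exp_minus_16 by linarith
  qed
  have "1 - (1 - \<rho> - h) = \<rho> + h" "(1 - \<rho>) - (1 - \<rho> - h) = h" "1 - (1 - \<rho>) = \<rho>" by simp_all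
  then show "measure (stationary_measure \<rho>) {w \<in> space configurations.
      t \<le> scaled_passage 1 (\<rho> / (\<rho> + h)) w m n} \<le> 1 / 20"
    using scaled_passage_upper_tail[OF \<rho> N m n, of h "1 - \<rho> - h" "1 - \<rho>" t] h \<rho> e by simp
  show "measure (stationary_measure \<rho>) {w \<in> space configurations.
      t \<le> scaled_passage ((1 - \<rho>) / (1 - \<rho> + h)) 1 w m n} \<le> 1 / 20"
    using scaled_passage_upper_tail[OF \<rho> N m n, of h "1 - \<rho>" "1 - \<rho> + h" t] h \<rho> e by simp
qed

text \<open>
  With \<open>q = N\<^bsup>1/3\<^esup>\<close> three levels are used: near exits stay below \<open>t = N + (B + 1) r\<^sup>2 q\<close>; an axis at rates
  lowered by \<open>\<delta> = a r / q\<close> reaches \<open>s = N + a\<^sup>2 r\<^sup>2 q\<close>; an axis at rates lowered by \<open>2 \<delta>\<close> stays below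
  \<open>s' = N + (9 B + 1) a\<^sup>2 r\<^sup>2 q\<close>.  The tilt adds about \<open>a r\<^sup>2 q\<close> on the first \<open>R\<close> sites, linear in \<open>a\<close>, whereas
  \<open>s - t\<close> grows like \<open>a\<^sup>2\<close>; this decides the choice of \<open>a\<close>.  Beyond \<open>K\<close> the step from \<open>\<delta>\<close> to \<open>2 \<delta>\<close> adds
  at least \<open>\<delta> K / 2\<close>, and \<open>b\<close> is chosen so that this covers \<open>s' - s\<close>.  The ten exceptional events have
  probability at most \<open>1/20\<close> each.
\<close>

lemma tilted_far_exit_likely:
  fixes \<rho> q r :: real
  assumes \<rho>: "0 < \<rho>" "\<rho> < 1" and q: "1 \<le> q" and r: "128 \<le> r"
  defines "\<eta> \<equiv> min (1 - \<rho>) \<rho>" and "B \<equiv> 4 / ((1 - \<rho>) * \<rho>)"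
  defines "a \<equiv> 8 / \<eta>\<^sup>2 + B + 3"
  defines "b \<equiv> 18 * B * a" and "\<delta> \<equiv> a * r / q"
  defines "\<kappa> \<equiv> nat \<lceil>r * q\<^sup>2\<rceil>"
  defines "K \<equiv> nat \<lceil>b * (r * q\<^sup>2)\<rceil>"
  assumes small: "12 * \<delta> \<le> \<eta>"
  shows "1 / 2 \<le> measure (stationary_measure \<rho>) {w \<in> space configurations.
    rescale (\<lambda>p. weight_rate \<rho> p / (weight_rate \<rho> p - \<delta>)) (x_sites {\<kappa>..K} \<union> y_sites {\<kappa>..K}) w
      \<in> far_exits \<rho> (q ^ 3) (r * q\<^sup>2)}"
proof -
  let ?P = "stationary_measure \<rho>"
  interpret prob_space ?P by (rule prob_space_stationary_measure[OF \<rho>])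
  let ?f = "\<lambda>p. weight_rate \<rho> p / (weight_rate \<rho> p - \<delta>)"
  define N R where "N = q ^ 3" and "R = r * q\<^sup>2"
  define m n where "m = nat \<lfloor>N * (1 - \<rho>)\<^sup>2\<rfloor> + 1" and "n = nat \<lfloor>N * \<rho>\<^sup>2\<rfloor> + 1"
  define \<delta>\<^sub>0 where "\<delta>\<^sub>0 = r / q"
  define t s s' where "t = N + (B + 1) * r\<^sup>2 * q" and "s = N + a\<^sup>2 * r\<^sup>2 * q"
    and "s' = N + (9 * B + 1) * a\<^sup>2 * r\<^sup>2 * q"
  have \<eta>: "0 < \<eta>" "\<eta> \<le> 1 - \<rho>" "\<eta> \<le> \<rho>" using \<rho> by (auto simp: \<eta>_def)
  have B: "4 < B"
  proof -
    have "(1 - \<rho>) * \<rho> < 1 * 1" using \<rho> by (intro mult_strict_mono) auto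
    then show ?thesis using \<rho> by (simp add: B_def field_simps)
  qed
  have a: "3 < a" "8 * a / \<eta>\<^sup>2 + B + 1 \<le> a\<^sup>2"
  proof -
    have "0 \<le> 8 / \<eta>\<^sup>2" by simp
    then show "3 < a" using B unfolding a_def by linarith
    then have "(B + 3) * 1 \<le> (B + 3) * a" using B by (intro mult_left_mono; simp)
    then have le: "B + 1 \<le> (B + 3) * a" unfolding mult_1_right by (rule order_trans[rotated]) simp
    have "a\<^sup>2 = (8 / \<eta>\<^sup>2 + (B + 3)) * a" by (simp add: a_def power2_eq_square add.assoc)
    then have sq: "a\<^sup>2 = 8 * a / \<eta>\<^sup>2 + (B + 3) * a" by (simp add: distrib_right)
    show "8 * a / \<eta>\<^sup>2 + B + 1 \<le> a\<^sup>2" unfolding sq add.assoc by (rule add_left_mono[OF le])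
  qed
  have N: "0 \<le> N" "1 \<le> N" using q by (auto simp: N_def)
  have fl: "0 \<le> N * (1 - \<rho>)\<^sup>2" "0 \<le> N * \<rho>\<^sup>2" using N by auto
  have m: "N * (1 - \<rho>)\<^sup>2 \<le> real m" "real m \<le> N * (1 - \<rho>)\<^sup>2 + 1" "1 \<le> m"
    and n: "N * \<rho>\<^sup>2 \<le> real n" "real n \<le> N * \<rho>\<^sup>2 + 1" "1 \<le> n"
    unfolding m_def n_def using fl by (auto simp: nat_add_distrib) linarith+
  have R: "128 \<le> R" "r \<le> R"
  proof -
    have "r * 1 \<le> r * q\<^sup>2" using q r by (intro mult_left_mono) auto
    then show "r \<le> R" by (simp only: R_def mult_1_right)
    then show "128 \<le> R" using r by linarith
  qed
  have b: "1 \<le> b"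
  proof -
    have "4 * 3 \<le> B * a" using B a by (intro mult_mono) auto
    then show ?thesis by (simp add: b_def)
  qed
  have \<kappa>: "1 \<le> \<kappa>" "R \<le> real \<kappa>" "real \<kappa> \<le> 2 * R" "\<And>k. real k < R \<longleftrightarrow> k < \<kappa>"
    using R unfolding \<kappa>_def R_def[symmetric] by (auto simp: nat_less_iff) linarith+
  have bR: "R \<le> b * R" using b R by simp
  have K: "\<kappa> \<le> K" "b * R \<le> real K"
    unfolding \<kappa>_def K_def R_def[symmetric]
    by (intro nat_mono ceiling_mono bR, rule real_nat_ceiling_ge)
  have \<delta>: "0 < \<delta>" "\<delta> \<le> \<eta> / 12"
  proof -
    show "0 < \<delta>" using a q r by (simp add: \<delta>_def)
    show "\<delta> \<le> \<eta> / 12" using small by linarith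
  qed
  have \<delta>\<^sub>0: "0 < \<delta>\<^sub>0" "\<delta>\<^sub>0 \<le> \<delta>" using a q r by (auto simp: \<delta>\<^sub>0_def \<delta>_def divide_right_mono)
  have ts: "t \<le> s"
  proof -
    have "0 \<le> 8 * a / \<eta>\<^sup>2" using a by simp
    then have "B + 1 \<le> a\<^sup>2" using a(2) by linarith
    then have "(B + 1) * (r\<^sup>2 * q) \<le> a\<^sup>2 * (r\<^sup>2 * q)" using a q by (intro mult_right_mono) auto
    then show ?thesis by (simp add: t_def s_def mult.assoc)
  qed
  define UT where "UT u z s = {w \<in> space configurations. s \<le> scaled_passage ((1 - \<rho>) / u) (\<rho> / (1 - z)) w m n}" for u z s
  define LT where "LT u z s = {w \<in> space configurations. scaled_passage ((1 - \<rho>) / u) (\<rho> / (1 - z)) w m n \<le> s}" for u z s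
  have UTm: "UT u z s \<in> events" and LTm: "LT u z s \<in> events" for u z s
    using scaled_passage_measurable unfolding UT_def LT_def sets_stationary_measure by measurable
  have sumx: "x_sum w k = (\<Sum>p\<in>x_sites {1..k}. w p)" and sumy: "y_sum w k = (\<Sum>p\<in>y_sites {1..k}. w p)" for w k
    by (simp_all add: x_sum_def y_sum_def x_sites_simps y_sites_simps)
  define XU where "XU = {w \<in> space configurations. 2 * real \<kappa> / (1 - \<rho>) \<le> x_sum w \<kappa>}"
  define YU where "YU = {w \<in> space configurations. 2 * real \<kappa> / \<rho> \<le> y_sum w \<kappa>}"
  define XL where "XL = {w \<in> space configurations. x_sum w K \<le> real K / (2 * (1 - \<rho>))}"
  define YL where "YL = {w \<in> space configurations. y_sum w K \<le> real K / (2 * \<rho>)}"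
  have sums_m: "XU \<in> events" "YU \<in> events" "XL \<in> events" "YL \<in> events"
    using x_sum_measurable y_sum_measurable unfolding XU_def YU_def XL_def YL_def sets_stationary_measure
    by measurable
  have expk: "exp (- real k / 8) \<le> 1 / 20" if "\<kappa> \<le> k" for k
  proof -
    have "- real k / 8 \<le> - 16" using that \<kappa>(2) R by simp
    then have "exp (- real k / 8) \<le> exp (- 16)" by simp
    also have "\<dots> \<le> 3 * exp (- 16)" by simp
    finally show ?thesis using exp_minus_16 by linarith
  qed
  have sums: "prob XU \<le> 1 / 20" "prob YU \<le> 1 / 20" "prob XL \<le> 1 / 20" "prob YL \<le> 1 / 20"
  proof -
    note pos = weight_rate_pos[OF \<rho>]
    have yr: "weight_rate \<rho> p = \<rho>" if "p \<in> y_sites {1..k}" for p k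
      using weight_rate_y_sites[of "{1..k}"] that by simp
    note X = sum_deviation[where \<alpha>="weight_rate \<rho>" and F="x_sites {1..k}" and a="1 - \<rho>" for k, OF _ _ pos]
    note Y = sum_deviation[where \<alpha>="weight_rate \<rho>" and F="y_sites {1..k}" and a=\<rho> for k, OF _ _ pos]
    show "prob XU \<le> 1 / 20"
      using X(1)[of \<kappa>] expk[of \<kappa>] \<rho> unfolding XU_def sumx stationary_eq_weights_law
      by (simp add: x_sites_simps weight_rate_x_sites)
    show "prob YU \<le> 1 / 20"
      using Y(1)[of \<kappa>] expk[of \<kappa>] \<rho> unfolding YU_def sumy stationary_eq_weights_law
      by (simp add: y_sites_simps yr)
    show "prob XL \<le> 1 / 20"
      using X(2)[of K] expk[of K] \<rho> K(1) unfolding XL_def sumx stationary_eq_weights_law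
      by (simp add: x_sites_simps weight_rate_x_sites)
    show "prob YL \<le> 1 / 20"
      using Y(2)[of K] expk[of K] \<rho> K(1) unfolding YL_def sumy stationary_eq_weights_law
      by (simp add: y_sites_simps yr)
  qed
  have r3: "16 \<le> r ^ 3"
  proof -
    have "128 ^ 1 \<le> r ^ 1" using r by simp
    also have "\<dots> \<le> r ^ 3" using r by (intro power_increasing) auto
    finally show ?thesis by simp
  qed
  have exp_r3: "3 * exp x \<le> 1 / 20" if "x \<le> - (r ^ 3)" for x
  proof -
    have "exp x \<le> exp (- 16)" using that r3 by simp
    then show ?thesis using exp_minus_16 by linarith
  qed
  have a3: "r ^ 3 \<le> a ^ 3 * r ^ 3 / 3"
  proof -
    have "3 ^ 3 \<le> a ^ 3" using a by (intro power_mono) auto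
    then have "3 ^ 3 * r ^ 3 \<le> a ^ 3 * r ^ 3" using r by (intro mult_right_mono) auto
    then show ?thesis using r3 by simp
  qed
  have scale: "N * \<delta> ^ 3 = a ^ 3 * r ^ 3" "\<delta> * (r\<^sup>2 * q) = a * r ^ 3" "N * \<delta>\<^sub>0 ^ 3 = r ^ 3" "\<delta>\<^sub>0 * (r\<^sup>2 * q) = r ^ 3"
    "\<delta> * R = a * (r\<^sup>2 * q)"
    using q by (simp_all add: N_def \<delta>_def \<delta>\<^sub>0_def R_def power_divide power_mult_distrib power2_eq_square power3_eq_cube)
  note upper = scaled_passage_upper_tail[OF \<rho> N(1) m(2) n(2), folded B_def UT_def]
  note lower = scaled_passage_lower_tail[OF \<rho> N(1) m(1) n(1), folded LT_def]
  have near_exponent: "N * (\<delta>\<^sub>0 * \<delta>\<^sub>0\<^sup>2 * B) - \<delta>\<^sub>0 * (t - N) = - (r ^ 3)"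
  proof -
    have "N * (\<delta>\<^sub>0 * \<delta>\<^sub>0\<^sup>2 * B) - \<delta>\<^sub>0 * (t - N) = B * (N * \<delta>\<^sub>0 ^ 3) - (B + 1) * (\<delta>\<^sub>0 * (r\<^sup>2 * q))"
      by (simp add: t_def power2_eq_square power3_eq_cube algebra_simps)
    then show ?thesis unfolding scale by (simp add: algebra_simps)
  qed
  have E1: "prob (UT (1 - \<rho>) (1 - \<rho> - \<delta>\<^sub>0) t) \<le> 1 / 20"
    using upper[of \<delta>\<^sub>0 "1 - \<rho> - \<delta>\<^sub>0" "1 - \<rho>" t] \<delta>\<^sub>0 \<delta> \<eta> near_exponent exp_r3[of "- (r ^ 3)"] by simp
  have E2: "prob (UT (1 - \<rho> + \<delta>\<^sub>0) (1 - \<rho>) t) \<le> 1 / 20"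
    using upper[of \<delta>\<^sub>0 "1 - \<rho>" "1 - \<rho> + \<delta>\<^sub>0" t] \<delta>\<^sub>0 \<delta> \<eta> near_exponent exp_r3[of "- (r ^ 3)"] by simp
  have exceed_exponent: "\<delta> * (s - N) - N * (4 / 3 * \<delta> ^ 3) \<le> - (r ^ 3)"
  proof -
    have "\<delta> * (s - N) - N * (4 / 3 * \<delta> ^ 3) = a\<^sup>2 * (\<delta> * (r\<^sup>2 * q)) - 4 / 3 * (N * \<delta> ^ 3)"
      by (simp add: s_def algebra_simps)
    also have "\<dots> = - (a ^ 3 * r ^ 3 / 3)"
      unfolding scale by (simp add: power2_eq_square power3_eq_cube)
    finally show ?thesis using a3 by linarith
  qed
  have e3: "exp (\<delta> * (s - N) - N * (4 / 3 * \<delta> ^ 3)) \<le> 1 / 20"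
  proof -
    have "exp (\<delta> * (s - N) - N * (4 / 3 * \<delta> ^ 3)) \<le> 3 * exp (\<delta> * (s - N) - N * (4 / 3 * \<delta> ^ 3))" by simp
    then show ?thesis using exp_r3[OF exceed_exponent] by linarith
  qed
  have E3: "prob (LT (1 - \<rho> - \<delta>) (1 - \<rho>) s) \<le> 1 / 20"
    using lower[of "1 - \<rho> - \<delta>" "1 - \<rho>" s] \<delta> \<eta> \<rho> e3 by simp
  have E4: "prob (LT (1 - \<rho>) (1 - \<rho> + \<delta>) s) \<le> 1 / 20"
    using lower[of "1 - \<rho>" "1 - \<rho> + \<delta>" s] \<delta> \<eta> \<rho> e3 by simp
  have far_exponent: "N * (\<delta> * (3 * \<delta>)\<^sup>2 * B) - \<delta> * (s' - N) \<le> - (r ^ 3)"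
  proof -
    have "N * (\<delta> * (3 * \<delta>)\<^sup>2 * B) - \<delta> * (s' - N) = 9 * B * (N * \<delta> ^ 3) - (9 * B + 1) * a\<^sup>2 * (\<delta> * (r\<^sup>2 * q))"
      by (simp add: s'_def power2_eq_square power3_eq_cube algebra_simps)
    also have "\<dots> = - (a ^ 3 * r ^ 3)"
      unfolding scale by (simp add: power2_eq_square power3_eq_cube algebra_simps)
    finally show ?thesis using a3 r3 by linarith
  qed
  have E5: "prob (UT (1 - \<rho> - 2 * \<delta>) (1 - \<rho> - 3 * \<delta>) s') \<le> 1 / 20"
    using upper[of "3 * \<delta>" "1 - \<rho> - 3 * \<delta>" "1 - \<rho> - 2 * \<delta>" s'] \<delta> \<eta> exp_r3[OF far_exponent] by simp
  have E6: "prob (UT (1 - \<rho> + 3 * \<delta>) (1 - \<rho> + 2 * \<delta>) s') \<le> 1 / 20"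
    using upper[of "3 * \<delta>" "1 - \<rho> + 2 * \<delta>" "1 - \<rho> + 3 * \<delta>" s'] \<delta> \<eta> exp_r3[OF far_exponent] by simp
  define Bad where "Bad = UT (1 - \<rho>) (1 - \<rho> - \<delta>\<^sub>0) t \<union> (UT (1 - \<rho> + \<delta>\<^sub>0) (1 - \<rho>) t \<union>
     (LT (1 - \<rho> - \<delta>) (1 - \<rho>) s \<union> (LT (1 - \<rho>) (1 - \<rho> + \<delta>) s \<union>
     (UT (1 - \<rho> - 2 * \<delta>) (1 - \<rho> - 3 * \<delta>) s' \<union> (UT (1 - \<rho> + 3 * \<delta>) (1 - \<rho> + 2 * \<delta>) s' \<union>
     (XU \<union> (YU \<union> (XL \<union> YL))))))))"
  have Badm: "Bad \<in> events" unfolding Bad_def by (intro sets.Un UTm LTm sums_m)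
  have "prob Bad \<le> 1/20 + (1/20 + (1/20 + (1/20 + (1/20 + (1/20 + (1/20 + (1/20 + (1/20 + 1/20))))))))"
    unfolding Bad_def by (intro prob_Un_le sets.Un UTm LTm sums_m sums E1 E2 E3 E4 E5 E6)
  then have "1 / 2 \<le> prob (space ?P - Bad)"
    using prob_compl[OF Badm] by simp
  also have "\<dots> \<le> prob {w \<in> space configurations.
      rescale ?f (x_sites {\<kappa>..K} \<union> y_sites {\<kappa>..K}) w \<in> far_exits \<rho> N R}"
  proof (rule finite_measure_mono_AE)
    have sub: "x_sites {\<kappa>..K} \<union> y_sites {\<kappa>..K} \<subseteq> weight_sites"
      using \<kappa>(1) by (simp add: x_sites_simps y_sites_simps)
    note rm = measurable_rescale[OF sub, of ?f]
    show "{w \<in> space configurations. rescale ?f (x_sites {\<kappa>..K} \<union> y_sites {\<kappa>..K}) w \<in> far_exits \<rho> N R} \<in> events"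
      using measurable_sets[OF rm far_exits_sets] unfolding sets_stationary_measure
      by (simp add: vimage_def Int_def conj_commute)
    have "AE w in ?P. \<forall>z\<in>weight_sites. 0 < w z"
      unfolding stationary_eq_weights_law by (rule AE_weights_law_pos[OF weight_rate_pos[OF \<rho>]])
    then show "AE w in ?P. w \<in> space ?P - Bad \<longrightarrow> w \<in> {w \<in> space configurations.
        rescale ?f (x_sites {\<kappa>..K} \<union> y_sites {\<kappa>..K}) w \<in> far_exits \<rho> N R}"
    proof (rule AE_mp, intro AE_I2 impI)
      fix w assume w: "\<forall>z\<in>weight_sites. 0 < w z" "w \<in> space ?P - Bad"
      then have ws: "w \<in> space configurations" by (simp add: space_stationary_measure)
      have good: "scaled_passage 1 (\<rho> / (\<rho> + \<delta>\<^sub>0)) w m n < t"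
        "scaled_passage ((1 - \<rho>) / (1 - \<rho> + \<delta>\<^sub>0)) 1 w m n < t"
        "s < scaled_passage ((1 - \<rho>) / (1 - \<rho> - \<delta>)) 1 w m n"
        "s < scaled_passage 1 (\<rho> / (\<rho> - \<delta>)) w m n"
        "scaled_passage ((1 - \<rho>) / (1 - \<rho> - 2 * \<delta>)) (\<rho> / (\<rho> + 3 * \<delta>)) w m n < s'"
        "scaled_passage ((1 - \<rho>) / (1 - \<rho> + 3 * \<delta>)) (\<rho> / (\<rho> - 2 * \<delta>)) w m n < s'"
        "x_sum w \<kappa> < 2 * real \<kappa> / (1 - \<rho>)" "y_sum w \<kappa> < 2 * real \<kappa> / \<rho>"
        "real K / (2 * (1 - \<rho>)) < x_sum w K" "real K / (2 * \<rho>) < y_sum w K"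
        using w(2) ws \<rho> by (auto simp: Bad_def UT_def LT_def XU_def YU_def XL_def YL_def not_le algebra_simps)
      \<comment> \<open>The extra weight collected before the tilted window, on either axis, is at most \<open>s - t\<close>.\<close>
      have seg: "(v / (v - \<delta>) - 1) * S \<le> s - t" if v: "\<eta> \<le> v" "0 \<le> S" "S < 2 * real \<kappa> / v" for v S
      proof -
        have v0: "0 < v" "v / 2 \<le> v - \<delta>" using v \<eta> \<delta> by auto
        have "v / (v - \<delta>) - 1 = \<delta> / (v - \<delta>)" using v0 by (simp add: field_simps)
        also have "\<dots> \<le> \<delta> / (v / 2)" using v0 \<delta> by (intro divide_left_mono) auto
        finally have "(v / (v - \<delta>) - 1) * S \<le> \<delta> / (v / 2) * (2 * real \<kappa> / v)"
          using v v0 \<delta> by (intro mult_mono) auto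
        also have "\<dots> = 4 * \<delta> * real \<kappa> / v\<^sup>2" using v0 by (simp add: power2_eq_square)
        also have "\<dots> \<le> 4 * \<delta> * (2 * R) / \<eta>\<^sup>2"
          using \<kappa>(3) \<delta> v(1) \<eta> by (intro frac_le mult_left_mono power_mono) auto
        also have "\<dots> = 8 * a / \<eta>\<^sup>2 * (r\<^sup>2 * q)" using scale(5) by simp
        also have "\<dots> \<le> (a\<^sup>2 - (B + 1)) * (r\<^sup>2 * q)" using a(2) q by (intro mult_right_mono) auto
        also have "\<dots> = s - t" by (simp add: s_def t_def algebra_simps)
        finally show ?thesis .
      qed
      \<comment> \<open>Beyond the tilted window, doubling \<open>\<delta>\<close> gains at least \<open>s' - s\<close>.\<close>
      have far: "s' - s \<le> (v / (v - 2 * \<delta>) - v / (v - \<delta>)) * S" if v: "\<eta> \<le> v" "v < 1" "real K / (2 * v) < S" for v S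
      proof -
        have v0: "0 < v" "0 < v - 2 * \<delta>" "0 < v - \<delta>" using v \<eta> \<delta> by auto
        have "s' - s = 9 * B * a\<^sup>2 * (r\<^sup>2 * q)" by (simp add: s'_def s_def algebra_simps)
        also have "\<dots> = 9 * B * a * (\<delta> * R)" unfolding scale(5) by (simp add: power2_eq_square)
        also have "\<dots> = \<delta> * (b * R) / 2" by (simp add: b_def)
        also have "\<dots> \<le> \<delta> * real K / 2" using K(2) \<delta> by simp
        also have "\<dots> \<le> \<delta> * (real K / (2 * v))"
        proof -
          have "real K / 2 \<le> real K / (2 * v)" using v v0 by (intro divide_left_mono) auto
          from mult_left_mono[OF this, of \<delta>] \<delta> show ?thesis by simp
        qed
        also have "\<dots> \<le> \<delta> * S" using v \<delta> by (intro mult_left_mono) auto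
        also have "\<dots> \<le> (v / (v - 2 * \<delta>) - v / (v - \<delta>)) * S"
        proof (rule mult_right_mono)
          have "(v - 2 * \<delta>) * (v - \<delta>) \<le> v * 1" using v0 v \<delta> by (intro mult_mono) auto
          then have "\<delta> * ((v - 2 * \<delta>) * (v - \<delta>)) \<le> \<delta> * v" using \<delta> by (intro mult_left_mono) auto
          then have "\<delta> \<le> \<delta> * v / ((v - 2 * \<delta>) * (v - \<delta>))" using v0 by (simp add: pos_le_divide_eq)
          also have "\<dots> = v / (v - 2 * \<delta>) - v / (v - \<delta>)" using v0 by (simp add: field_simps)
          finally show "\<delta> \<le> v / (v - 2 * \<delta>) - v / (v - \<delta>)" .
          have "0 \<le> real K / (2 * v)" using v0 by simp
          then show "0 \<le> S" using v(3) by linarith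
        qed
        finally show ?thesis .
      qed
      have c: "1 \<le> v / (v - \<delta>)" "v / (v - \<delta>) \<le> v / (v - 2 * \<delta>)" if "\<eta> \<le> v" for v
        using that \<delta> \<eta> by (auto simp: frac_le)
      have "R \<le> real_of_int \<bar>exit_time (rescale ?f (x_sites {\<kappa>..K} \<union> y_sites {\<kappa>..K}) w) z\<bar>"
        if z: "z \<in> pos_quadrant - {0..char_point \<rho> N}" for z
      proof (rule exit_time_tilted_ge[where m=m and n=n and t=t and s=s and s'=s'
            and cx="(1 - \<rho>) / (1 - \<rho> - \<delta>)" and cy="\<rho> / (\<rho> - \<delta>)"
            and dx="(1 - \<rho>) / (1 - \<rho> - 2 * \<delta>)" and dy="\<rho> / (\<rho> - 2 * \<delta>)"])
        note ge = scaled_passage_ge_exit[OF m(3) n(3), of _ _ w]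
        show "x_sum w k + x_tail w m n k \<le> t" if "k \<in> {1..m}" for k
          using ge(1)[OF that, of 1 "\<rho> / (\<rho> + \<delta>\<^sub>0)"] good(1) by simp
        show "y_sum w k + y_tail w m n k \<le> t" if "k \<in> {1..n}" for k
          using ge(2)[OF that, of 1 "(1 - \<rho>) / (1 - \<rho> + \<delta>\<^sub>0)"] good(2) by simp
        show "(1 - \<rho>) / (1 - \<rho> - 2 * \<delta>) * x_sum w k + x_tail w m n k < s'" if "k \<in> {1..m}" for k
          using ge(1)[OF that, of "(1 - \<rho>) / (1 - \<rho> - 2 * \<delta>)" "\<rho> / (\<rho> + 3 * \<delta>)"] good(5) by simp
        show "\<rho> / (\<rho> - 2 * \<delta>) * y_sum w k + y_tail w m n k < s'" if "k \<in> {1..n}" for k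
          using ge(2)[OF that, of "\<rho> / (\<rho> - 2 * \<delta>)" "(1 - \<rho>) / (1 - \<rho> + 3 * \<delta>)"] good(6) by simp
        have xy0: "0 \<le> x_sum w \<kappa>" "0 \<le> y_sum w \<kappa>"
          using monoD[OF mono_x_sum[of w], of 0 \<kappa>] monoD[OF mono_y_sum[of w], of 0 \<kappa>] w(1) by auto
        show "((1 - \<rho>) / (1 - \<rho> - \<delta>) - 1) * x_sum w \<kappa> \<le> s - t" by (rule seg[OF \<eta>(2) xy0(1) good(7)])
        show "(\<rho> / (\<rho> - \<delta>) - 1) * y_sum w \<kappa> \<le> s - t" by (rule seg[OF \<eta>(3) xy0(2) good(8)])
        show "s' - s \<le> ((1 - \<rho>) / (1 - \<rho> - 2 * \<delta>) - (1 - \<rho>) / (1 - \<rho> - \<delta>)) * x_sum w K"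
          by (rule far[OF \<eta>(2) _ good(9)]) (use \<rho> in simp)
        show "s' - s \<le> (\<rho> / (\<rho> - 2 * \<delta>) - \<rho> / (\<rho> - \<delta>)) * y_sum w K"
          by (rule far[OF \<eta>(3) _ good(10)]) (use \<rho> in simp)
        show "int m \<le> fst z \<or> int n \<le> snd z"
          using outside_char_box[OF z N(1)] by (simp only: m_def n_def)
        show "z \<in> pos_quadrant" using z by simp
        show "weight_rate \<rho> (int i, 0) / (weight_rate \<rho> (int i, 0) - \<delta>) = (1 - \<rho>) / (1 - \<rho> - \<delta>)" for i
          by (simp add: weight_rate_def)
        show "weight_rate \<rho> (0, int j) / (weight_rate \<rho> (0, int j) - \<delta>) = \<rho> / (\<rho> - \<delta>)" if "1 \<le> j" for j
          using that by (simp add: weight_rate_def)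
      qed (use m(3) n(3) \<kappa> K(1) ts good(3,4) c[OF \<eta>(2)] c[OF \<eta>(3)] w(1) in auto)
      then show "w \<in> {w \<in> space configurations.
          rescale ?f (x_sites {\<kappa>..K} \<union> y_sites {\<kappa>..K}) w \<in> far_exits \<rho> N R}"
        using ws measurable_space[OF rm ws] by (simp add: far_exits_def)
    qed
  qed
  finally show ?thesis by (simp only: N_def R_def)
qed

lemma far_exits_lower_bound_moderate:
  fixes \<rho> q r :: real
  assumes \<rho>: "0 < \<rho>" "\<rho> < 1" and q: "1 \<le> q" and r: "128 \<le> r"
  defines "\<eta> \<equiv> min (1 - \<rho>) \<rho>" and "B \<equiv> 4 / ((1 - \<rho>) * \<rho>)"
  defines "a \<equiv> 8 / \<eta>\<^sup>2 + B + 3"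
  defines "b \<equiv> 18 * B * a"
  assumes small: "12 * a * r \<le> \<eta> * q"
  shows "exp (- (8 * a\<^sup>2 * b / \<eta>\<^sup>2 + 1) * r ^ 3)
    \<le> measure (stationary_measure \<rho>) (far_exits \<rho> (q ^ 3) (r * q\<^sup>2))"
proof -
  define \<delta> where "\<delta> = a * r / q"
  define R where "R = r * q\<^sup>2"
  define \<kappa> where "\<kappa> = nat \<lceil>R\<rceil>"
  define K where "K = nat \<lceil>b * R\<rceil>"
  let ?F = "x_sites {\<kappa>..K} \<union> y_sites {\<kappa>..K}"
  have \<eta>: "0 < \<eta>" "\<eta> \<le> 1 - \<rho>" "\<eta> \<le> \<rho>" using \<rho> by (auto simp: \<eta>_def)
  have B: "0 < B" using \<rho> by (simp add: B_def)
  have a: "0 < a" using \<eta> B by (simp add: a_def add_nonneg_pos)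
  have b: "1 \<le> b"
  proof -
    have "(1 - \<rho>) * \<rho> \<le> 1 * 1" using \<rho> by (intro mult_mono) auto
    then have "1 \<le> B" using \<rho> by (simp add: B_def field_simps)
    moreover have "3 \<le> a" using B by (simp add: a_def)
    ultimately have "1 * 3 \<le> B * a" by (intro mult_mono) auto
    then show ?thesis by (simp add: b_def)
  qed
  have R: "1 \<le> R"
  proof -
    have "1 * 1 \<le> r * q\<^sup>2" using q r by (intro mult_mono) auto
    then show ?thesis by (simp add: R_def)
  qed
  have bR: "1 * 1 \<le> b * R" using b R by (intro mult_mono) auto
  have \<kappa>: "1 \<le> \<kappa>" using R unfolding \<kappa>_def by linarith
  have K: "real K \<le> 2 * (b * R)" using bR unfolding K_def by linarith
  have \<delta>: "0 \<le> \<delta>" "12 * \<delta> \<le> \<eta>" using a q r small by (simp_all add: \<delta>_def pos_divide_le_eq)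
  have fin: "finite ?F" and sub: "?F \<subseteq> weight_sites"
    using \<kappa> by (simp_all add: x_sites_simps y_sites_simps)
  have "card ?F \<le> card (x_sites {\<kappa>..K}) + card (y_sites {\<kappa>..K})" by (rule card_Un_le)
  also have "\<dots> \<le> 2 * K" using \<kappa> by (simp add: x_sites_simps y_sites_simps)
  finally have card: "real (card ?F) \<le> 4 * (b * R)" using K by linarith
  have rate: "\<eta> \<le> weight_rate \<rho> p" if "p \<in> ?F" for p
    using that \<eta> \<kappa> weight_rate_x_sites[of p "{\<kappa>..K}" \<rho>] weight_rate_y_sites[of "{\<kappa>..K}" p \<rho>] by auto
  have "1 / 2 \<le> measure (stationary_measure \<rho>) {w \<in> space configurations.
      rescale (\<lambda>p. weight_rate \<rho> p / (weight_rate \<rho> p - \<delta>)) ?F w \<in> far_exits \<rho> (q ^ 3) (r * q\<^sup>2)}"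
    using tilted_far_exit_likely[OF \<rho> q r, folded \<eta>_def B_def, folded a_def, folded b_def \<delta>_def R_def,
      folded \<kappa>_def K_def, OF \<delta>(2)] by (simp only: R_def)
  then have cost: "exp (- (2 * \<delta>\<^sup>2 / \<eta>\<^sup>2 * real (card ?F))) / 16
      \<le> measure (stationary_measure \<rho>) (far_exits \<rho> (q ^ 3) (r * q\<^sup>2))"
    unfolding stationary_eq_weights_law
    using \<delta> \<eta>(1)
    by (intro tilt_cost[OF fin sub weight_rate_pos[OF \<rho>] rate _ _ _ far_exits_sets]) auto
  have "2 * \<delta>\<^sup>2 / \<eta>\<^sup>2 * real (card ?F) \<le> 2 * \<delta>\<^sup>2 / \<eta>\<^sup>2 * (4 * (b * R))"
    using card by (intro mult_left_mono) auto
  also have "\<dots> = 8 * a\<^sup>2 * b / \<eta>\<^sup>2 * r ^ 3"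
    using q by (simp add: \<delta>_def R_def power_divide power_mult_distrib power2_eq_square power3_eq_cube)
  finally have le: "2 * \<delta>\<^sup>2 / \<eta>\<^sup>2 * real (card ?F) \<le> 8 * a\<^sup>2 * b / \<eta>\<^sup>2 * r ^ 3" .
  have "16 \<le> exp (r ^ 3)"
  proof -
    have "r ^ 1 \<le> r ^ 3" using r by (intro power_increasing) auto
    then have "128 \<le> r ^ 3" using r by simp
    then show ?thesis using exp_ge_add_one_self[of "r ^ 3"] by linarith
  qed
  then have "exp (- (r ^ 3)) \<le> 1 / 16" by (simp add: exp_minus field_simps)
  then have "exp (- (8 * a\<^sup>2 * b / \<eta>\<^sup>2 * r ^ 3)) * exp (- (r ^ 3)) \<le> exp (- (2 * \<delta>\<^sup>2 / \<eta>\<^sup>2 * real (card ?F))) * (1 / 16)"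
    using le by (intro mult_mono) auto
  moreover have "exp (- (8 * a\<^sup>2 * b / \<eta>\<^sup>2 + 1) * r ^ 3) = exp (- (8 * a\<^sup>2 * b / \<eta>\<^sup>2 * r ^ 3)) * exp (- (r ^ 3))"
    unfolding exp_add[symmetric] by (rule arg_cong[where f=exp]) (simp add: algebra_simps)
  ultimately show ?thesis using cost by simp
qed

section \<open>Large deviations\<close>

lemma weights_law_shift_pair:
  assumes pos: "\<And>z. 0 < \<alpha> z" and t: "0 \<le> t" and p: "p \<in> weight_sites" "p' \<in> weight_sites"
    and A: "A \<in> sets configurations"
  shows "measure (weights_law \<alpha>) {w \<in> space configurations. (w(p := w p + t))(p' := (w(p := w p + t)) p' + t) \<in> A}
    \<le> exp ((\<alpha> p + \<alpha> p') * t) * measure (weights_law \<alpha>) A"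
proof -
  interpret prob_space "weights_law \<alpha>" by (rule prob_space_weights_law[OF pos])
  let ?\<Psi> = "\<lambda>w. (w(p := w p + t))(p' := (w(p := w p + t)) p' + t)"
  have \<Psi>: "?\<Psi> \<in> configurations \<rightarrow>\<^sub>M configurations"
    using measurable_compose[OF measurable_shift[OF p(1)] measurable_shift[OF p(2)]] .
  have ind: "(indicator A :: _ \<Rightarrow> ennreal) \<in> borel_measurable configurations" using A by simp
  have "emeasure (weights_law \<alpha>) {w \<in> space configurations. ?\<Psi> w \<in> A}
      = (\<integral>\<^sup>+ w. indicator {w \<in> space configurations. ?\<Psi> w \<in> A} w \<partial>weights_law \<alpha>)"
  proof (rule nn_integral_indicator[symmetric])
    have "{w \<in> space configurations. ?\<Psi> w \<in> A} = ?\<Psi> -` A \<inter> space configurations" by auto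
    then show "{w \<in> space configurations. ?\<Psi> w \<in> A} \<in> events"
      using measurable_sets[OF \<Psi> A] by simp
  qed
  also have "\<dots> = (\<integral>\<^sup>+ w. indicator A (?\<Psi> w) \<partial>weights_law \<alpha>)"
    by (intro nn_integral_cong) (auto simp: indicator_def)
  also have "\<dots> \<le> ennreal (exp (\<alpha> p * t)) * (\<integral>\<^sup>+ w. indicator A (w(p' := w p' + t)) \<partial>weights_law \<alpha>)"
    by (rule nn_integral_weights_law_shift_le[OF pos t p(1) measurable_compose[OF measurable_shift[OF p(2)] ind]])
  also have "\<dots> \<le> ennreal (exp (\<alpha> p * t)) * (ennreal (exp (\<alpha> p' * t)) * (\<integral>\<^sup>+ w. indicator A w \<partial>weights_law \<alpha>))"
    by (intro mult_left_mono nn_integral_weights_law_shift_le[OF pos t p(2) ind]) simp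
  also have "\<dots> = ennreal (exp ((\<alpha> p + \<alpha> p') * t) * prob A)"
    using A by (simp add: emeasure_eq_measure ennreal_mult'[symmetric] exp_add[symmetric] algebra_simps flip: mult.assoc)
  finally show ?thesis
    unfolding emeasure_eq_measure by (subst (asm) ennreal_le_iff) auto
qed

text \<open>
  All exits towards \<open>(m, n)\<close> are worth at most a constant times \<open>N\<close> with probability at least \<open>9/10\<close>.  Adding
  that amount \<open>t\<close> to the first weight at distance at least \<open>R\<close> on each axis changes no near exit and lifts
  one far exit on each axis above \<open>t\<close>.  The bound \<open>R \<le> min ((1 - \<rho>)\<^sup>2) (\<rho>\<^sup>2) * N\<close> ensures that these sites
  do not lie beyond \<open>m\<close> and \<open>n\<close>.
\<close>

lemma far_exits_lower_bound_large:
  fixes \<rho> N R :: real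
  assumes \<rho>: "0 < \<rho>" "\<rho> < 1"
  defines "h \<equiv> min (1 - \<rho>) \<rho> / 4" and "B \<equiv> 4 / ((1 - \<rho>) * \<rho>)"
  assumes N: "16 \<le> h * N" and R: "0 < R" "R \<le> min ((1 - \<rho>)\<^sup>2) (\<rho>\<^sup>2) * N"
  shows "exp (- ((2 + h\<^sup>2 * B) * N)) / 2 \<le> measure (stationary_measure \<rho>) (far_exits \<rho> N R)"
proof -
  let ?P = "stationary_measure \<rho>"
  interpret prob_space ?P by (rule prob_space_stationary_measure[OF \<rho>])
  have h: "0 < h" "h \<le> (1 - \<rho>) / 4" "h \<le> \<rho> / 4" using \<rho> by (auto simp: h_def)
  have N0: "0 \<le> N" using N h(1) by (metis less_le_trans less_imp_le zero_less_mult_pos zero_less_numeral)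
  have B: "0 < B" using \<rho> by (simp add: B_def)
  define t where "t = (2 + h\<^sup>2 * B) * N"
  have t: "0 \<le> t" using N0 B by (simp add: t_def)
  define m n \<kappa> where "m = nat \<lfloor>N * (1 - \<rho>)\<^sup>2\<rfloor> + 1" and "n = nat \<lfloor>N * \<rho>\<^sup>2\<rfloor> + 1" and "\<kappa> = nat \<lceil>R\<rceil>"
  have fl: "0 \<le> N * (1 - \<rho>)\<^sup>2" "0 \<le> N * \<rho>\<^sup>2" using N0 by auto
  have m: "real m \<le> N * (1 - \<rho>)\<^sup>2 + 1" "1 \<le> m" and n: "real n \<le> N * \<rho>\<^sup>2 + 1" "1 \<le> n"
    unfolding m_def n_def using fl by (auto simp: nat_add_distrib)
  have R': "R \<le> N * (1 - \<rho>)\<^sup>2" "R \<le> N * \<rho>\<^sup>2"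
  proof -
    have "min ((1 - \<rho>)\<^sup>2) (\<rho>\<^sup>2) * N \<le> (1 - \<rho>)\<^sup>2 * N" "min ((1 - \<rho>)\<^sup>2) (\<rho>\<^sup>2) * N \<le> \<rho>\<^sup>2 * N"
      using N0 by (intro mult_right_mono; simp)+
    then show "R \<le> N * (1 - \<rho>)\<^sup>2" "R \<le> N * \<rho>\<^sup>2" using R(2) by (simp_all add: mult.commute)
  qed
  have \<kappa>: "1 \<le> \<kappa>" "\<And>k. real k < R \<longleftrightarrow> k < \<kappa>" "R \<le> real \<kappa>"
    using R(1) unfolding \<kappa>_def by (auto simp: nat_less_iff) linarith+
  have \<kappa>mn: "\<kappa> \<le> m" "\<kappa> \<le> n"
    using R' R(1) unfolding \<kappa>_def m_def n_def by linarith+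
  let ?p = "(int \<kappa>, 0) :: int \<times> int" and ?p' = "(0, int \<kappa>) :: int \<times> int"
  have p: "?p \<in> weight_sites" "?p' \<in> weight_sites" using \<kappa>(1) by (auto simp: weight_sites_iff)
  let ?\<Psi> = "\<lambda>w :: int \<times> int \<Rightarrow> real. (w(?p := w ?p + t))(?p' := (w(?p := w ?p + t)) ?p' + t)"
  have big: "16 \<le> h * (t - N - N * (h\<^sup>2 * (4 / ((1 - \<rho>) * \<rho>))))"
    unfolding B_def[symmetric] using N by (simp add: t_def algebra_simps)
  note near = near_exits_upper_tail[OF \<rho> N0 m(1) n(1) h big]
  let ?X = "{w \<in> space configurations. t \<le> scaled_passage 1 (\<rho> / (\<rho> + h)) w m n}"
  let ?Y = "{w \<in> space configurations. t \<le> scaled_passage ((1 - \<rho>) / (1 - \<rho> + h)) 1 w m n}"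
  have XY: "?X \<in> events" "?Y \<in> events"
    using scaled_passage_measurable unfolding sets_stationary_measure by measurable
  have "prob (?X \<union> ?Y) \<le> 1 / 20 + 1 / 20" by (rule prob_Un_le[OF XY near])
  then have "1 / 2 \<le> prob (space ?P - (?X \<union> ?Y))"
    using prob_compl[OF sets.Un[OF XY]] by simp
  also have "\<dots> \<le> prob {w \<in> space configurations. ?\<Psi> w \<in> far_exits \<rho> N R}"
  proof (rule finite_measure_mono_AE)
    have \<Psi>: "?\<Psi> \<in> configurations \<rightarrow>\<^sub>M configurations"
      using measurable_compose[OF measurable_shift[OF p(1)] measurable_shift[OF p(2)]] .
    have "{w \<in> space configurations. ?\<Psi> w \<in> far_exits \<rho> N R} = ?\<Psi> -` far_exits \<rho> N R \<inter> space configurations" by auto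
    then show "{w \<in> space configurations. ?\<Psi> w \<in> far_exits \<rho> N R} \<in> events"
      using measurable_sets[OF \<Psi> far_exits_sets] unfolding sets_stationary_measure by simp
    have "AE w in ?P. \<forall>z\<in>weight_sites. 0 < w z"
      unfolding stationary_eq_weights_law by (rule AE_weights_law_pos[OF weight_rate_pos[OF \<rho>]])
    then show "AE w in ?P. w \<in> space ?P - (?X \<union> ?Y) \<longrightarrow> w \<in> {w \<in> space configurations. ?\<Psi> w \<in> far_exits \<rho> N R}"
    proof (rule AE_mp, intro AE_I2 impI)
      fix w assume w: "\<forall>z\<in>weight_sites. 0 < w z" "w \<in> space ?P - (?X \<union> ?Y)"
      then have ws: "w \<in> space configurations" by (simp add: space_stationary_measure)
      have good: "scaled_passage 1 (\<rho> / (\<rho> + h)) w m n < t"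
        "scaled_passage ((1 - \<rho>) / (1 - \<rho> + h)) 1 w m n < t"
        using w(2) ws by (auto simp: not_le)
      let ?w = "?\<Psi> w"
      have xs: "x_sum ?w k = x_sum w k + (if k < \<kappa> then 0 else t)" for k
        using \<kappa>(1) by (induction k) (auto simp del: of_nat_Suc)
      have ys: "y_sum ?w k = y_sum w k + (if k < \<kappa> then 0 else t)" for k
        using \<kappa>(1) by (induction k) (auto simp del: of_nat_Suc)
      have x_tail: "x_tail ?w m n k = x_tail w m n k" if "1 \<le> k" for k
        using that by (intro last_passage_cong) (auto simp: less_eq_prod_def)
      have y_tail: "y_tail ?w m n k = y_tail w m n k" if "1 \<le> k" for k
        using that by (intro last_passage_cong) (auto simp: less_eq_prod_def)
      have nonneg: "0 \<le> w z" if "(k, l) \<le> z" "0 \<le> k" "0 \<le> l" "0 < k \<or> 0 < l" for z k l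
        using that w(1) by (cases z) (auto simp: less_eq_prod_def weight_sites_iff intro!: less_imp_le)
      have x0: "0 < x_sum w \<kappa>" and y0: "0 < y_sum w \<kappa>"
        unfolding x_sum_def y_sum_def using w(1) \<kappa>(1) by (auto intro!: sum_pos simp: weight_sites_iff)
      have tails: "0 \<le> x_tail w m n \<kappa>" "0 \<le> y_tail w m n \<kappa>"
      proof -
        have "(int \<kappa>, 1) \<le> (int m, int n)" "(1, int \<kappa>) \<le> (int m, int n)"
          using \<kappa>mn m(2) n(2) by (auto simp: less_eq_prod_def)
        then show "0 \<le> x_tail w m n \<kappa>" "0 \<le> y_tail w m n \<kappa>"
          using nonneg[of "int \<kappa>" 1] nonneg[of 1 "int \<kappa>"] by (auto intro: last_passage_nonneg)
      qed
      note ge = scaled_passage_ge_exit[OF m(2) n(2), of _ _ w]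
      have "R \<le> real_of_int \<bar>exit_time ?w z\<bar>" if z: "z \<in> pos_quadrant - {0..char_point \<rho> N}" for z
      proof (rule exit_time_ge_outside_box[OF m(2) n(2)])
        fix k assume "k \<in> {1..m}" "real k < R"
        then show "x_sum ?w k + x_tail ?w m n k \<le> t"
          using ge(1)[of k 1 "\<rho> / (\<rho> + h)"] good(1) \<kappa>(2) xs[of k] x_tail[of k] by simp
      next
        fix k assume "k \<in> {1..n}" "real k < R"
        then show "y_sum ?w k + y_tail ?w m n k \<le> t"
          using ge(2)[of k 1 "(1 - \<rho>) / (1 - \<rho> + h)"] good(2) \<kappa>(2) ys[of k] y_tail[of k] by simp
      next
        show "\<exists>k\<in>{1..m}. R \<le> real k \<and> t < x_sum ?w k + x_tail ?w m n k"
          using \<kappa> \<kappa>mn x0 tails xs[of \<kappa>] x_tail[of \<kappa>] by (intro bexI[of _ \<kappa>]) auto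
        show "\<exists>k\<in>{1..n}. R \<le> real k \<and> t < y_sum ?w k + y_tail ?w m n k"
          using \<kappa> \<kappa>mn y0 tails ys[of \<kappa>] y_tail[of \<kappa>] by (intro bexI[of _ \<kappa>]) auto
        show "int m \<le> fst z \<or> int n \<le> snd z"
          using outside_char_box[OF z N0] by (simp only: m_def n_def)
        show "z \<in> pos_quadrant" using z by simp
      qed
      then show "w \<in> {w \<in> space configurations. ?\<Psi> w \<in> far_exits \<rho> N R}"
        using ws measurable_space[OF \<Psi> ws] unfolding far_exits_def by blast
    qed
  qed
  also have "\<dots> \<le> exp ((weight_rate \<rho> ?p + weight_rate \<rho> ?p') * t) * prob (far_exits \<rho> N R)"
    unfolding stationary_eq_weights_law
    by (rule weights_law_shift_pair[OF weight_rate_pos[OF \<rho>] t p far_exits_sets])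
  also have "weight_rate \<rho> ?p + weight_rate \<rho> ?p' = 1" using \<kappa>(1) by (simp add: weight_rate_def)
  finally have "1 / 2 \<le> exp t * prob (far_exits \<rho> N R)" by simp
  then have "exp (- t) * (1 / 2) \<le> exp (- t) * (exp t * prob (far_exits \<rho> N R))"
    by (intro mult_left_mono) auto
  also have "\<dots> = prob (far_exits \<rho> N R)"
    by (simp add: exp_minus)
  finally show ?thesis by (simp add: t_def)
qed

theorem theorem4p1:
  fixes \<rho> :: real
  assumes "0 < \<rho>" and "\<rho> < 1"
  shows "\<exists>r\<^sub>0 C N\<^sub>0 :: real. r\<^sub>0 > 0 \<and> C > 0 \<and> N\<^sub>0 > 0 \<and>
    (\<forall>N r :: real. N \<ge> N\<^sub>0 \<longrightarrow> r\<^sub>0 \<le> r \<longrightarrow> r \<le> min ((1 - \<rho>)\<^sup>2) (\<rho>\<^sup>2) * N powr (1 / 3) \<longrightarrow>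
      measure (stationary_measure \<rho>)
        {w \<in> space (stationary_measure \<rho>).
           \<forall>z \<in> pos_quadrant - {0..char_point \<rho> N}.
             real_of_int \<bar>exit_time w z\<bar> \<ge> r * N powr (2 / 3)}
      \<ge> exp (- C * r ^ 3))"
proof -
  define \<eta> B where "\<eta> = min (1 - \<rho>) \<rho>" and "B = 4 / ((1 - \<rho>) * \<rho>)"
  define a where "a = 8 / \<eta>\<^sup>2 + B + 3"
  define b where "b = 18 * B * a"
  define h where "h = \<eta> / 4"
  define \<epsilon> where "\<epsilon> = \<eta> / (12 * a)"
  define C1 C2 where "C1 = 8 * a\<^sup>2 * b / \<eta>\<^sup>2 + 1" and "C2 = (2 + h\<^sup>2 * B) / \<epsilon> ^ 3 + 1"
  have \<eta>: "0 < \<eta>" using assms by (simp add: \<eta>_def)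
  have B: "0 < B" using assms by (simp add: B_def)
  have a: "0 < a" using B by (simp add: a_def add_nonneg_pos)
  have b: "0 < b" using a B by (simp add: b_def)
  have h: "0 < h" using \<eta> by (simp add: h_def)
  have \<epsilon>: "0 < \<epsilon>" using \<eta> a by (simp add: \<epsilon>_def)
  have C: "0 < C1" "0 < C2" using \<eta> a b B \<epsilon> by (auto simp: C1_def C2_def intro!: add_nonneg_pos)
  have main: "exp (- (C1 + C2) * r ^ 3) \<le> measure (stationary_measure \<rho>) (far_exits \<rho> N (r * N powr (2 / 3)))"
    if N: "1 + 16 / h \<le> N" and r: "128 \<le> r" "r \<le> min ((1 - \<rho>)\<^sup>2) (\<rho>\<^sup>2) * N powr (1 / 3)" for N r
  proof -
    define q where "q = N powr (1 / 3)"
    have "0 < 16 / h" using h by simp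
    with N have N1: "1 \<le> N" by linarith
    have q: "1 \<le> q" using N1 by (simp add: q_def ge_one_powr_ge_zero)
    have q3: "q ^ 3 = N" and q2: "q\<^sup>2 = N powr (2 / 3)"
      using N1 by (simp_all add: q_def powr_power)
    have r3: "1 \<le> r ^ 3" using r(1) by (intro one_le_power) simp
    show ?thesis
    proof (cases "r \<le> \<epsilon> * q")
      case True
      then have "12 * a * r \<le> \<eta> * q" using a by (simp add: \<epsilon>_def field_simps)
      then have "exp (- C1 * r ^ 3) \<le> measure (stationary_measure \<rho>) (far_exits \<rho> (q ^ 3) (r * q\<^sup>2))"
        using far_exits_lower_bound_moderate[OF assms q r(1), folded \<eta>_def B_def, folded a_def, folded b_def, folded C1_def]
        by simp
      moreover have "0 \<le> C2 * r ^ 3" by (intro mult_nonneg_nonneg) (use C r3 in linarith)+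
      then have "exp (- (C1 + C2) * r ^ 3) \<le> exp (- C1 * r ^ 3)" by (simp add: algebra_simps)
      ultimately show ?thesis unfolding q3 q2 by linarith
    next
      case False
      have hN: "16 \<le> h * N"
      proof -
        have "16 / h \<le> N" using N by linarith
        then show ?thesis using h by (simp add: field_simps)
      qed
      have "r * N powr (2 / 3) \<le> (min ((1 - \<rho>)\<^sup>2) (\<rho>\<^sup>2) * q) * q\<^sup>2"
        unfolding q2[symmetric] using r(2) by (intro mult_right_mono) (simp_all add: q_def)
      also have "\<dots> = min ((1 - \<rho>)\<^sup>2) (\<rho>\<^sup>2) * N"
        using q3 by (simp add: power2_eq_square power3_eq_cube mult.assoc)
      finally have R: "r * N powr (2 / 3) \<le> min ((1 - \<rho>)\<^sup>2) (\<rho>\<^sup>2) * N" .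
      have "0 < r * N powr (2 / 3)" using r(1) N1 by simp
      from far_exits_lower_bound_large[OF assms, folded \<eta>_def B_def, folded h_def, OF hN this R]
      have large: "exp (- ((2 + h\<^sup>2 * B) * N)) / 2
          \<le> measure (stationary_measure \<rho>) (far_exits \<rho> N (r * N powr (2 / 3)))" .
      have "\<epsilon> ^ 3 * N \<le> r ^ 3"
      proof -
        have "(\<epsilon> * q) ^ 3 \<le> r ^ 3" using False \<epsilon> q by (intro power_mono) auto
        then show ?thesis using q3 by (simp add: power_mult_distrib)
      qed
      then have "N \<le> r ^ 3 / \<epsilon> ^ 3" using \<epsilon> by (simp add: field_simps)
      then have "(2 + h\<^sup>2 * B) * N \<le> (2 + h\<^sup>2 * B) * (r ^ 3 / \<epsilon> ^ 3)"
        using B by (intro mult_left_mono) auto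
      then have "(2 + h\<^sup>2 * B) * N + 1 \<le> C2 * r ^ 3"
        using r3 by (simp add: C2_def algebra_simps)
      moreover have "0 \<le> C1 * r ^ 3" by (intro mult_nonneg_nonneg) (use C r3 in linarith)+
      ultimately have "exp (- (C1 + C2) * r ^ 3) \<le> exp (- ((2 + h\<^sup>2 * B) * N) - 1)"
        by (simp add: algebra_simps)
      also have "\<dots> = exp (- ((2 + h\<^sup>2 * B) * N)) / exp 1" by (simp add: exp_diff)
      also have "\<dots> \<le> exp (- ((2 + h\<^sup>2 * B) * N)) / 2"
        using exp_ge_add_one_self[of 1] by (intro divide_left_mono) auto
      finally show ?thesis using large by linarith
    qed
  qed
  show ?thesis
  proof (rule exI[of _ 128], rule exI[of _ "C1 + C2"], rule exI[of _ "1 + 16 / h"], intro conjI allI impI)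
    show "0 < C1 + C2" "0 < 1 + 16 / h" using C h by (auto intro!: add_pos_pos)
    fix N r :: real
    assume "1 + 16 / h \<le> N" "128 \<le> r" "r \<le> min ((1 - \<rho>)\<^sup>2) (\<rho>\<^sup>2) * N powr (1 / 3)"
    from main[OF this] show "exp (- (C1 + C2) * r ^ 3) \<le> measure (stationary_measure \<rho>)
        {w \<in> space (stationary_measure \<rho>). \<forall>z \<in> pos_quadrant - {0..char_point \<rho> N}.
           r * N powr (2 / 3) \<le> real_of_int \<bar>exit_time w z\<bar>}"
      by (simp only: far_exits_def space_stationary_measure)
  qed simp
qed

end
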